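(* Let $a,b>0$ be constants with $a+b<\tfrac12$. There exists $\varepsilon_0>0$ such that for every fixed $0<\varepsilon<\varepsilon_0$ the following holds. Let $n\to\infty$ and let $\boldsymbol{s}=(s_1,\dots,s_n)$, $\boldsymbol{t}=(t_1,\dots,t_n)$ be vectors of positive integers with equal sums such that uniformly $s_j-s=O(n^{1/2+\varepsilon})$ and $t_k-s=O(n^{1/2+\varepsilon})$, and $\frac{(1-2\lambda)^2}{3A}\le a\log n$. Then the expected permanent of a uniformly random $n\times n$ matrix over $\{0,1\}$ with row sums $\boldsymbol{s}$ and column sums $\boldsymbol{t}$ is \[ n!\,\lambda^n\exp\Bigl(\frac{1-\lambda}{2\lambda}-\frac{R+C}{2\lambda^2n^2}+O(n^{-b})\Bigr).\]
   Context: $s=n^{-1}\sum_js_j=n^{-1}\sum_kt_k$, $\lambda=s/n$, $A=\tfrac12\lambda(1-\lambda)$, $R=\sum_{j=1}^n(s_j-s)^2$, $C=\sum_{k=1}^n(t_k-s)^2$. The random matrix is uniformly distributed over all $n\times n$ 0-1 matrices with these row and column sums. Asymptotic notation refers to $n\to\infty$. (The hypotheses are those of the paper's main enumeration theorem with $m=n$, in which case the density condition $\frac{(1-2\lambda)^2}{8A}(1+\frac{5m}{6n}+\frac{5n}{6m})\le a\log n$ becomes $\frac{(1-2\lambda)^2}{3A}\le a\log n$.) *)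

theory Defs
  imports Complex_Main "HOL-Combinatorics.Permutations"
begin

definition zo_matrices :: "nat \<Rightarrow> (nat \<Rightarrow> nat) \<Rightarrow> (nat \<Rightarrow> nat) \<Rightarrow> (nat \<Rightarrow> nat \<Rightarrow> nat) set" where
  "zo_matrices n s t = {M. (\<forall>i j. M i j \<le> 1)
      \<and> (\<forall>i j. (n \<le> i \<or> n \<le> j) \<longrightarrow> M i j = 0)
      \<and> (\<forall>i<n. (\<Sum>j<n. M i j) = s i)
      \<and> (\<forall>j<n. (\<Sum>i<n. M i j) = t j)}"

definition perm_mat :: "nat \<Rightarrow> (nat \<Rightarrow> nat \<Rightarrow> nat) \<Rightarrow> nat" where
  "perm_mat n M = (\<Sum>\<sigma> | \<sigma> permutes {..<n}. \<Prod>i<n. M i (\<sigma> i))"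

definition expected_perm :: "nat \<Rightarrow> (nat \<Rightarrow> nat) \<Rightarrow> (nat \<Rightarrow> nat) \<Rightarrow> real" where
  "expected_perm n s t =
     (\<Sum>M\<in>zo_matrices n s t. real (perm_mat n M)) / real (card (zo_matrices n s t))"

end

theory Submission
  imports Defs "HOL-Real_Asymp.Real_Asymp"
begin

text \<open>
  Write \<open>E perm\<close> as the sum over permutations \<open>\<sigma>\<close> of the probability that the random matrix \<open>M\<close> has ones
  along \<open>\<sigma>\<close>, and expose these ones row by row; it suffices to know each conditional entry probability
  up to an error \<open>n powr (-3/2 + o(1))\<close>.

  Given all rows but \<open>j\<close> and \<open>m\<close>, the columns in which these two rows differ are split between them
  uniformly.  With \<open>H\<close> the number of such columns this yields the exact identity
  \<open>E (M j k - M m k) = (s j - s m) * E (1[M j k \<noteq> M m k] / H)\<close>, up to a correction for the entries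
  already exposed.  Averaging it over \<open>m\<close> expresses \<open>E (M j k)\<close> through the right-hand sides, and these
  are compared for different columns \<open>k\<close> by the same identity for a pair of columns.  The resulting
  expression is needed to leading order only, which follows from the concentration of \<open>H\<close>; the latter is
  an exchangeable-pair argument, as is the final averaging over \<open>\<sigma>\<close>.

  All asymptotics are carried by two parameters: \<open>y = sqrt n\<close> and \<open>x = n powr \<epsilon>\<close>, the latter absorbing
  constants and logarithms.
\<close>

section \<open>Exchangeable pairs\<close>

text \<open>The accuracy is dictated by the product of \<open>n\<close> conditional probabilities:
  an error \<open>n powr (-3/2)\<close> in each costs \<open>n powr (-1/2)\<close> in the logarithm,
  up to powers of \<open>x\<close>. Concentration of \<open>H\<close> alone is too weak for this. It
  determines \<open>1 / H\<close> only up to \<open>n powr (-3/2)\<close>, and the prefactor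
  \<open>s j - s m\<close> may be of order \<open>sqrt n\<close>, so an error of order
  \<open>1 / n\<close> would remain. Hence the mean of \<open>1[M j k \<noteq> M m k] / H\<close> is
  wanted up to \<open>n powr (-2)\<close>. Summed over \<open>k\<close> it is 1 unless
  \<open>H = 0\<close>, so its differences between columns suffice; exchanging entries of two
  columns turns such a difference into \<open>t k - t l\<close> times a mean of two reciprocal
  counts, and there the leading order is accurate enough.

  In the result, each planted entry raises later conditional probabilities by
  \<open>(1 - lam) / n ^ 2\<close>, which accumulates to \<open>(1 - lam) / (2 * lam)\<close>. The
  squares in the expansion of the logarithm give the term in \<open>R + C\<close>. Only the product
  of row and column deviations depends on \<open>\<sigma>\<close>, and it averages out.\<close>

lemma exp_diff_le:
  fixes u v :: real
  shows "(u - v) * (exp u - exp v) \<le> (u - v)\<^sup>2 * (exp u + exp v)"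
proof -
  have *: "(u - v) * (exp u - exp v) \<le> (u - v)\<^sup>2 * exp u" if "v \<le> u" for u v :: real
  proof -
    have "1 + (v - u) \<le> exp (v - u)" by (rule exp_ge_add_one_self)
    then have "exp u * (1 + (v - u)) \<le> exp u * exp (v - u)" by simp
    also have "\<dots> = exp v" by (simp flip: exp_add)
    finally have "exp u - exp v \<le> (u - v) * exp u" by (simp add: algebra_simps)
    then have "(u - v) * (exp u - exp v) \<le> (u - v) * ((u - v) * exp u)"
      using that by (intro mult_left_mono) auto
    then show ?thesis by (simp add: power2_eq_square)
  qed
  have p: "0 \<le> (u - v)\<^sup>2 * exp u" "0 \<le> (u - v)\<^sup>2 * exp v" by auto
  show ?thesis
  proof (cases "v \<le> u")
    case True
    then show ?thesis using *[of v u] p unfolding distrib_left by linarith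
  next
    case False
    have "(u - v) * (exp u - exp v) = (v - u) * (exp v - exp u)" by (simp add: algebra_simps)
    then show ?thesis using *[of u v] p False unfolding distrib_left power2_commute[of v u] by linarith
  qed
qed

text \<open>Chatterjee's method of exchangeable pairs. Each \<open>\<tau> q\<close> is an involution
  of \<open>S\<close> and preserves the uniform measure; \<open>lin\<close> says that the
  antisymmetric differences average back to \<open>f\<close>, which forces \<open>f\<close> to have
  mean zero. Symmetrising the derivative of the moment generating function makes a difference of
  exponentials appear, and \<open>var\<close> bounds it by
  \<open>\<phi>' z \<le> v * z * \<phi> z\<close>. The weights need not sum to 1, so
  \<open>lin\<close> needs no scaling constant.\<close>

lemma exchange_subgaussian:
  fixes f :: "'a \<Rightarrow> real" and w :: "'q \<Rightarrow> 'a \<Rightarrow> real" and \<tau> :: "'q \<Rightarrow> 'a \<Rightarrow> 'a"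
  assumes fS: "finite S" and fQ: "finite Q"
    and \<tau>S: "\<And>q x. q \<in> Q \<Longrightarrow> x \<in> S \<Longrightarrow> \<tau> q x \<in> S"
    and \<tau>\<tau>: "\<And>q x. q \<in> Q \<Longrightarrow> x \<in> S \<Longrightarrow> \<tau> q (\<tau> q x) = x"
    and w\<tau>: "\<And>q x. q \<in> Q \<Longrightarrow> x \<in> S \<Longrightarrow> w q (\<tau> q x) = w q x"
    and w0: "\<And>q x. q \<in> Q \<Longrightarrow> x \<in> S \<Longrightarrow> 0 \<le> w q x"
    and lin: "\<And>x. x \<in> S \<Longrightarrow> (\<Sum>q\<in>Q. w q x * (f x - f (\<tau> q x))) = f x"
    and var: "\<And>x. x \<in> S \<Longrightarrow> (\<Sum>q\<in>Q. w q x * (f x - f (\<tau> q x))\<^sup>2) \<le> v"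
    and th: "0 \<le> \<theta>"
  shows "(\<Sum>x\<in>S. exp (\<theta> * f x)) \<le> card S * exp (v * \<theta>\<^sup>2 / 2)"
proof -
  define \<phi> where "\<phi> z = (\<Sum>x\<in>S. exp (z * f x))" for z
  define \<phi>' where "\<phi>' z = (\<Sum>x\<in>S. f x * exp (z * f x))" for z
  have swap: "(\<Sum>x\<in>S. g (\<tau> q x)) = (\<Sum>x\<in>S. g x)" if "q \<in> Q" for g :: "'a \<Rightarrow> real" and q
    by (rule sum.reindex_bij_witness[of S "\<tau> q" "\<tau> q"]) (use that \<tau>S \<tau>\<tau> in auto)
  have key: "\<phi>' z \<le> v * z * \<phi> z" if z: "0 \<le> z" for z
  proof -
    have A: "\<phi>' z = (\<Sum>q\<in>Q. \<Sum>x\<in>S. w q x * (f x - f (\<tau> q x)) * exp (z * f x))"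
    proof -
      have "\<phi>' z = (\<Sum>x\<in>S. \<Sum>q\<in>Q. w q x * (f x - f (\<tau> q x)) * exp (z * f x))"
        unfolding \<phi>'_def by (rule sum.cong[OF refl]) (simp add: lin flip: sum_distrib_right)
      then show ?thesis by (subst sum.swap)
    qed
    have B: "(\<Sum>x\<in>S. w q x * (f x - f (\<tau> q x)) * exp (z * f x))
        \<le> z * (\<Sum>x\<in>S. w q x * (f x - f (\<tau> q x))\<^sup>2 * exp (z * f x))" (is "?L \<le> z * ?R") if q: "q \<in> Q" for q
    proof -
      have L2: "?L = (\<Sum>x\<in>S. w q x * (f (\<tau> q x) - f x) * exp (z * f (\<tau> q x)))"
        by (subst swap[OF q, symmetric], rule sum.cong) (use q w\<tau> \<tau>\<tau> in auto)
      have R2: "?R = (\<Sum>x\<in>S. w q x * (f x - f (\<tau> q x))\<^sup>2 * exp (z * f (\<tau> q x)))"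
        by (subst swap[OF q, symmetric], rule sum.cong) (use q w\<tau> \<tau>\<tau> in \<open>auto simp: power2_commute\<close>)
      \<comment> \<open>The sum equals its image under \<open>\<tau> q\<close>, in which the
        difference of \<open>f\<close> changes sign; adding both produces
        \<open>exp (z * f x) - exp (z * f (\<tau> q x))\<close>.\<close>
      have "2 * ?L = ?L + (\<Sum>x\<in>S. w q x * (f (\<tau> q x) - f x) * exp (z * f (\<tau> q x)))"
        using L2 by simp
      also have "\<dots> = (\<Sum>x\<in>S. w q x * ((f x - f (\<tau> q x)) * (exp (z * f x) - exp (z * f (\<tau> q x)))))"
        unfolding sum.distrib[symmetric] by (rule sum.cong) (auto simp: algebra_simps)
      also have "\<dots> \<le> (\<Sum>x\<in>S. w q x * (z * (f x - f (\<tau> q x))\<^sup>2 * (exp (z * f x) + exp (z * f (\<tau> q x)))))"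
      proof (intro sum_mono mult_left_mono)
        fix x assume x: "x \<in> S"
        show "0 \<le> w q x" using w0[OF q x] .
        show "(f x - f (\<tau> q x)) * (exp (z * f x) - exp (z * f (\<tau> q x)))
          \<le> z * (f x - f (\<tau> q x))\<^sup>2 * (exp (z * f x) + exp (z * f (\<tau> q x)))"
        proof (cases "z = 0")
          case False
          have "z * ((f x - f (\<tau> q x)) * (exp (z * f x) - exp (z * f (\<tau> q x))))
              \<le> z * (z * (f x - f (\<tau> q x))\<^sup>2 * (exp (z * f x) + exp (z * f (\<tau> q x))))"
            using exp_diff_le[of "z * f x" "z * f (\<tau> q x)"]
            by (simp add: algebra_simps power2_eq_square)
          then show ?thesis using False z by simp
        qed auto
      qed
      also have "\<dots> = z * ?R + z * (\<Sum>x\<in>S. w q x * (f x - f (\<tau> q x))\<^sup>2 * exp (z * f (\<tau> q x)))"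
        unfolding sum_distrib_left sum.distrib[symmetric] by (rule sum.cong) (auto simp: algebra_simps)
      also have "\<dots> = 2 * (z * ?R)" using R2 by simp
      finally show ?thesis by simp
    qed
    have "\<phi>' z \<le> (\<Sum>q\<in>Q. z * (\<Sum>x\<in>S. w q x * (f x - f (\<tau> q x))\<^sup>2 * exp (z * f x)))"
      unfolding A by (intro sum_mono B)
    also have "\<dots> = z * (\<Sum>x\<in>S. (\<Sum>q\<in>Q. w q x * (f x - f (\<tau> q x))\<^sup>2) * exp (z * f x))"
      by (simp add: sum_distrib_left[symmetric] sum_distrib_right sum.swap[of _ S Q])
    also have "\<dots> \<le> z * (\<Sum>x\<in>S. v * exp (z * f x))"
      by (intro mult_left_mono sum_mono mult_right_mono var z) auto
    also have "\<dots> = v * z * \<phi> z" by (simp add: \<phi>_def sum_distrib_left mult_ac)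
    finally show ?thesis .
  qed
  \<comment> \<open>Gronwall: with this integrating factor, \<open>key\<close> makes
    \<open>g\<close> nonincreasing for nonnegative arguments.\<close>
  define g where "g z = \<phi> z * exp (- v * z\<^sup>2 / 2)" for z
  have D\<phi>: "(\<phi> has_real_derivative \<phi>' z) (at z)" for z
    unfolding \<phi>_def \<phi>'_def by (auto intro!: derivative_eq_intros simp: mult_ac)
  have Dg: "(g has_real_derivative (\<phi>' z - v * z * \<phi> z) * exp (- v * z\<^sup>2 / 2)) (at z)" for z
    unfolding g_def by (auto intro!: derivative_eq_intros D\<phi> simp: algebra_simps)
  have "g \<theta> \<le> g 0"
    by (rule DERIV_nonpos_imp_nonincreasing[OF th]) (use Dg key in \<open>force intro: mult_nonpos_nonneg\<close>)
  also have "g 0 = card S" by (simp add: g_def \<phi>_def)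
  finally have "\<phi> \<theta> * exp (- v * \<theta>\<^sup>2 / 2) \<le> card S" by (simp add: g_def)
  then have "\<phi> \<theta> * exp (- v * \<theta>\<^sup>2 / 2) * exp (v * \<theta>\<^sup>2 / 2) \<le> card S * exp (v * \<theta>\<^sup>2 / 2)"
    by (intro mult_right_mono) auto
  then show ?thesis unfolding \<phi>_def by (simp add: mult.assoc flip: exp_add)
qed

lemma exchange_tail:
  fixes f :: "'a \<Rightarrow> real" and w :: "'q \<Rightarrow> 'a \<Rightarrow> real" and \<tau> :: "'q \<Rightarrow> 'a \<Rightarrow> 'a"
  assumes fS: "finite S" and fQ: "finite Q"
    and \<tau>S: "\<And>q x. q \<in> Q \<Longrightarrow> x \<in> S \<Longrightarrow> \<tau> q x \<in> S"
    and \<tau>\<tau>: "\<And>q x. q \<in> Q \<Longrightarrow> x \<in> S \<Longrightarrow> \<tau> q (\<tau> q x) = x"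
    and w\<tau>: "\<And>q x. q \<in> Q \<Longrightarrow> x \<in> S \<Longrightarrow> w q (\<tau> q x) = w q x"
    and w0: "\<And>q x. q \<in> Q \<Longrightarrow> x \<in> S \<Longrightarrow> 0 \<le> w q x"
    and lin: "\<And>x. x \<in> S \<Longrightarrow> (\<Sum>q\<in>Q. w q x * (f x - f (\<tau> q x))) = f x"
    and var: "\<And>x. x \<in> S \<Longrightarrow> (\<Sum>q\<in>Q. w q x * (f x - f (\<tau> q x))\<^sup>2) \<le> v"
    and v: "0 < v" and z: "0 \<le> z"
  shows "card {x \<in> S. z < f x} \<le> card S * exp (- z\<^sup>2 / (2 * v))"
proof -
  \<comment> \<open>The minimiser of the Chernoff exponent
    \<open>v * \<theta>\<^sup>2 / 2 - \<theta> * z\<close>.\<close>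
  define \<theta> where "\<theta> = z / v"
  have th: "0 \<le> \<theta>" using v z by (simp add: \<theta>_def)
  have "card {x \<in> S. z < f x} * exp (\<theta> * z) = (\<Sum>x\<in>{x \<in> S. z < f x}. exp (\<theta> * z))" by simp
  also have "\<dots> \<le> (\<Sum>x\<in>{x \<in> S. z < f x}. exp (\<theta> * f x))"
    by (intro sum_mono) (use th in \<open>auto intro: mult_left_mono\<close>)
  also have "\<dots> \<le> (\<Sum>x\<in>S. exp (\<theta> * f x))" by (rule sum_mono2[OF fS]) auto
  also have "\<dots> \<le> card S * exp (v * \<theta>\<^sup>2 / 2)"
    using assms(1-8) th by (rule exchange_subgaussian)
  finally have "card {x \<in> S. z < f x} * exp (\<theta> * z) * exp (- (\<theta> * z)) \<le> card S * exp (v * \<theta>\<^sup>2 / 2) * exp (- (\<theta> * z))"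
    by (intro mult_right_mono) auto
  then have "card {x \<in> S. z < f x} \<le> card S * exp (v * \<theta>\<^sup>2 / 2 - \<theta> * z)"
    by (simp add: mult.assoc flip: exp_add)
  also have "v * \<theta>\<^sup>2 / 2 - \<theta> * z = - z\<^sup>2 / (2 * v)"
    using v by (simp add: \<theta>_def field_simps power2_eq_square)
  finally show ?thesis .
qed

lemma exchange_tail_abs:
  fixes f :: "'a \<Rightarrow> real" and w :: "'q \<Rightarrow> 'a \<Rightarrow> real" and \<tau> :: "'q \<Rightarrow> 'a \<Rightarrow> 'a"
  assumes fS: "finite S" and fQ: "finite Q"
    and \<tau>S: "\<And>q x. q \<in> Q \<Longrightarrow> x \<in> S \<Longrightarrow> \<tau> q x \<in> S"
    and \<tau>\<tau>: "\<And>q x. q \<in> Q \<Longrightarrow> x \<in> S \<Longrightarrow> \<tau> q (\<tau> q x) = x"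
    and w\<tau>: "\<And>q x. q \<in> Q \<Longrightarrow> x \<in> S \<Longrightarrow> w q (\<tau> q x) = w q x"
    and w0: "\<And>q x. q \<in> Q \<Longrightarrow> x \<in> S \<Longrightarrow> 0 \<le> w q x"
    and lin: "\<And>x. x \<in> S \<Longrightarrow> (\<Sum>q\<in>Q. w q x * (f x - f (\<tau> q x))) = f x"
    and var: "\<And>x. x \<in> S \<Longrightarrow> (\<Sum>q\<in>Q. w q x * (f x - f (\<tau> q x))\<^sup>2) \<le> v"
    and v: "0 < v" and z: "0 \<le> z"
  shows "card {x \<in> S. z < \<bar>f x\<bar>} \<le> 2 * card S * exp (- z\<^sup>2 / (2 * v))"
proof -
  have A: "card {x \<in> S. z < f x} \<le> card S * exp (- z\<^sup>2 / (2 * v))"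
    using assms by (rule exchange_tail)
  have lin': "(\<Sum>q\<in>Q. w q x * (- f x - - f (\<tau> q x))) = - f x" if "x \<in> S" for x
  proof -
    have "(\<Sum>q\<in>Q. w q x * (- f x - - f (\<tau> q x))) = - (\<Sum>q\<in>Q. w q x * (f x - f (\<tau> q x)))"
      unfolding sum_negf[symmetric] by (rule sum.cong) (auto simp: algebra_simps)
    then show ?thesis using lin[OF that] by simp
  qed
  have var': "(\<Sum>q\<in>Q. w q x * (- f x - - f (\<tau> q x))\<^sup>2) \<le> v" if "x \<in> S" for x
  proof -
    have "(\<Sum>q\<in>Q. w q x * (- f x - - f (\<tau> q x))\<^sup>2) = (\<Sum>q\<in>Q. w q x * (f x - f (\<tau> q x))\<^sup>2)"
      by (rule sum.cong) (auto simp: power2_eq_square algebra_simps)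
    then show ?thesis using var[OF that] by simp
  qed
  have B: "card {x \<in> S. z < - f x} \<le> card S * exp (- z\<^sup>2 / (2 * v))"
    using fS fQ \<tau>S \<tau>\<tau> w\<tau> w0 lin' var' v z by (rule exchange_tail)
  have "card {x \<in> S. z < \<bar>f x\<bar>} \<le> card ({x \<in> S. z < f x} \<union> {x \<in> S. z < - f x})"
    using fS by (intro card_mono) auto
  also have "\<dots> \<le> card {x \<in> S. z < f x} + card {x \<in> S. z < - f x}" by (rule card_Un_le)
  finally show ?thesis using A B by linarith
qed

section \<open>Exchanging columns within two rows\<close>

text \<open>Conditioning a uniform matrix on the ones exposed so far gives the uniform measure on
  this set, so counting replaces a probability space.\<close>

definition planted :: "nat \<Rightarrow> (nat \<Rightarrow> nat) \<Rightarrow> (nat \<Rightarrow> nat) \<Rightarrow> (nat \<times> nat) set \<Rightarrow> (nat \<Rightarrow> nat \<Rightarrow> nat) set" where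
  "planted n s t F = {M \<in> zo_matrices n s t. \<forall>(i, k) \<in> F. M i k = 1}"

text \<open>Applied to two columns in which rows \<open>j\<close> and \<open>m\<close> differ, this
  keeps all row and column sums, since each of the two columns has exactly one one in the two rows.
  Permuting whole columns of the row pair, rather than switching a particular 2 by 2 pattern, gives
  an involution that is always defined and may be trivial.\<close>

definition rswap :: "nat \<Rightarrow> nat \<Rightarrow> nat \<Rightarrow> nat \<Rightarrow> (nat \<Rightarrow> nat \<Rightarrow> nat) \<Rightarrow> nat \<Rightarrow> nat \<Rightarrow> nat" where
  "rswap j m k l M = (\<lambda>i q. if i = j \<or> i = m then M i (Transposition.transpose k l q) else M i q)"

text \<open>The columns in \<open>B\<close> are frozen: those where row \<open>j\<close> or
  \<open>m\<close> has a planted one, and any further column on which a test function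
  depends.\<close>

definition dset :: "nat \<Rightarrow> nat set \<Rightarrow> nat \<Rightarrow> nat \<Rightarrow> (nat \<Rightarrow> nat \<Rightarrow> nat) \<Rightarrow> nat set" where
  "dset n B j m M = {q. q < n \<and> q \<notin> B \<and> M j q \<noteq> M m q}"

lemma finite_zo_matrices: "finite (zo_matrices n s t)"
proof (rule finite_subset)
  show "zo_matrices n s t \<subseteq> (\<lambda>S i k. if (i, k) \<in> S then 1 else 0) ` Pow ({..<n} \<times> {..<n})"
  proof
    fix M assume M: "M \<in> zo_matrices n s t"
    have 1: "M i k \<le> 1" for i k using M by (auto simp: zo_matrices_def)
    have 0: "M i k = 0" if "n \<le> i \<or> n \<le> k" for i k using M that unfolding zo_matrices_def by blast
    have "M = (\<lambda>i k. if (i, k) \<in> {(i, k). M i k = 1} then 1 else 0)"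
    proof (intro ext)
      fix i k show "M i k = (if (i, k) \<in> {(i, k). M i k = 1} then 1 else 0)"
        using 1[of i k] by auto
    qed
    moreover have "{(i, k). M i k = 1} \<in> Pow ({..<n} \<times> {..<n})"
    proof -
      have "i < n \<and> k < n" if "M i k = 1" for i k
        using 0[of i k] that by (metis not_less zero_neq_one)
      then show ?thesis by auto
    qed
    ultimately show "M \<in> (\<lambda>S i k. if (i, k) \<in> S then 1 else 0) ` Pow ({..<n} \<times> {..<n})"
      by (rule image_eqI)
  qed
qed auto

lemma finite_planted: "finite (planted n s t F)"
  unfolding planted_def using finite_zo_matrices by (rule rev_finite_subset) auto

lemma finite_dset [simp]: "finite (dset n B j m M)"
  by (rule finite_subset[of _ "{..<n}"]) (auto simp: dset_def)

lemma card_dset_le: "card (dset n B j m M) \<le> n"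
  using card_mono[of "{..<n}" "dset n B j m M"] by (auto simp: dset_def)

lemma planted_le1: "M \<in> planted n s t F \<Longrightarrow> M i k \<le> 1"
  by (auto simp: planted_def zo_matrices_def)

lemma planted_cases: "M \<in> planted n s t F \<Longrightarrow> M i k = 0 \<or> M i k = 1"
  using planted_le1[of M n s t F i k] by linarith

lemma planted_row: "M \<in> planted n s t F \<Longrightarrow> i < n \<Longrightarrow> (\<Sum>k<n. M i k) = s i"
  by (auto simp: planted_def zo_matrices_def)

lemma planted_col: "M \<in> planted n s t F \<Longrightarrow> k < n \<Longrightarrow> (\<Sum>i<n. M i k) = t k"
  by (auto simp: planted_def zo_matrices_def)

lemma planted_row_real: "M \<in> planted n s t F \<Longrightarrow> i < n \<Longrightarrow> (\<Sum>k<n. real (M i k)) = real (s i)"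
  using planted_row[of M n s t F i] by (metis of_nat_sum)

lemma planted_col_real: "M \<in> planted n s t F \<Longrightarrow> k < n \<Longrightarrow> (\<Sum>i<n. real (M i k)) = real (t k)"
  using planted_col[of M n s t F k] by (metis of_nat_sum)

lemma planted_one: "M \<in> planted n s t F \<Longrightarrow> (i, k) \<in> F \<Longrightarrow> M i k = 1"
  by (auto simp: planted_def)

lemma planted_transpose:
  "M \<in> planted n s t F \<longleftrightarrow> (\<lambda>i k. M k i) \<in> planted n t s (F\<inverse>)"
  by (auto simp: planted_def zo_matrices_def)

lemma sum_planted_transpose:
  "(\<Sum>M\<in>planted n s t F. g M) = (\<Sum>M\<in>planted n t s (F\<inverse>). g (\<lambda>i k. M k i))"
  by (rule sum.reindex_bij_witness[of _ "\<lambda>M i k. M k i" "\<lambda>M i k. M k i"])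
    (use planted_transpose in \<open>auto simp flip: planted_transpose\<close>)

lemma card_planted_transpose: "card (planted n s t F) = card (planted n t s (F\<inverse>))"
  using sum_planted_transpose[of "\<lambda>_. 1::nat" n s t F] by simp

lemma rswap_rswap [simp]: "rswap j m k l (rswap j m k l M) = M"
  by (auto simp: rswap_def fun_eq_iff)

lemma rswap_diff:
  assumes "k \<in> dset n B j m M" "l \<in> dset n B j m M"
  shows "rswap j m k l M j q \<noteq> rswap j m k l M m q \<longleftrightarrow> M j q \<noteq> M m q"
  using assms by (auto simp: rswap_def dset_def transpose_def)

lemma dset_rswap:
  assumes "k \<in> dset n B j m M" "l \<in> dset n B j m M"
  shows "dset n B j m (rswap j m k l M) = dset n B j m M"
  using rswap_diff[OF assms] by (simp add: dset_def)

lemma rswap_planted: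
  assumes M: "M \<in> planted n s t F" and jm: "j < n" "m < n" "j \<noteq> m"
    and kl: "k \<in> dset n B j m M" "l \<in> dset n B j m M"
    and B: "\<And>q. (j, q) \<in> F \<or> (m, q) \<in> F \<Longrightarrow> q \<in> B"
  shows "rswap j m k l M \<in> planted n s t F"
proof -
  let ?M = "rswap j m k l M"
  have kln: "k < n" "l < n" "k \<notin> B" "l \<notin> B" using kl by (auto simp: dset_def)
  have tr: "Transposition.transpose k l permutes {..<n}" using kln by (auto intro: permutes_swap_id)
  have tn: "n \<le> Transposition.transpose k l q" if "n \<le> q" for q
    using that kln by (auto simp: transpose_def)
  have row: "(\<Sum>q<n. ?M i q) = s i" if "i < n" for i
  proof -
    have "(\<Sum>q<n. M i (Transposition.transpose k l q)) = (\<Sum>q<n. M i q)"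
      using sum.permute[OF tr, of "M i"] by (simp add: o_def)
    then show ?thesis using planted_row[OF M that]
      by (cases "i = j \<or> i = m") (simp_all add: rswap_def)
  qed
  have e: "M j q + M m q = 1" if "M j q \<noteq> M m q" for q
    using that planted_cases[OF M, of j q] planted_cases[OF M, of m q] by auto
  have e1: "?M j q + ?M m q = M j q + M m q" for q
    using kl jm(3) e[of k] e[of l] by (auto simp: rswap_def dset_def transpose_def)
  have col: "(\<Sum>i<n. ?M i q) = t q" if "q < n" for q
  proof -
    have *: "(\<Sum>i<n. N i q) = (N j q + N m q) + (\<Sum>i\<in>{..<n} - {j, m}. N i q)" for N :: "nat \<Rightarrow> nat \<Rightarrow> nat"
      using jm sum.subset_diff[of "{j, m}" "{..<n}" "\<lambda>i. N i q"] by simp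
    have "(\<Sum>i\<in>{..<n} - {j, m}. ?M i q) = (\<Sum>i\<in>{..<n} - {j, m}. M i q)"
      by (rule sum.cong) (auto simp: rswap_def)
    then have "(\<Sum>i<n. ?M i q) = (\<Sum>i<n. M i q)" using *[of ?M] *[of M] e1[of q] by simp
    then show ?thesis using planted_col[OF M that] by simp
  qed
  have "?M i q \<le> 1" for i q using planted_le1[OF M] by (auto simp: rswap_def)
  moreover have "?M i q = 0" if "n \<le> i \<or> n \<le> q" for i q
  proof -
    have "\<And>i q. n \<le> i \<or> n \<le> q \<Longrightarrow> M i q = 0"
      using M unfolding planted_def zo_matrices_def by blast
    then show ?thesis using that tn by (auto simp: rswap_def)
  qed
  moreover have "?M i q = 1" if F: "(i, q) \<in> F" for i q
  proof -
    have "Transposition.transpose k l q = q" if "i = j \<or> i = m"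
      using B[of q] that F kln by (intro transpose_apply_other) auto
    then show ?thesis using planted_one[OF M F] by (auto simp: rswap_def)
  qed
  ultimately show ?thesis using row col unfolding planted_def zo_matrices_def by blast
qed

definition esum :: "nat \<Rightarrow> nat set \<Rightarrow> nat \<Rightarrow> nat \<Rightarrow> (nat \<Rightarrow> nat \<Rightarrow> nat) \<Rightarrow> real" where
  "esum n B j m M = (\<Sum>q\<in>dset n B j m M. real (M j q) - real (M m q))"

lemma rswap_entry:
  "j \<noteq> m \<Longrightarrow> rswap j m k l M j k = M j l" "j \<noteq> m \<Longrightarrow> rswap j m k l M m k = M m l"
  "j \<noteq> m \<Longrightarrow> rswap j m k l M j l = M j k" "j \<noteq> m \<Longrightarrow> rswap j m k l M m l = M m k"
  by (auto simp: rswap_def)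

text \<open>On pairs of a matrix and a column \<open>l\<close>, with \<open>k\<close> and
  \<open>l\<close> both movable, swapping \<open>k\<close> with \<open>l\<close> is an involution
  that keeps \<open>Z\<close> and the set of movable columns. It therefore replaces the difference
  in column \<open>k\<close> by the one in column \<open>l\<close>, and averaging over
  \<open>l\<close> gives \<open>esum\<close> divided by the number of movable columns. This is the
  exact identity on which everything else rests.\<close>

lemma row_exchange:
  fixes Z :: "(nat \<Rightarrow> nat \<Rightarrow> nat) \<Rightarrow> real"
  assumes jm: "j < n" "m < n" "j \<noteq> m"
    and B: "\<And>q. (j, q) \<in> F \<or> (m, q) \<in> F \<Longrightarrow> q \<in> B"
    and k: "k < n" "k \<notin> B"
    and Z: "\<And>M l. M \<in> planted n s t F \<Longrightarrow> k \<in> dset n B j m M \<Longrightarrow> l \<in> dset n B j m M \<Longrightarrow> Z (rswap j m k l M) = Z M"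
  shows "(\<Sum>M\<in>planted n s t F. Z M * (real (M j k) - real (M m k))) =
    (\<Sum>M\<in>planted n s t F. Z M * (if k \<in> dset n B j m M then esum n B j m M / card (dset n B j m M) else 0))"
proof -
  let ?\<Omega> = "planted n s t F" and ?U = "dset n B j m"
  let ?S = "Sigma {M \<in> ?\<Omega>. k \<in> ?U M} ?U"
  have fin: "finite {M \<in> ?\<Omega>. k \<in> ?U M}" using finite_planted by auto
  have "(\<Sum>(M, l)\<in>?S. Z M / card (?U M) * (real (M j k) - real (M m k)))
      = (\<Sum>(M, l)\<in>?S. Z M / card (?U M) * (real (M j l) - real (M m l)))"
    by (rule sum.reindex_bij_witness[of _ "\<lambda>(M, l). (rswap j m k l M, l)" "\<lambda>(M, l). (rswap j m k l M, l)"])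
      (auto simp: dset_rswap rswap_planted[OF _ jm _ _ B] Z rswap_entry[OF jm(3)])
  then have *: "(\<Sum>M | M \<in> ?\<Omega> \<and> k \<in> ?U M. \<Sum>l\<in>?U M. Z M / card (?U M) * (real (M j k) - real (M m k)))
      = (\<Sum>M | M \<in> ?\<Omega> \<and> k \<in> ?U M. \<Sum>l\<in>?U M. Z M / card (?U M) * (real (M j l) - real (M m l)))"
    using fin by (subst (1 2) sum.Sigma) auto
  have "(\<Sum>M\<in>?\<Omega>. Z M * (real (M j k) - real (M m k))) = (\<Sum>M | M \<in> ?\<Omega> \<and> k \<in> ?U M. Z M * (real (M j k) - real (M m k)))"
    by (rule sum.mono_neutral_right[OF finite_planted]) (use k in \<open>auto simp: dset_def\<close>)
  also have "\<dots> = (\<Sum>M | M \<in> ?\<Omega> \<and> k \<in> ?U M. \<Sum>l\<in>?U M. Z M / card (?U M) * (real (M j k) - real (M m k)))"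
  proof (rule sum.cong[OF refl])
    fix M assume "M \<in> {M \<in> ?\<Omega>. k \<in> ?U M}"
    then have "card (?U M) \<noteq> 0" by auto
    then show "Z M * (real (M j k) - real (M m k)) = (\<Sum>l\<in>?U M. Z M / card (?U M) * (real (M j k) - real (M m k)))"
      by simp
  qed
  also have "\<dots> = (\<Sum>M | M \<in> ?\<Omega> \<and> k \<in> ?U M. Z M * (esum n B j m M / card (?U M)))"
    unfolding * by (rule sum.cong[OF refl]) (simp add: esum_def sum_distrib_left sum_divide_distrib)
  also have "\<dots> = (\<Sum>M\<in>?\<Omega>. Z M * (if k \<in> ?U M then esum n B j m M / card (?U M) else 0))"
    by (rule sum.mono_neutral_cong_left[OF finite_planted]) auto
  finally show ?thesis .
qed

lemma esum_eq:
  assumes M: "M \<in> planted n s t F" and "j < n" "m < n" "finite B" "B \<subseteq> {..<n}"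
  shows "esum n B j m M = real (s j) - real (s m) - (\<Sum>q\<in>B. real (M j q) - real (M m q))"
proof -
  have "(\<Sum>q<n. real (M j q) - real (M m q)) = real (s j) - real (s m)"
    using assms by (simp add: sum_subtractf planted_row_real)
  moreover have "(\<Sum>q<n. real (M j q) - real (M m q))
      = (\<Sum>q\<in>{..<n} - B. real (M j q) - real (M m q)) + (\<Sum>q\<in>B. real (M j q) - real (M m q))"
    using assms by (intro sum.subset_diff) auto
  moreover have "(\<Sum>q\<in>{..<n} - B. real (M j q) - real (M m q)) = esum n B j m M"
    unfolding esum_def by (rule sum.mono_neutral_right) (auto simp: dset_def)
  ultimately show ?thesis by simp
qed

lemma esum_abs_le_card:
  assumes M: "M \<in> planted n s t F"
  shows "\<bar>esum n B j m M\<bar> \<le> card (dset n B j m M)"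
proof -
  have "\<bar>esum n B j m M\<bar> \<le> (\<Sum>q\<in>dset n B j m M. \<bar>real (M j q) - real (M m q)\<bar>)"
    unfolding esum_def by (rule sum_abs)
  also have "\<dots> \<le> (\<Sum>q\<in>dset n B j m M. 1)"
  proof (rule sum_mono)
    fix q show "\<bar>real (M j q) - real (M m q)\<bar> \<le> 1"
      using planted_cases[OF M, of j q] planted_cases[OF M, of m q] by auto
  qed
  finally show ?thesis by simp
qed

lemma esum_abs_le:
  assumes M: "M \<in> planted n s t F" and "j < n" "m < n" "finite B" "B \<subseteq> {..<n}"
  shows "\<bar>esum n B j m M\<bar> \<le> \<bar>real (s j) - real (s m)\<bar> + card B"
proof -
  have "\<bar>\<Sum>q\<in>B. real (M j q) - real (M m q)\<bar> \<le> (\<Sum>q\<in>B. \<bar>real (M j q) - real (M m q)\<bar>)"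
    by (rule sum_abs)
  also have "\<dots> \<le> (\<Sum>q\<in>B. 1)"
  proof (rule sum_mono)
    fix q show "\<bar>real (M j q) - real (M m q)\<bar> \<le> 1"
      using planted_cases[OF M, of j q] planted_cases[OF M, of m q] by auto
  qed
  finally show ?thesis using esum_eq[OF assms] by simp
qed

section \<open>Concentration of codegrees\<close>

text \<open>If the rows \<open>j\<close> and \<open>m\<close> are reshuffled on their movable
  columns while row \<open>p\<close> stays fixed, the subtracted term is the conditional mean of the
  first one. So this is a centred quantity, as the exchangeable-pair argument needs.\<close>

definition codeg_dev :: "nat \<Rightarrow> nat set \<Rightarrow> nat \<Rightarrow> nat \<Rightarrow> nat \<Rightarrow> (nat \<Rightarrow> nat \<Rightarrow> nat) \<Rightarrow> real" where
  "codeg_dev n B j m p M =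
    (\<Sum>q\<in>dset n B j m M. real (M p q) * (real (M j q) - real (M m q)))
    - (\<Sum>q\<in>dset n B j m M. real (M p q)) * esum n B j m M / card (dset n B j m M)"

lemma sum_transpose_diff:
  fixes g e :: "nat \<Rightarrow> real"
  assumes "finite U" "k \<in> U" "l \<in> U"
  shows "(\<Sum>q\<in>U. g q * e q) - (\<Sum>q\<in>U. g q * e (Transposition.transpose k l q)) = (g k - g l) * (e k - e l)"
proof (cases "k = l")
  case False
  have "(\<Sum>q\<in>U. g q * e q) - (\<Sum>q\<in>U. g q * e (Transposition.transpose k l q))
      = (\<Sum>q\<in>U. g q * (e q - e (Transposition.transpose k l q)))"
    by (simp add: sum_subtractf algebra_simps)
  also have "\<dots> = (\<Sum>q\<in>{k, l}. g q * (e q - e (Transposition.transpose k l q)))"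
    by (rule sum.mono_neutral_right) (use assms in \<open>auto simp: transpose_def\<close>)
  also have "\<dots> = (g k - g l) * (e k - e l)" using False by (simp add: algebra_simps)
  finally show ?thesis .
qed simp

text \<open>With \<open>sum_transpose_diff\<close> this supplies the hypothesis \<open>lin\<close>:
  the changes under all transpositions add up to a multiple of the sum minus its mean. It serves
  both the reshuffling of two rows and the random permutations.\<close>

lemma sum_pair_product:
  fixes g e :: "nat \<Rightarrow> real"
  assumes "finite U"
  shows "(\<Sum>k\<in>U. \<Sum>l\<in>U. (g k - g l) * (e k - e l)) = 2 * card U * (\<Sum>q\<in>U. g q * e q) - 2 * (\<Sum>q\<in>U. g q) * (\<Sum>q\<in>U. e q)"
proof -
  have "(\<Sum>k\<in>U. \<Sum>l\<in>U. (g k - g l) * (e k - e l))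
     = (\<Sum>k\<in>U. \<Sum>l\<in>U. g k * e k) + (\<Sum>k\<in>U. \<Sum>l\<in>U. g l * e l) - (\<Sum>k\<in>U. \<Sum>l\<in>U. g k * e l) - (\<Sum>k\<in>U. \<Sum>l\<in>U. g l * e k)"
    by (simp add: algebra_simps sum.distrib sum_subtractf)
  also have "(\<Sum>k\<in>U. \<Sum>l\<in>U. g l * e k) = (\<Sum>q\<in>U. g q) * (\<Sum>q\<in>U. e q)"
    by (subst sum.swap) (simp add: sum_product)
  also have "(\<Sum>k\<in>U. \<Sum>l\<in>U. g k * e l) = (\<Sum>q\<in>U. g q) * (\<Sum>q\<in>U. e q)"
    by (simp add: sum_product)
  finally show ?thesis by (simp flip: sum_distrib_left)
qed

text \<open>The involutions are the swaps of two movable columns with weight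
  \<open>1 / (2 * card U)\<close>. One swap changes the deviation by at most 2, so the variance
  proxy is at most \<open>4 * card U ^ 2 / (2 * card U) \<le> 2 * n\<close>. Row \<open>p\<close>
  must be a third row, so that it stays in place.\<close>

lemma codeg_dev_tail:
  assumes jm: "j < n" "m < n" "j \<noteq> m" and p: "p \<noteq> j" "p \<noteq> m"
    and B: "\<And>q. (j, q) \<in> F \<or> (m, q) \<in> F \<Longrightarrow> q \<in> B"
    and z: "0 \<le> z"
  shows "card {M \<in> planted n s t F. z < \<bar>codeg_dev n B j m p M\<bar>} \<le> 2 * card (planted n s t F) * exp (- z\<^sup>2 / (4 * real n))"
proof -
  let ?\<Omega> = "planted n s t F" and ?U = "dset n B j m"
  let ?Q = "{..<n} \<times> {..<n}"
  let ?f = "codeg_dev n B j m p"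
  define \<tau> where "\<tau> = (\<lambda>(k, l) M. if k \<in> ?U M \<and> l \<in> ?U M then rswap j m k l M else M)"
  define w where "w = (\<lambda>(k, l) M. if k \<in> ?U M \<and> l \<in> ?U M then 1 / (2 * real (card (?U M))) else 0)"
  have n: "0 < n" using jm by simp
  have df: "?f M - ?f (rswap j m k l M) = (real (M p k) - real (M p l)) * ((real (M j k) - real (M m k)) - (real (M j l) - real (M m l)))"
    if kl: "k \<in> ?U M" "l \<in> ?U M" for k l M
  proof -
    have U: "?U (rswap j m k l M) = ?U M" using dset_rswap[OF kl] .
    have 1: "(\<Sum>q\<in>?U M. real (rswap j m k l M p q) * (real (rswap j m k l M j q) - real (rswap j m k l M m q)))
      = (\<Sum>q\<in>?U M. real (M p q) * (\<lambda>q. real (M j q) - real (M m q)) (Transposition.transpose k l q))"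
      using p by (simp add: rswap_def)
    have 2: "(\<Sum>q\<in>?U M. real (rswap j m k l M p q)) = (\<Sum>q\<in>?U M. real (M p q))"
      using p by (simp add: rswap_def)
    have 3: "esum n B j m (rswap j m k l M) = esum n B j m M"
    proof -
      have "(\<Sum>q\<in>?U M. (\<lambda>q. real (M j q) - real (M m q)) (Transposition.transpose k l q)) = (\<Sum>q\<in>?U M. real (M j q) - real (M m q))"
        using sum_transpose_diff[of "?U M" k l "\<lambda>_. 1" "\<lambda>q. real (M j q) - real (M m q)"] kl by simp
      then show ?thesis unfolding esum_def U by (simp add: rswap_def)
    qed
    show ?thesis
      unfolding codeg_dev_def U 1 2 3
      using sum_transpose_diff[of "?U M" k l "\<lambda>q. real (M p q)" "\<lambda>q. real (M j q) - real (M m q)"] kl by simp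
  qed
  have Q: "(\<Sum>q\<in>?Q. w q M * g q) = (\<Sum>k\<in>?U M. \<Sum>l\<in>?U M. g (k, l)) / (2 * card (?U M))" for M and g :: "nat \<times> nat \<Rightarrow> real"
  proof -
    have "(\<Sum>q\<in>?Q. w q M * g q) = (\<Sum>q\<in>?U M \<times> ?U M. g q / (2 * card (?U M)))"
      by (rule sum.mono_neutral_cong_right) (auto simp: w_def dset_def)
    then show ?thesis by (simp add: sum.cartesian_product sum_divide_distrib case_prod_unfold)
  qed
  have lin: "(\<Sum>q\<in>?Q. w q M * (?f M - ?f (\<tau> q M))) = ?f M" if M: "M \<in> ?\<Omega>" for M
  proof -
    have "(\<Sum>k\<in>?U M. \<Sum>l\<in>?U M. ?f M - ?f (\<tau> (k, l) M))
       = (\<Sum>k\<in>?U M. \<Sum>l\<in>?U M. (real (M p k) - real (M p l)) * ((real (M j k) - real (M m k)) - (real (M j l) - real (M m l))))"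
      by (intro sum.cong refl) (simp add: \<tau>_def df)
    also have "\<dots> = 2 * card (?U M) * (\<Sum>q\<in>?U M. real (M p q) * (real (M j q) - real (M m q))) - 2 * (\<Sum>q\<in>?U M. real (M p q)) * esum n B j m M"
      unfolding esum_def by (rule sum_pair_product) simp
    finally have "(\<Sum>q\<in>?Q. w q M * (?f M - ?f (\<tau> q M))) =
      (2 * card (?U M) * (\<Sum>q\<in>?U M. real (M p q) * (real (M j q) - real (M m q))) - 2 * (\<Sum>q\<in>?U M. real (M p q)) * esum n B j m M) / (2 * card (?U M))"
      by (simp add: Q)
    also have "\<dots> = ?f M"
    proof (cases "?U M = {}")
      case True
      then show ?thesis by (simp add: codeg_dev_def)
    next
      case False
      then have "real (card (?U M)) \<noteq> 0" by simp
      then show ?thesis by (simp add: codeg_dev_def field_simps)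
    qed
    finally show ?thesis .
  qed
  have var: "(\<Sum>q\<in>?Q. w q M * (?f M - ?f (\<tau> q M))\<^sup>2) \<le> 2 * real n" if M: "M \<in> ?\<Omega>" for M
  proof -
    have b: "((?f M - ?f (\<tau> (k, l) M))\<^sup>2) \<le> 4" if "k \<in> ?U M" "l \<in> ?U M" for k l
    proof -
      have "?f M - ?f (\<tau> (k, l) M) = (real (M p k) - real (M p l)) * ((real (M j k) - real (M m k)) - (real (M j l) - real (M m l)))"
        using that by (simp add: \<tau>_def df)
      moreover have "\<dots> \<in> {-2, -1, 0, 1, 2}"
        using planted_cases[OF M, of p k] planted_cases[OF M, of p l] planted_cases[OF M, of j k] planted_cases[OF M, of j l]
           planted_cases[OF M, of m k] planted_cases[OF M, of m l] by auto
      ultimately show ?thesis by auto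
    qed
    have "(\<Sum>q\<in>?Q. w q M * (?f M - ?f (\<tau> q M))\<^sup>2) \<le> (\<Sum>k\<in>?U M. \<Sum>l\<in>?U M. 4) / (2 * card (?U M))"
      unfolding Q by (intro divide_right_mono sum_mono b) auto
    also have "\<dots> = 2 * real (card (?U M))" by simp
    also have "\<dots> \<le> 2 * n" using card_dset_le[of n B j m M] by simp
    finally show ?thesis by simp
  qed
  have "card {M \<in> ?\<Omega>. z < \<bar>?f M\<bar>} \<le> 2 * card ?\<Omega> * exp (- z\<^sup>2 / (2 * (2 * real n)))"
  proof (rule exchange_tail_abs[where Q = ?Q and w = w and \<tau> = \<tau>])
    show "\<tau> q M \<in> ?\<Omega>" if "M \<in> ?\<Omega>" for q M
      using that by (auto simp: \<tau>_def rswap_planted[OF _ jm _ _ B] split: prod.split)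
    show "\<tau> q (\<tau> q M) = M" for q M
      by (auto simp: \<tau>_def dset_rswap split: prod.split)
    show "w q (\<tau> q M) = w q M" for q M
      by (auto simp: \<tau>_def w_def dset_rswap split: prod.split)
    show "0 \<le> w q M" for q M by (auto simp: w_def split: prod.split)
  qed (use finite_planted lin var n z in auto)
  then show ?thesis by simp
qed

definition codeg :: "nat \<Rightarrow> (nat \<Rightarrow> nat \<Rightarrow> nat) \<Rightarrow> nat \<Rightarrow> nat \<Rightarrow> real" where
  "codeg n M j p = (\<Sum>q<n. real (M j q) * real (M p q))"

lemma codeg_diff_le:
  assumes M: "M \<in> planted n s t F" and jm: "j < n" "m < n"
    and B: "finite B" "B \<subseteq> {..<n}" "card B \<le> 2"
  shows "\<bar>codeg n M j p - codeg n M m p\<bar> \<le> \<bar>codeg_dev n B j m p M\<bar> + \<bar>real (s j) - real (s m)\<bar> + 4"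
proof -
  let ?U = "dset n B j m M"
  let ?g = "\<lambda>q. real (M p q) * (real (M j q) - real (M m q))"
  have "codeg n M j p - codeg n M m p = (\<Sum>q<n. ?g q)"
    unfolding codeg_def by (simp add: sum_subtractf algebra_simps)
  also have "\<dots> = (\<Sum>q\<in>{..<n} - B. ?g q) + (\<Sum>q\<in>B. ?g q)"
    using B by (intro sum.subset_diff) auto
  also have "(\<Sum>q\<in>{..<n} - B. ?g q) = (\<Sum>q\<in>?U. ?g q)"
    by (rule sum.mono_neutral_right) (auto simp: dset_def)
  finally have e: "codeg n M j p - codeg n M m p = (\<Sum>q\<in>?U. ?g q) + (\<Sum>q\<in>B. ?g q)" .
  have "\<bar>\<Sum>q\<in>B. ?g q\<bar> \<le> (\<Sum>q\<in>B. 1)"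
  proof (rule order_trans[OF sum_abs], rule sum_mono)
    fix q show "\<bar>?g q\<bar> \<le> 1"
      using planted_cases[OF M, of j q] planted_cases[OF M, of m q] planted_cases[OF M, of p q] by auto
  qed
  then have b: "\<bar>\<Sum>q\<in>B. ?g q\<bar> \<le> 2" using B by simp
  have W: "0 \<le> (\<Sum>q\<in>?U. real (M p q))" "(\<Sum>q\<in>?U. real (M p q)) \<le> card ?U"
  proof -
    have "(\<Sum>q\<in>?U. real (M p q)) \<le> (\<Sum>q\<in>?U. 1)"
    proof (rule sum_mono)
      fix q show "real (M p q) \<le> 1" using planted_le1[OF M, of p q] by simp
    qed
    then show "(\<Sum>q\<in>?U. real (M p q)) \<le> card ?U" by simp
  qed (simp add: sum_nonneg)
  have "\<bar>(\<Sum>q\<in>?U. real (M p q)) * esum n B j m M / card ?U\<bar> \<le> \<bar>esum n B j m M\<bar>"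
  proof (cases "card ?U = 0")
    case False
    then have "(\<Sum>q\<in>?U. real (M p q)) / card ?U \<le> 1" "0 \<le> (\<Sum>q\<in>?U. real (M p q)) / card ?U"
      using W by (simp_all add: divide_le_eq_1 card_gt_0_iff)
    then have "\<bar>(\<Sum>q\<in>?U. real (M p q)) / card ?U\<bar> * \<bar>esum n B j m M\<bar> \<le> 1 * \<bar>esum n B j m M\<bar>"
      by (intro mult_right_mono) auto
    then show ?thesis by (simp add: abs_mult)
  qed simp
  moreover have "\<bar>esum n B j m M\<bar> \<le> \<bar>real (s j) - real (s m)\<bar> + 2"
    using esum_abs_le[OF M jm B(1,2)] B(3) by simp
  moreover have "\<bar>D\<bar> \<le> \<bar>A - C\<bar> + S + 4"
    if "\<bar>C\<bar> \<le> \<bar>E\<bar>" "\<bar>E\<bar> \<le> S + 2" "D = A + G" "\<bar>G\<bar> \<le> 2" for A C D E G S :: real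
    using that by linarith
  ultimately show ?thesis using e b unfolding codeg_dev_def by blast
qed

lemma card_dset_codeg:
  assumes M: "M \<in> planted n s t F" and jp: "j < n" "p < n"
  shows "real (card (dset n {} j p M)) = real (s j) + real (s p) - 2 * codeg n M j p"
proof -
  have "real (card (dset n {} j p M)) = (\<Sum>q\<in>dset n {} j p M. 1)" by simp
  also have "\<dots> = (\<Sum>q<n. real (M j q) + real (M p q) - 2 * (real (M j q) * real (M p q)))"
  proof (rule sum.mono_neutral_cong_left)
    show "\<forall>i\<in>{..<n} - dset n {} j p M. real (M j i) + real (M p i) - 2 * (real (M j i) * real (M p i)) = 0"
    proof
      fix i assume "i \<in> {..<n} - dset n {} j p M"
      then show "real (M j i) + real (M p i) - 2 * (real (M j i) * real (M p i)) = 0"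
        using planted_cases[OF M, of j i] planted_cases[OF M, of p i] by (auto simp: dset_def)
    qed
    show "1 = real (M j i) + real (M p i) - 2 * (real (M j i) * real (M p i))" if "i \<in> dset n {} j p M" for i
      using that planted_cases[OF M, of j i] planted_cases[OF M, of p i] by (auto simp: dset_def)
  qed (auto simp: dset_def)
  also have "\<dots> = real (s j) + real (s p) - 2 * codeg n M j p"
    using M jp by (simp add: codeg_def sum.distrib sum_subtractf planted_row_real flip: sum_distrib_left)
  finally show ?thesis .
qed

text \<open>Double counting. It fixes the average overlap with row \<open>p\<close>, whereas the
  tail bounds only compare overlaps with each other.\<close>

lemma sum_codeg:
  assumes M: "M \<in> planted n s t F"
  shows "(\<Sum>m<n. codeg n M m p) = (\<Sum>q<n. real (M p q) * real (t q))"
proof -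
  have "(\<Sum>m<n. codeg n M m p) = (\<Sum>q<n. \<Sum>m<n. real (M m q) * real (M p q))"
    unfolding codeg_def by (rule sum.swap)
  also have "\<dots> = (\<Sum>q<n. real (M p q) * real (t q))"
    using M by (intro sum.cong refl) (simp add: planted_col_real flip: sum_distrib_right)
  finally show ?thesis .
qed

text \<open>A spare factor \<open>x\<close> absorbs any numerical constant, because
  \<open>1000 \<le> x\<close>; \<open>x40\<close> keeps the accumulated powers of \<open>x\<close>
  below \<open>y\<close>; \<open>n_exp\<close> makes a tail of size \<open>exp (- x)\<close> survive
  union bounds over polynomially many events. By \<open>lam_ge\<close>, dividing by
  \<open>lam\<close>, by \<open>1 - lam\<close> or by their product costs one factor
  \<open>x\<close>.\<close>

locale dense_degrees =
  fixes n :: nat and s t :: "nat \<Rightarrow> nat" and lam x y :: real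
  assumes n_pos: "0 < n" and y_def: "y = sqrt (real n)"
    and x_ge: "1000 \<le> x" and x40: "x ^ 40 \<le> y" and n_exp: "real n ^ 10 * exp (- x) \<le> 1"
    and s_dev: "\<And>j. j < n \<Longrightarrow> \<bar>real (s j) - lam * n\<bar> \<le> x\<^sup>2 * y"
    and t_dev: "\<And>k. k < n \<Longrightarrow> \<bar>real (t k) - lam * n\<bar> \<le> x\<^sup>2 * y"
    and sum_s: "(\<Sum>j<n. real (s j)) = lam * real n ^ 2"
    and sum_t: "(\<Sum>k<n. real (t k)) = lam * real n ^ 2"
    and lam: "0 < lam" "lam < 1" and lam_ge: "1 / x \<le> lam * (1 - lam)"
begin

lemma x_pos: "0 < x" and x_ge1: "1 \<le> x" using x_ge by auto
lemma x_pow_mono: "a \<le> b \<Longrightarrow> x ^ a \<le> x ^ b" using x_ge1 by (simp add: power_increasing)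
lemma x_pow_y: "a \<le> 40 \<Longrightarrow> x ^ a \<le> y" using x_pow_mono[of a 40] x40 by simp
lemma y_ge: "1000 \<le> y" using x_pow_y[of 1] x_ge by simp
lemma y_pos: "0 < y" using y_ge by simp
lemma n_y: "real n = y\<^sup>2" by (simp add: y_def)
lemma y_le_n: "y \<le> real n"
proof -
  have "1 * y \<le> y * y" using y_ge by (intro mult_right_mono) auto
  then show ?thesis by (simp add: n_y power2_eq_square)
qed
lemma x_pow_ge1: "1 \<le> x ^ a" using x_ge1 by (rule one_le_power)

end

text \<open>The planted positions form a partial permutation matrix, so a row freezes at most one
  column. The assumptions are symmetric in rows and columns: interpreting the locale at the
  transposed data (\<open>transposed\<close>) yields the column version of every result on
  rows.\<close>

locale dense_ensemble = dense_degrees +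
  fixes F :: "(nat \<times> nat) set"
  assumes F_sub: "F \<subseteq> {..<n} \<times> {..<n}"
    and F_row: "\<And>i k k'. (i, k) \<in> F \<Longrightarrow> (i, k') \<in> F \<Longrightarrow> k = k'"
    and F_col: "\<And>i i' k. (i, k) \<in> F \<Longrightarrow> (i', k) \<in> F \<Longrightarrow> i = i'"
    and nonempty: "planted n s t F \<noteq> {}"
begin

abbreviation "\<Omega> \<equiv> planted n s t F"

text \<open>The mean number of columns in which two rows would differ if all entries were
  independent with density \<open>lam\<close>.\<close>

definition h :: real where "h = 2 * lam * (1 - lam) * n"

definition expect :: "((nat \<Rightarrow> nat \<Rightarrow> nat) \<Rightarrow> real) \<Rightarrow> real" where
  "expect g = (\<Sum>M\<in>\<Omega>. g M) / card \<Omega>"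

lemma transposed: "dense_ensemble n t s lam x y (F\<inverse>)"
proof
  show "planted n t s (F\<inverse>) \<noteq> {}" using nonempty planted_transpose by fastforce
  show "F\<inverse> \<subseteq> {..<n} \<times> {..<n}" using F_sub by auto
qed (use n_pos y_def x_ge x40 n_exp s_dev t_dev sum_s sum_t lam lam_ge F_row F_col in auto)

lemma card_\<Omega>_pos: "0 < card \<Omega>" using nonempty finite_planted by (simp add: card_gt_0_iff)

lemma h_ge: "2 * n / x \<le> h"
proof -
  have "(1 / x) * (2 * n) \<le> (lam * (1 - lam)) * (2 * n)" using lam_ge by (intro mult_right_mono) auto
  then show ?thesis by (simp add: h_def algebra_simps)
qed

lemma h_pos: "0 < h" using lam n_pos by (simp add: h_def)

definition pcols :: "nat \<Rightarrow> nat set" where "pcols j = {q. (j, q) \<in> F}"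

lemma pcols_sub: "pcols j \<subseteq> {..<n}" using F_sub by (auto simp: pcols_def)
lemma pcols_card: "card (pcols j) \<le> 1"
proof -
  have "pcols j = {} \<or> (\<exists>q. pcols j = {q})" using F_row unfolding pcols_def by blast
  then show ?thesis by auto
qed
lemma pcols_finite [simp]: "finite (pcols j)" using pcols_sub finite_subset by blast

definition rgood :: "(nat \<Rightarrow> nat \<Rightarrow> nat) \<Rightarrow> bool" where
  "rgood M \<longleftrightarrow> (\<forall>j<n. \<forall>m<n. j \<noteq> m \<longrightarrow> \<bar>real (card (dset n {} j m M)) - h\<bar> \<le> 16 * (x\<^sup>2 * y))"

text \<open>By the hypothesis the overlap of row \<open>j\<close> with row \<open>p\<close> hardly
  depends on \<open>j\<close>, so it is close to its average over all rows, which
  \<open>sum_codeg\<close> evaluates as about \<open>lam * s p\<close>. The number of differing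
  columns then follows by inclusion and exclusion.\<close>

lemma rgood_if_codeg_dev:
  assumes M: "M \<in> \<Omega>"
    and dev: "\<And>j m p. j < n \<Longrightarrow> m < n \<Longrightarrow> p < n \<Longrightarrow> j \<noteq> m \<Longrightarrow> p \<noteq> j \<Longrightarrow> p \<noteq> m \<Longrightarrow>
      \<bar>codeg_dev n (pcols j \<union> pcols m) j m p M\<bar> \<le> x * y"
  shows "rgood M"
  unfolding rgood_def
proof (intro allI impI)
  fix j p assume jp: "j < n" "p < n" "j \<noteq> p"
  let ?d = "x\<^sup>2 * y"
  have d: "x * y \<le> ?d" "1000 \<le> x * y"
  proof -
    show "x * y \<le> ?d" using x_ge1 y_pos by (simp add: power2_eq_square)
    have "1 * 1000 \<le> x * y" using x_ge1 y_ge by (intro mult_mono) auto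
    then show "1000 \<le> x * y" by simp
  qed
  have c: "\<bar>codeg n M j p - codeg n M m p\<bar> \<le> 4 * ?d" if m: "m < n" "m \<noteq> p" for m
  proof (cases "m = j")
    case False
    have "card (pcols j \<union> pcols m) \<le> 2"
      using card_Un_le[of "pcols j" "pcols m"] pcols_card[of j] pcols_card[of m] by linarith
    then have "\<bar>codeg n M j p - codeg n M m p\<bar> \<le> \<bar>codeg_dev n (pcols j \<union> pcols m) j m p M\<bar> + \<bar>real (s j) - real (s m)\<bar> + 4"
      using codeg_diff_le[OF M jp(1) m(1)] pcols_sub by auto
    then show ?thesis
      using dev[OF jp(1) m(1) jp(2)] False jp(3) m(2) s_dev[OF jp(1)] s_dev[OF m(1)] d by linarith
  qed (use d in simp)
  have M01: "0 \<le> real (M a b)" "real (M a b) \<le> 1" for a b using planted_le1[OF M, of a b] by auto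
  have cn: "0 \<le> codeg n M a b" "codeg n M a b \<le> n" for a b
  proof -
    show "0 \<le> codeg n M a b" unfolding codeg_def by (intro sum_nonneg) auto
    have "codeg n M a b \<le> (\<Sum>q<n. 1)" unfolding codeg_def
      by (intro sum_mono mult_le_one) (use M01 in auto)
    then show "codeg n M a b \<le> n" by simp
  qed
  \<comment> \<open>Comparison with the average over all rows \<open>m\<close>. The row
    \<open>m = p\<close> is not covered by \<open>c\<close>; its overlap is bounded trivially by
    \<open>n\<close>, which costs only 1 after division by \<open>n\<close>.\<close>
  have "\<bar>n * codeg n M j p - (\<Sum>m<n. codeg n M m p)\<bar> = \<bar>\<Sum>m<n. codeg n M j p - codeg n M m p\<bar>"
    by (simp add: sum_subtractf)
  also have "\<dots> \<le> (\<Sum>m<n. \<bar>codeg n M j p - codeg n M m p\<bar>)" by (rule sum_abs)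
  also have "\<dots> \<le> (\<Sum>m<n. 4 * ?d + (if m = p then real n else 0))"
  proof (rule sum_mono)
    fix m assume "m \<in> {..<n}"
    then show "\<bar>codeg n M j p - codeg n M m p\<bar> \<le> 4 * ?d + (if m = p then real n else 0)"
      using c[of m] cn[of j p] cn[of m p] d by (auto simp: abs_le_iff)
  qed
  also have "\<dots> = n * (4 * ?d) + n" using jp by (simp add: sum.distrib sum.delta)
  finally have 1: "\<bar>n * codeg n M j p - (\<Sum>m<n. codeg n M m p)\<bar> \<le> n * (4 * ?d) + n" .
  have "(\<Sum>m<n. codeg n M m p) - lam * n * s p = (\<Sum>q<n. real (M p q) * (real (t q) - lam * n))"
    using sum_codeg[OF M, of p] planted_row_real[OF M jp(2)]
    by (simp add: right_diff_distrib sum_subtractf flip: sum_distrib_right)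
  also have "\<bar>\<dots>\<bar> \<le> (\<Sum>q<n. \<bar>real (M p q) * (real (t q) - lam * n)\<bar>)" by (rule sum_abs)
  also have "\<dots> \<le> (\<Sum>q<n. ?d)"
  proof (rule sum_mono)
    fix q assume "q \<in> {..<n}"
    then have "\<bar>real (M p q)\<bar> * \<bar>real (t q) - lam * n\<bar> \<le> 1 * ?d"
      using M01[of p q] t_dev[of q] by (intro mult_mono) auto
    then show "\<bar>real (M p q) * (real (t q) - lam * n)\<bar> \<le> ?d" by (simp add: abs_mult)
  qed
  finally have 2: "\<bar>(\<Sum>m<n. codeg n M m p) - lam * n * s p\<bar> \<le> n * ?d" by simp
  have "\<bar>n * (codeg n M j p - lam * s p)\<bar> \<le> n * (5 * ?d + 1)"
    using 1 2 by (simp add: algebra_simps)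
  then have 3: "\<bar>codeg n M j p - lam * s p\<bar> \<le> 5 * ?d + 1" using n_pos by (simp add: abs_mult)
  have "\<bar>lam * (real (s p) - lam * n)\<bar> \<le> 1 * ?d"
    unfolding abs_mult using lam s_dev[OF jp(2)] by (intro mult_mono) auto
  then have 4: "\<bar>codeg n M j p - lam * (lam * n)\<bar> \<le> 6 * ?d + 1"
    using 3 unfolding right_diff_distrib by linarith
  have "real (card (dset n {} j p M)) - h = (real (s j) - lam * n) + (real (s p) - lam * n) - 2 * (codeg n M j p - lam * (lam * n))"
    unfolding card_dset_codeg[OF M jp(1,2)] h_def by (simp add: algebra_simps)
  note e = this
  have aux: "\<bar>H\<bar> \<le> 16 * D"
    if "H = A + B - 2 * C" "\<bar>A\<bar> \<le> D" "\<bar>B\<bar> \<le> D" "\<bar>C\<bar> \<le> 6 * D + 1" "e \<le> D" "1000 \<le> e" for H A B C D e :: real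
    using that by linarith
  show "\<bar>real (card (dset n {} j p M)) - h\<bar> \<le> 16 * (x\<^sup>2 * y)"
    by (rule aux[OF e s_dev[OF jp(1)] s_dev[OF jp(2)] 4 d])
qed

lemma exp_x2: "exp (- (x * y)\<^sup>2 / (4 * real n)) \<le> 1 / real n ^ 10"
proof -
  have "- (x * y)\<^sup>2 / (4 * real n) = - (x\<^sup>2) / 4" unfolding n_y using y_pos by (simp add: power_mult_distrib)
  also have "\<dots> \<le> - x"
  proof -
    have "4 * x \<le> x * x" using x_ge by (intro mult_right_mono) auto
    then show ?thesis by (simp add: power2_eq_square)
  qed
  finally have "exp (- (x * y)\<^sup>2 / (4 * real n)) \<le> exp (- x)" by simp
  also have "\<dots> \<le> 1 / real n ^ 10" using n_exp n_pos by (simp add: field_simps)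
  finally show ?thesis .
qed

text \<open>Union bound over at most \<open>n ^ 3\<close> triples of rows, each with tail
  \<open>2 / n ^ 10\<close>.\<close>

lemma card_not_rgood: "card {M \<in> \<Omega>. \<not> rgood M} \<le> card \<Omega> * (2 / real n ^ 7)"
proof -
  let ?T = "{(j, m, p). j < n \<and> m < n \<and> p < n \<and> j \<noteq> m \<and> p \<noteq> j \<and> p \<noteq> m}"
  let ?A = "\<lambda>(j, m, p). {M \<in> \<Omega>. x * y < \<bar>codeg_dev n (pcols j \<union> pcols m) j m p M\<bar>}"
  have T: "?T \<subseteq> {..<n} \<times> {..<n} \<times> {..<n}" by auto
  have fT: "finite ?T" by (rule finite_subset[OF T]) auto
  have cT: "card ?T \<le> n * (n * n)" using card_mono[OF _ T] by simp
  have "{M \<in> \<Omega>. \<not> rgood M} \<subseteq> (\<Union>q\<in>?T. ?A q)"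
  proof
    fix M assume "M \<in> {M \<in> \<Omega>. \<not> rgood M}"
    then have M: "M \<in> \<Omega>" "\<not> rgood M" by auto
    then obtain j m p where "j < n" "m < n" "p < n" "j \<noteq> m" "p \<noteq> j" "p \<noteq> m"
      "\<not> \<bar>codeg_dev n (pcols j \<union> pcols m) j m p M\<bar> \<le> x * y"
      using rgood_if_codeg_dev by blast
    then show "M \<in> (\<Union>q\<in>?T. ?A q)" using M by (intro UN_I[of "(j, m, p)"]) auto
  qed
  then have "card {M \<in> \<Omega>. \<not> rgood M} \<le> card (\<Union>q\<in>?T. ?A q)"
    using fT finite_planted by (intro card_mono) auto
  also have "\<dots> \<le> (\<Sum>q\<in>?T. card (?A q))" using fT by (rule card_UN_le)
  finally have "real (card {M \<in> \<Omega>. \<not> rgood M}) \<le> (\<Sum>q\<in>?T. real (card (?A q)))"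
    unfolding of_nat_sum[symmetric] of_nat_le_iff .
  also have "\<dots> \<le> (\<Sum>q\<in>?T. 2 * card \<Omega> / real n ^ 10)"
  proof (rule sum_mono)
    fix q assume "q \<in> ?T"
    then obtain j m p where q: "q = (j, m, p)" "j < n" "m < n" "p < n" "j \<noteq> m" "p \<noteq> j" "p \<noteq> m" by auto
    have "card (?A q) \<le> 2 * card \<Omega> * exp (- (x * y)\<^sup>2 / (4 * real n))"
      unfolding q(1) prod.case
      by (rule codeg_dev_tail) (use q x_pos y_pos in \<open>auto simp: pcols_def\<close>)
    also have "\<dots> \<le> 2 * card \<Omega> * (1 / real n ^ 10)" by (intro mult_left_mono exp_x2) auto
    finally show "real (card (?A q)) \<le> 2 * card \<Omega> / real n ^ 10" by simp
  qed
  also have "\<dots> = card ?T * (2 * card \<Omega> / real n ^ 10)" by simp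
  also have "\<dots> \<le> (real n * (real n * real n)) * (2 * card \<Omega> / real n ^ 10)"
    by (intro mult_right_mono) (use cT in \<open>auto simp flip: of_nat_mult\<close>)
  also have "\<dots> = card \<Omega> * (2 / real n ^ 7)"
    using n_pos by (simp add: field_simps flip: power_Suc)
  finally show ?thesis .
qed

definition good :: "(nat \<Rightarrow> nat \<Rightarrow> nat) \<Rightarrow> bool" where
  "good M \<longleftrightarrow> rgood M \<and> rgood (\<lambda>i k. M k i)"

lemma card_not_good: "card {M \<in> \<Omega>. \<not> good M} \<le> card \<Omega> * (1 / real n ^ 5)"
proof -
  interpret T: dense_ensemble n t s lam x y "F\<inverse>" by (rule transposed)
  have "card {M \<in> \<Omega>. \<not> rgood (\<lambda>i k. M k i)} = card {M \<in> planted n t s (F\<inverse>). \<not> rgood M}"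
    by (rule bij_betw_same_card[of "\<lambda>M i k. M k i"], rule bij_betw_byWitness[of _ "\<lambda>M i k. M k i"])
      (auto simp: planted_transpose[of _ n s t F])
  then have A: "card {M \<in> \<Omega>. \<not> rgood (\<lambda>i k. M k i)} \<le> card \<Omega> * (2 / real n ^ 7)"
    using T.card_not_rgood by (simp add: card_planted_transpose[of n s t F])
  have "card {M \<in> \<Omega>. \<not> good M} \<le> card ({M \<in> \<Omega>. \<not> rgood M} \<union> {M \<in> \<Omega>. \<not> rgood (\<lambda>i k. M k i)})"
    using finite_planted by (intro card_mono) (auto simp: good_def)
  also have "\<dots> \<le> card {M \<in> \<Omega>. \<not> rgood M} + card {M \<in> \<Omega>. \<not> rgood (\<lambda>i k. M k i)}" by (rule card_Un_le)
  finally have "real (card {M \<in> \<Omega>. \<not> good M}) \<le> card \<Omega> * (4 / real n ^ 7)"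
    using A card_not_rgood by simp
  also have "\<dots> \<le> card \<Omega> * (1 / real n ^ 5)"
  proof (rule mult_left_mono)
    have "4 \<le> real n ^ 2" using y_le_n y_ge power_mono[of 2 "real n" 2] by simp
    then have "4 * real n ^ 5 \<le> real n ^ 2 * real n ^ 5" by (intro mult_right_mono) auto
    then show "4 / real n ^ 7 \<le> 1 / real n ^ 5" using n_pos by (simp add: field_simps flip: power_add)
  qed simp
  finally show ?thesis .
qed

end

section \<open>Leading-order entry correlations\<close>

context dense_ensemble
begin

lemma expect_add: "expect (\<lambda>M. f M + g M) = expect f + expect g"
  by (simp add: expect_def sum.distrib add_divide_distrib)

lemma expect_diff: "expect (\<lambda>M. f M - g M) = expect f - expect g"
  by (simp add: expect_def sum_subtractf diff_divide_distrib)

lemma expect_cmult: "expect (\<lambda>M. c * f M) = c * expect f"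
  by (simp add: expect_def flip: sum_distrib_left)

lemma expect_sum: "expect (\<lambda>M. \<Sum>i\<in>I. f i M) = (\<Sum>i\<in>I. expect (f i))"
  by (simp add: expect_def sum.swap[of _ I] sum_divide_distrib)

lemma expect_const: "expect (\<lambda>_. c) = c"
  using card_\<Omega>_pos by (simp add: expect_def)

lemma expect_cong: "(\<And>M. M \<in> \<Omega> \<Longrightarrow> f M = g M) \<Longrightarrow> expect f = expect g"
  unfolding expect_def by (intro arg_cong2[where f = "(/)"] sum.cong) auto

lemma expect_mono: "(\<And>M. M \<in> \<Omega> \<Longrightarrow> f M \<le> g M) \<Longrightarrow> expect f \<le> expect g"
  unfolding expect_def by (intro divide_right_mono sum_mono) auto

lemma expect_abs_le:
  assumes "\<And>M. M \<in> \<Omega> \<Longrightarrow> \<bar>f M\<bar> \<le> c"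
  shows "\<bar>expect f\<bar> \<le> c"
proof -
  have "expect f \<le> expect (\<lambda>_. c)" "expect (\<lambda>_. - c) \<le> expect f"
    using assms by (auto intro!: expect_mono simp: abs_le_iff minus_le_iff)
  then show ?thesis by (simp add: expect_const abs_le_iff)
qed

text \<open>The one place where matrices without regular codegrees are paid for: a trivial bound
  \<open>b\<close> on them costs \<open>b / n ^ 5\<close>, below every error term in use.\<close>

lemma expect_good_bound:
  assumes g: "\<And>M. M \<in> \<Omega> \<Longrightarrow> good M \<Longrightarrow> \<bar>f M\<bar> \<le> a" and b: "\<And>M. M \<in> \<Omega> \<Longrightarrow> \<bar>f M\<bar> \<le> b" and a: "0 \<le> a"
  shows "\<bar>expect f\<bar> \<le> a + b / real n ^ 5"
proof -
  have b0: "0 \<le> b" using nonempty b by fastforce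
  have "\<bar>\<Sum>M\<in>\<Omega>. f M\<bar> \<le> (\<Sum>M\<in>\<Omega>. \<bar>f M\<bar>)" by (rule sum_abs)
  also have "\<dots> \<le> (\<Sum>M\<in>\<Omega>. a + (if \<not> good M then b else 0))"
    using g b a by (intro sum_mono) (auto intro: add_increasing)
  also have "\<dots> = card \<Omega> * a + card {M \<in> \<Omega>. \<not> good M} * b"
    using finite_planted by (simp add: sum.distrib flip: sum.inter_filter)
  also have "\<dots> \<le> card \<Omega> * a + card \<Omega> * (1 / real n ^ 5) * b"
    using card_not_good b0 by (intro add_left_mono mult_right_mono) auto
  finally have "\<bar>\<Sum>M\<in>\<Omega>. f M\<bar> \<le> (a + b / real n ^ 5) * card \<Omega>" by (simp add: algebra_simps)
  then show ?thesis using card_\<Omega>_pos by (simp add: expect_def divide_le_eq)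
qed

lemma inv_h_le: "1 / h \<le> x / (2 * n)"
proof -
  have "1 / h \<le> 1 / (2 * n / x)" using h_ge n_pos x_pos h_pos by (intro divide_left_mono mult_pos_pos) auto
  then show ?thesis by simp
qed

text \<open>Freezing at most four columns moves the count by at most 4, so 16 becomes 17. The last
  bound shows the limit of concentration: the reciprocal count is known up to order
  \<open>n powr (-3/2)\<close>, which is a relative error of order
  \<open>n powr (-1/2)\<close>.\<close>

lemma rgood_card:
  assumes r: "rgood M" and jm: "j < n" "m < n" "j \<noteq> m" and B: "finite B" "card B \<le> 4"
  shows "\<bar>real (card (dset n B j m M)) - h\<bar> \<le> 17 * (x\<^sup>2 * y)"
    and "h / 2 \<le> real (card (dset n B j m M))" and "real n / x \<le> real (card (dset n B j m M))"
    and "1 / real (card (dset n B j m M)) \<le> x / n"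
    and "\<bar>1 / real (card (dset n B j m M)) - 1 / h\<bar> \<le> 9 * x ^ 4 / (n * y)"
proof -
  let ?c = "real (card (dset n B j m M))"
  have e: "dset n B j m M = dset n {} j m M - B" by (auto simp: dset_def)
  have c1: "card (dset n B j m M) \<le> card (dset n {} j m M)" unfolding e by (intro card_mono) auto
  have c2: "card (dset n {} j m M) \<le> card (dset n B j m M) + card B"
    using diff_card_le_card_Diff[OF B(1), of "dset n {} j m M"] unfolding e by linarith
  have d: "4 \<le> x\<^sup>2 * y"
  proof -
    have "1 * 4 \<le> x\<^sup>2 * y" using x_pow_ge1[of 2] y_ge by (intro mult_mono) auto
    then show ?thesis by simp
  qed
  have "\<bar>real (card (dset n {} j m M)) - h\<bar> \<le> 16 * (x\<^sup>2 * y)" using r jm by (auto simp: rgood_def)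
  then show 1: "\<bar>?c - h\<bar> \<le> 17 * (x\<^sup>2 * y)" using c1 c2 B(2) d by linarith
  have nx: "17 * (x\<^sup>2 * y) \<le> n / x"
  proof -
    have "17 * x ^ 3 \<le> x * x ^ 3" using x_ge by (intro mult_right_mono) auto
    also have "\<dots> = x ^ 4" by (simp add: power_eq_if)
    also have "\<dots> \<le> y" by (rule x_pow_y) simp
    finally have "17 * x ^ 3 * y \<le> y * y" using y_pos by (intro mult_right_mono) auto
    moreover have "17 * x ^ 3 * y = 17 * (x\<^sup>2 * y) * x" by (simp add: power_eq_if)
    ultimately show ?thesis using x_pos by (simp add: n_y power2_eq_square le_divide_eq)
  qed
  show 2: "h / 2 \<le> ?c" using 1 nx h_ge by simp
  show 3: "real n / x \<le> ?c" using 2 h_ge by simp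
  have nx0: "0 < real n / x" using n_pos x_pos by simp
  have c0: "0 < ?c" using 3 nx0 by linarith
  have "1 / ?c \<le> 1 / (real n / x)" using 3 nx0 c0 by (intro divide_left_mono mult_pos_pos) auto
  then show 4: "1 / ?c \<le> x / n" by simp
  note h1 = inv_h_le
  have "\<bar>1 / ?c - 1 / h\<bar> = \<bar>?c - h\<bar> * (1 / ?c) * (1 / h)"
  proof -
    have "1 / c - 1 / d = (d - c) * (1 / c) * (1 / d)" if "0 < c" "0 < d" for c d :: real
      using that by (simp add: field_simps)
    from this[OF c0 h_pos] have "1 / ?c - 1 / h = (h - ?c) * (1 / ?c) * (1 / h)" .
    then show ?thesis using c0 h_pos by (simp add: abs_mult abs_minus_commute)
  qed
  also have "\<dots> \<le> 17 * (x\<^sup>2 * y) * (x / n) * (x / (2 * n))"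
    using 1 4 h1 c0 h_pos x_pos y_pos by (intro mult_mono) auto
  also have "\<dots> = 17 / 2 * x ^ 4 / (n * y)"
    using y_pos by (simp add: n_y power2_eq_square power_eq_if field_simps)
  also have "\<dots> \<le> 9 * x ^ 4 / (n * y)"
    using x_pos y_pos by (intro divide_right_mono mult_right_mono) auto
  finally show "\<bar>1 / ?c - 1 / h\<bar> \<le> 9 * x ^ 4 / (n * y)" .
qed

lemma inv_n5: "1 / real n ^ 5 \<le> 1 / (real n ^ 2 * y)"
proof -
  have "real n \<le> real n ^ 3" using n_pos by (intro self_le_power) auto
  then have "y \<le> real n ^ 3" using y_le_n by linarith
  then have "real n ^ 2 * y \<le> real n ^ 2 * real n ^ 3" by (intro mult_left_mono) auto
  then show ?thesis using n_pos y_pos by (intro divide_left_mono) (auto simp flip: power_add)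
qed

lemma row_exchange_expect:
  fixes Z :: "(nat \<Rightarrow> nat \<Rightarrow> nat) \<Rightarrow> real"
  assumes "j < n" "m < n" "j \<noteq> m" and "pcols j \<union> pcols m \<subseteq> B" and "k < n" "k \<notin> B"
    and "\<And>M l. M \<in> \<Omega> \<Longrightarrow> k \<in> dset n B j m M \<Longrightarrow> l \<in> dset n B j m M \<Longrightarrow> Z (rswap j m k l M) = Z M"
  shows "expect (\<lambda>M. Z M * (real (M j k) - real (M m k))) =
    expect (\<lambda>M. Z M * (if k \<in> dset n B j m M then esum n B j m M / card (dset n B j m M) else 0))"
  unfolding expect_def
  by (subst row_exchange[where B = B]) (use assms in \<open>auto simp: pcols_def\<close>)

text \<open>A bound without any cancellation: \<open>esum\<close> is of order \<open>sqrt n\<close>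
  and is divided by a count of order \<open>n\<close>. It suffices for correlations to leading
  order.\<close>

lemma row_exchange_small:
  fixes Z :: "(nat \<Rightarrow> nat \<Rightarrow> nat) \<Rightarrow> real"
  assumes jm: "j < n" "m < n" "j \<noteq> m" and B: "pcols j \<union> pcols m \<subseteq> B" "B \<subseteq> {..<n}" "card B \<le> 4"
    and k: "k < n" "k \<notin> B"
    and Z: "\<And>M l. M \<in> \<Omega> \<Longrightarrow> k \<in> dset n B j m M \<Longrightarrow> l \<in> dset n B j m M \<Longrightarrow> Z (rswap j m k l M) = Z M"
    and Z1: "\<And>M. M \<in> \<Omega> \<Longrightarrow> \<bar>Z M\<bar> \<le> 1"
  shows "\<bar>expect (\<lambda>M. Z M * (real (M j k) - real (M m k)))\<bar> \<le> 3 * x ^ 3 / y"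
proof -
  let ?g = "\<lambda>M. Z M * (if k \<in> dset n B j m M then esum n B j m M / card (dset n B j m M) else 0)"
  have fB: "finite B" using B(2) finite_subset by blast
  have b1: "\<bar>if k \<in> dset n B j m M then esum n B j m M / card (dset n B j m M) else 0\<bar> \<le> 1" if M: "M \<in> \<Omega>" for M
    using esum_abs_le_card[OF M, of B j m] by (auto simp: divide_le_eq_1 card_gt_0_iff)
  have b2: "\<bar>if k \<in> dset n B j m M then esum n B j m M / card (dset n B j m M) else 0\<bar> \<le> (2 * (x\<^sup>2 * y) + 4) * (x / n)"
    if M: "M \<in> \<Omega>" "good M" for M
  proof -
    have r: "rgood M" using M by (simp add: good_def)
    have "\<bar>esum n B j m M\<bar> \<le> \<bar>real (s j) - real (s m)\<bar> + card B"
      by (rule esum_abs_le[OF M(1) jm(1,2) fB B(2)])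
    then have e: "\<bar>esum n B j m M\<bar> \<le> 2 * (x\<^sup>2 * y) + 4"
      using s_dev[OF jm(1)] s_dev[OF jm(2)] B(3) by linarith
    have "\<bar>esum n B j m M\<bar> * (1 / card (dset n B j m M)) \<le> (2 * (x\<^sup>2 * y) + 4) * (x / n)"
      using e rgood_card(4)[OF r jm fB B(3)] y_pos by (intro mult_mono) auto
    moreover have "0 \<le> (2 * (x\<^sup>2 * y) + 4) * (x / n)" using x_pos y_pos by simp
    ultimately show ?thesis by simp
  qed
  have "expect (\<lambda>M. Z M * (real (M j k) - real (M m k))) = expect ?g"
    by (rule row_exchange_expect) (use assms in auto)
  also have "\<bar>expect ?g\<bar> \<le> (2 * (x\<^sup>2 * y) + 4) * (x / n) + 1 / real n ^ 5"
  proof (rule expect_good_bound)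
    fix M assume M: "M \<in> \<Omega>"
    show "\<bar>?g M\<bar> \<le> 1" unfolding abs_mult using Z1[OF M] b1[OF M] by (intro mult_le_one) auto
    assume g: "good M"
    have "\<bar>?g M\<bar> \<le> 1 * ((2 * (x\<^sup>2 * y) + 4) * (x / n))"
      unfolding abs_mult using Z1[OF M] b2[OF M g] by (intro mult_mono) auto
    then show "\<bar>?g M\<bar> \<le> (2 * (x\<^sup>2 * y) + 4) * (x / n)" by simp
  qed (use x_pos y_pos in simp)
  also have "\<dots> \<le> 3 * x ^ 3 / y"
  proof -
    have a: "2 * (x\<^sup>2 * y) * (x / n) = 2 * x ^ 3 / y"
      using y_pos by (simp add: n_y power2_eq_square power_eq_if field_simps)
    have b: "4 * (x / n) \<le> x ^ 3 / (2 * y)"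
    proof -
      have "8 * x \<le> x ^ 3 * 1" using x_ge power_mono[of 3 x 2] by (simp add: power_eq_if)
      also have "\<dots> \<le> x ^ 3 * y" using x_pos y_ge by (intro mult_left_mono) auto
      finally show ?thesis using y_pos by (simp add: n_y power2_eq_square field_simps)
    qed
    have c: "1 / real n ^ 5 \<le> x ^ 3 / (2 * y)"
    proof -
      have "1 / real n ^ 5 \<le> 1 / (real n ^ 2 * y)" by (rule inv_n5)
      also have "\<dots> \<le> 1 / y" using n_pos y_pos by (intro divide_left_mono) auto
      also have "\<dots> \<le> x ^ 3 / (2 * y)"
        using y_pos x_ge power_mono[of 2 x 3] by (simp add: field_simps)
      finally show ?thesis .
    qed
    have "(2 * (x\<^sup>2 * y) + 4) * (x / n) = 2 * (x\<^sup>2 * y) * (x / n) + 4 * (x / n)" by (rule distrib_right)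
    moreover have "3 * x ^ 3 / y = 2 * x ^ 3 / y + x ^ 3 / (2 * y) + x ^ 3 / (2 * y)" by (simp add: field_simps)
    ultimately show ?thesis using a b c by linarith
  qed
  finally show ?thesis .
qed

definition e1 :: real where "e1 = 6 * x ^ 3 / y"

text \<open>The test function \<open>Z\<close> sees only the other three entries of the 2 by 2
  block. Exchanging row \<open>j\<close> with a third row \<open>i\<close> while column
  \<open>l\<close> is frozen leaves all three alone, so \<open>M j k\<close> may be replaced by
  \<open>M i k\<close> at cost \<open>O(n powr (-1/2))\<close>. Averaged over \<open>i\<close> this
  is \<open>t k / n\<close>, close to \<open>lam\<close>. Splitting off entries one at a time gives
  all the block correlations below.\<close>

lemma expect_entry_indep:
  fixes Z :: "(nat \<Rightarrow> nat \<Rightarrow> nat) \<Rightarrow> real"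
  assumes jm: "j < n" "m < n" "j \<noteq> m" and kl: "k < n" "l < n" "k \<noteq> l" and F: "(j, k) \<notin> F"
    and Z: "\<And>M M'. M j l = M' j l \<Longrightarrow> M m k = M' m k \<Longrightarrow> M m l = M' m l \<Longrightarrow> Z M = Z M'"
    and Z1: "\<And>M. M \<in> \<Omega> \<Longrightarrow> \<bar>Z M\<bar> \<le> 1"
  shows "\<bar>expect (\<lambda>M. Z M * M j k) - lam * expect Z\<bar> \<le> e1"
proof -
  let ?c = "3 * x ^ 3 / y"
  interpret T: dense_ensemble n t s lam x y "F\<inverse>" by (rule transposed)
  have M1: "\<bar>Z M * (real (M i k) - real (M i' k))\<bar> \<le> 1" if "M \<in> \<Omega>" for M i i'
  proof -
    have "\<bar>real (M i k) - real (M i' k)\<bar> \<le> 1"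
      using planted_le1[OF that, of i k] planted_le1[OF that, of i' k] by auto
    then show ?thesis unfolding abs_mult using Z1[OF that] by (intro mult_le_one) auto
  qed
  have c0: "0 \<le> ?c" using x_pos y_pos by simp
  have one: "\<bar>expect (\<lambda>M. Z M * (real (M j k) - real (M i k)))\<bar> \<le> ?c" if i: "i < n" "i \<noteq> m" "(i, k) \<notin> F" for i
  proof (cases "i = j")
    case True
    then show ?thesis using c0 by (simp add: expect_const)
  next
    case False
    let ?B = "pcols j \<union> pcols i \<union> {l}"
    show ?thesis
    proof (rule row_exchange_small[where B = ?B])
      show "card ?B \<le> 4"
        using card_Un_le[of "pcols j \<union> pcols i" "{l}"] card_Un_le[of "pcols j" "pcols i"] pcols_card[of i] pcols_card[of j]
        by simp
      show "k \<notin> ?B" using F i kl by (auto simp: pcols_def)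
      fix M q assume "q \<in> dset n ?B j i M"
      then have "q \<noteq> l" by (auto simp: dset_def)
      then show "Z (rswap j i k q M) = Z M"
        using kl jm i False by (intro Z) (auto simp: rswap_def transpose_def)
    qed (use jm kl i False Z1 pcols_sub in auto)
  qed
  \<comment> \<open>The exceptional rows: row \<open>m\<close>, whose entries \<open>Z\<close> may
    use, and the at most one row planted in column \<open>k\<close>. Each costs at most 1, so 2 in
    total before division by \<open>n\<close>.\<close>
  let ?x = "\<lambda>i. (if i = m then 1 else 0) + (if (i, k) \<in> F then 1 else 0 :: real)"
  have all: "\<bar>expect (\<lambda>M. Z M * (real (M j k) - real (M i k)))\<bar> \<le> ?c + ?x i" if i: "i < n" for i
  proof (cases "i = m \<or> (i, k) \<in> F")
    case False
    then show ?thesis using one[OF i] by simp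
  next
    case True
    have "\<bar>expect (\<lambda>M. Z M * (real (M j k) - real (M i k)))\<bar> \<le> 1" by (rule expect_abs_le) (rule M1)
    then show ?thesis using True c0 by auto
  qed
  have xs: "(\<Sum>i<n. ?x i) \<le> 2"
  proof -
    have "(\<Sum>i<n. if (i, k) \<in> F then 1 else 0 :: real) = card ({..<n} \<inter> {i. (i, k) \<in> F})"
      by (simp add: sum.If_cases)
    also have "{..<n} \<inter> {i. (i, k) \<in> F} = T.pcols k" using F_sub by (auto simp: T.pcols_def)
    finally have "(\<Sum>i<n. if (i, k) \<in> F then 1 else 0 :: real) \<le> 1" using T.pcols_card[of k] by simp
    then show ?thesis using jm by (simp add: sum.distrib)
  qed
  have "n * expect (\<lambda>M. Z M * M j k) - t k * expect Z = (\<Sum>i<n. expect (\<lambda>M. Z M * (real (M j k) - real (M i k))))"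
  proof -
    have "(\<Sum>i<n. expect (\<lambda>M. Z M * (real (M j k) - real (M i k)))) = expect (\<lambda>M. \<Sum>i<n. Z M * (real (M j k) - real (M i k)))"
      by (simp add: expect_sum)
    also have "\<dots> = expect (\<lambda>M. n * (Z M * M j k) - t k * Z M)"
      by (rule expect_cong) (use kl in \<open>simp add: sum_subtractf planted_col_real flip: sum_distrib_left, simp add: algebra_simps\<close>)
    finally show ?thesis by (simp add: expect_diff expect_cmult)
  qed
  also have "\<bar>\<dots>\<bar> \<le> (\<Sum>i<n. ?c + ?x i)" by (rule order_trans[OF sum_abs], rule sum_mono) (use all in auto)
  also have "\<dots> \<le> n * ?c + 2" using xs by (simp add: sum.distrib)
  finally have 1: "\<bar>n * expect (\<lambda>M. Z M * M j k) - t k * expect Z\<bar> \<le> n * ?c + 2" .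
  have "\<bar>(real (t k) - lam * n) * expect Z\<bar> \<le> (x\<^sup>2 * y) * 1"
    unfolding abs_mult using t_dev[OF kl(1)] expect_abs_le[OF Z1] x_pos y_pos by (intro mult_mono) auto
  then have "\<bar>n * (expect (\<lambda>M. Z M * M j k) - lam * expect Z)\<bar> \<le> n * ?c + 2 + x\<^sup>2 * y"
    using 1 by (simp add: algebra_simps)
  also have "\<dots> \<le> n * e1"
  proof -
    have "2 \<le> x ^ 3 * y" using mult_mono[of 1 "x^3" 2 y] x_pow_ge1[of 3] y_ge x_pos by simp
    moreover have "x\<^sup>2 * y \<le> x ^ 3 * y" using x_pow_mono[of 2 3] y_pos by simp
    moreover have "n * e1 - n * ?c = 3 * (x ^ 3 * y)"
      using y_pos by (simp add: e1_def n_y power2_eq_square field_simps)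
    ultimately show ?thesis using x_pos y_pos by linarith
  qed
  finally show ?thesis using n_pos by (simp add: abs_mult)
qed

lemma expect_entry:
  assumes "j < n" "m < n" "j \<noteq> m" "k < n" "l < n" "k \<noteq> l" "(j, k) \<notin> F"
  shows "\<bar>expect (\<lambda>M. real (M j k)) - lam\<bar> \<le> e1"
  using expect_entry_indep[OF assms, of "\<lambda>_. 1"] by (simp add: expect_const)

lemma prod_error:
  fixes a b c d e :: real
  assumes "\<bar>a - c * b\<bar> \<le> e" "\<bar>b - d\<bar> \<le> e'" "\<bar>c\<bar> \<le> 1"
  shows "\<bar>a - c * d\<bar> \<le> e + e'"
proof -
  have "\<bar>c * (b - d)\<bar> \<le> 1 * e'" unfolding abs_mult using assms by (intro mult_mono) auto
  then show ?thesis using assms(1) by (simp add: algebra_simps)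
qed

lemma expect_differ_col:
  assumes A: "j < n" "m < n" "j \<noteq> m" "k < n" "l < n" "k \<noteq> l" and F: "(j, k) \<notin> F" "(m, k) \<notin> F"
  shows "\<bar>expect (\<lambda>M. real (M j k) + real (M m k) - 2 * (real (M j k) * real (M m k))) - 2 * lam * (1 - lam)\<bar> \<le> 6 * e1"
proof -
  have a: "\<bar>expect (\<lambda>M. real (M j k)) - lam\<bar> \<le> e1" by (rule expect_entry[OF A F(1)])
  have c: "\<bar>expect (\<lambda>M. real (M m k)) - lam\<bar> \<le> e1" using expect_entry[of m j k l] A F(2) by auto
  have "\<bar>expect (\<lambda>M. real (M j k) * real (M m k)) - lam * expect (\<lambda>M. real (M j k))\<bar> \<le> e1"
    by (rule expect_entry_indep[of m j k l]) (use planted_le1 A F in auto)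
  then have "\<bar>expect (\<lambda>M. real (M j k) * real (M m k)) - lam * lam\<bar> \<le> e1 + e1"
    by (rule prod_error) (use a lam in auto)
  moreover have "2 * lam * (1 - lam) = lam + lam - 2 * (lam * lam)" by (simp add: algebra_simps)
  ultimately show ?thesis using a c unfolding expect_diff expect_add expect_cmult by linarith
qed

lemma expect_differ_row:
  assumes A: "j < n" "m < n" "j \<noteq> m" "k < n" "l < n" "k \<noteq> l" and F: "(m, k) \<notin> F" "(m, l) \<notin> F"
  shows "\<bar>expect (\<lambda>M. real (M m k) + real (M m l) - 2 * (real (M m k) * real (M m l))) - 2 * lam * (1 - lam)\<bar> \<le> 6 * e1"
proof -
  have a: "\<bar>expect (\<lambda>M. real (M m k)) - lam\<bar> \<le> e1" using expect_entry[of m j k l] A F by auto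
  have c: "\<bar>expect (\<lambda>M. real (M m l)) - lam\<bar> \<le> e1" using expect_entry[of m j l k] A F by auto
  have "\<bar>expect (\<lambda>M. real (M m k) * real (M m l)) - lam * expect (\<lambda>M. real (M m k))\<bar> \<le> e1"
    by (rule expect_entry_indep[of m j l k]) (use planted_le1 A F in auto)
  then have "\<bar>expect (\<lambda>M. real (M m k) * real (M m l)) - lam * lam\<bar> \<le> e1 + e1"
    by (rule prod_error) (use a lam in auto)
  moreover have "2 * lam * (1 - lam) = lam + lam - 2 * (lam * lam)" by (simp add: algebra_simps)
  ultimately show ?thesis using a c unfolding expect_diff expect_add expect_cmult by linarith
qed

lemma diff01: "M \<in> \<Omega> \<Longrightarrow> real (M i k) + real (M i' k') - 2 * (real (M i k) * real (M i' k')) = (if M i k \<noteq> M i' k' then 1 else 0)"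
  using planted_cases[of M n s t F i k] planted_cases[of M n s t F i' k'] by auto

lemma expect_block_col:
  assumes A: "j < n" "m < n" "j \<noteq> m" "k < n" "l < n" "k \<noteq> l" and F: "(j, k) \<notin> F" "(m, k) \<notin> F" "(j, l) \<notin> F"
  shows "\<bar>expect (\<lambda>M. (if M j k \<noteq> M m k then 1 else 0) * (1 - real (M j l))) - 2 * lam * (1 - lam)\<^sup>2\<bar> \<le> 7 * e1"
proof -
  let ?Z = "\<lambda>M. real (M j k) + real (M m k) - 2 * (real (M j k) * real (M m k))"
  have "\<bar>expect (\<lambda>M. ?Z M * real (M j l)) - lam * expect ?Z\<bar> \<le> e1"
  proof (rule expect_entry_indep[of j m l k])
    show "\<bar>?Z M\<bar> \<le> 1" if "M \<in> \<Omega>" for M using diff01[OF that] by simp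
  qed (use A F in auto)
  moreover have "expect (\<lambda>M. (if M j k \<noteq> M m k then 1 else 0) * (1 - real (M j l))) = expect ?Z - expect (\<lambda>M. ?Z M * real (M j l))"
    unfolding expect_diff[symmetric] by (rule expect_cong) (simp add: diff01 algebra_simps)
  ultimately have "\<bar>expect (\<lambda>M. (if M j k \<noteq> M m k then 1 else 0) * (1 - real (M j l))) - (1 - lam) * expect ?Z\<bar> \<le> e1"
    by (simp add: algebra_simps abs_le_iff)
  then have "\<bar>expect (\<lambda>M. (if M j k \<noteq> M m k then 1 else 0) * (1 - real (M j l))) - (1 - lam) * (2 * lam * (1 - lam))\<bar> \<le> e1 + 6 * e1"
    by (rule prod_error[OF _ expect_differ_col[OF A F(1,2)]]) (use lam in auto)
  then show ?thesis by (simp add: power2_eq_square mult_ac)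
qed

text \<open>The value for independent entries of density \<open>lam\<close>; it will become the
  numerator of \<open>kap\<close>. Two entries are split off, and the remaining factor contributes
  \<open>6 * e1\<close>.\<close>

lemma expect_block_row:
  assumes A: "j < n" "m < n" "j \<noteq> m" "k < n" "l < n" "k \<noteq> l" and F: "(j, k) \<notin> F" "(m, k) \<notin> F" "(j, l) \<notin> F" "(m, l) \<notin> F"
  shows "\<bar>expect (\<lambda>M. (1 - real (M j k) - real (M j l)) * (if M m k \<noteq> M m l then 1 else 0)) - (1 - 2 * lam) * (2 * lam * (1 - lam))\<bar> \<le> 8 * e1"
proof -
  let ?Z = "\<lambda>M. real (M m k) + real (M m l) - 2 * (real (M m k) * real (M m l))"
  have 1: "\<bar>expect (\<lambda>M. ?Z M * real (M j k)) - lam * expect ?Z\<bar> \<le> e1"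
  proof (rule expect_entry_indep[of j m k l])
    show "\<bar>?Z M\<bar> \<le> 1" if "M \<in> \<Omega>" for M using diff01[OF that] by simp
  qed (use A F in auto)
  have 2: "\<bar>expect (\<lambda>M. ?Z M * real (M j l)) - lam * expect ?Z\<bar> \<le> e1"
  proof (rule expect_entry_indep[of j m l k])
    show "\<bar>?Z M\<bar> \<le> 1" if "M \<in> \<Omega>" for M using diff01[OF that] by simp
  qed (use A F in auto)
  have "expect (\<lambda>M. (1 - real (M j k) - real (M j l)) * (if M m k \<noteq> M m l then 1 else 0)) = expect ?Z - expect (\<lambda>M. ?Z M * real (M j k)) - expect (\<lambda>M. ?Z M * real (M j l))"
    unfolding expect_diff[symmetric] by (rule expect_cong) (simp add: diff01 algebra_simps)
  then have "\<bar>expect (\<lambda>M. (1 - real (M j k) - real (M j l)) * (if M m k \<noteq> M m l then 1 else 0)) - (1 - 2 * lam) * expect ?Z\<bar> \<le> 2 * e1"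
    using 1 2 by (simp add: algebra_simps abs_le_iff)
  then have "\<bar>expect (\<lambda>M. (1 - real (M j k) - real (M j l)) * (if M m k \<noteq> M m l then 1 else 0)) - (1 - 2 * lam) * (2 * lam * (1 - lam))\<bar> \<le> 2 * e1 + 6 * e1"
    by (rule prod_error[OF _ expect_differ_row[OF A F(2,4)]]) (use lam in \<open>auto simp: abs_le_iff\<close>)
  then show ?thesis by simp
qed

end

section \<open>Entry probabilities to second order\<close>

definition cswap :: "nat \<Rightarrow> nat \<Rightarrow> nat \<Rightarrow> nat \<Rightarrow> (nat \<Rightarrow> nat \<Rightarrow> nat) \<Rightarrow> nat \<Rightarrow> nat \<Rightarrow> nat" where
  "cswap k l r i M = (\<lambda>a q. rswap k l r i (\<lambda>a q. M q a) q a)"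

lemma cswap_apply:
  "cswap k l r i M a q = (if q = k \<or> q = l then M (Transposition.transpose r i a) q else M a q)"
  by (simp add: cswap_def rswap_def)

lemma dset_commute: "dset n B j m M = dset n B m j M"
  by (auto simp: dset_def)

text \<open>Rows \<open>r'\<close> and \<open>i\<close> both differ in the columns \<open>k\<close>
  and \<open>l\<close>, so after the exchange row \<open>r'\<close> is either unchanged or has these
  two entries transposed. Row \<open>r\<close> is constant on the two columns, hence invariant under
  that transposition, and the set of columns in which \<open>r\<close> and \<open>r'\<close> differ
  is at most permuted.\<close>

lemma card_dset_cswap:
  assumes M: "M \<in> planted n s t F" and kl: "k < n" "l < n" "k \<noteq> l" "k \<notin> B" "l \<notin> B"
    and rr: "r \<noteq> r'" and i: "M r' k \<noteq> M r' l" "M i k \<noteq> M i l" and r: "M r k = M r l"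
  shows "card (dset n B r r' (cswap k l r' i M)) = card (dset n B r r' M)"
proof -
  let ?M = "cswap k l r' i M"
  have ir: "i \<noteq> r" using i r by auto
  have rowr: "?M r q = M r q" for q using ir rr by (auto simp: cswap_apply transpose_def)
  have rowr': "?M r' q = (if q = k \<or> q = l then M i q else M r' q)" for q by (simp add: cswap_apply)
  show ?thesis
  proof (cases "M i k = M r' k")
    case True
    then have "M i l = M r' l"
      using i planted_cases[OF M, of i l] planted_cases[OF M, of r' l] planted_cases[OF M, of r' k] by auto
    then have "?M r' q = M r' q" for q using True rowr' by auto
    then show ?thesis by (simp add: dset_def rowr)
  next
    case False
    then have sw: "M i k = M r' l" "M i l = M r' k"
      using i planted_cases[OF M, of i l] planted_cases[OF M, of i k] planted_cases[OF M, of r' l] planted_cases[OF M, of r' k] by auto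
    have row: "?M r' q = M r' (Transposition.transpose k l q)" for q
      using rowr' sw kl by (auto simp: transpose_def)
    have row2: "M r q = M r (Transposition.transpose k l q)" for q
      using r by (auto simp: transpose_def)
    have B: "q \<in> B \<longleftrightarrow> Transposition.transpose k l q \<in> B" "q < n \<longleftrightarrow> Transposition.transpose k l q < n" for q
      using kl by (auto simp: transpose_def)
    have "q \<in> dset n B r r' ?M \<longleftrightarrow> Transposition.transpose k l q \<in> dset n B r r' M" for q
      unfolding dset_def mem_Collect_eq row rowr row2[of q] using B by simp
    then have "dset n B r r' ?M = Transposition.transpose k l ` dset n B r r' M"
      by (force simp: image_iff)
    then show ?thesis by (simp add: card_image)
  qed
qed

section \<open>Exchanges within two columns\<close>

context dense_ensemble
begin

lemma expect_transpose: "dense_ensemble.expect n t s (F\<inverse>) g = expect (\<lambda>M. g (\<lambda>i k. M k i))"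
proof -
  interpret T: dense_ensemble n t s lam x y "F\<inverse>" by (rule transposed)
  show ?thesis unfolding T.expect_def expect_def
    using sum_planted_transpose[of g n t s "F\<inverse>"] card_planted_transpose[of n t s "F\<inverse>"] by simp
qed

definition prows :: "nat \<Rightarrow> nat set" where "prows k = {i. (i, k) \<in> F}"

lemma col_exchange_expect:
  fixes Z :: "(nat \<Rightarrow> nat \<Rightarrow> nat) \<Rightarrow> real"
  assumes kl: "k < n" "l < n" "k \<noteq> l" and r: "r < n" "r \<notin> prows k \<union> prows l"
    and Z: "\<And>M i. M \<in> \<Omega> \<Longrightarrow> M r k \<noteq> M r l \<Longrightarrow> M i k \<noteq> M i l \<Longrightarrow> Z (cswap k l r i M) = Z M"
  shows "expect (\<lambda>M. Z M * (real (M r k) - real (M r l))) =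
    expect (\<lambda>M. Z M * (if M r k \<noteq> M r l then esum n (prows k \<union> prows l) k l (\<lambda>i q. M q i)
       / card (dset n (prows k \<union> prows l) k l (\<lambda>i q. M q i)) else 0))"
proof -
  interpret T: dense_ensemble n t s lam x y "F\<inverse>" by (rule transposed)
  have p: "T.pcols q = prows q" for q by (simp add: T.pcols_def prows_def)
  have "T.expect (\<lambda>N. Z (\<lambda>i q. N q i) * (real (N k r) - real (N l r))) =
    T.expect (\<lambda>N. Z (\<lambda>i q. N q i) * (if r \<in> dset n (prows k \<union> prows l) k l N then esum n (prows k \<union> prows l) k l N / card (dset n (prows k \<union> prows l) k l N) else 0))"
  proof (rule T.row_exchange_expect)
    fix N i assume N: "N \<in> planted n t s (F\<inverse>)" "r \<in> dset n (prows k \<union> prows l) k l N" "i \<in> dset n (prows k \<union> prows l) k l N"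
    have "(\<lambda>i q. N q i) \<in> \<Omega>" using N(1) planted_transpose[of N n t s "F\<inverse>"] by simp
    then have "Z (cswap k l r i (\<lambda>i q. N q i)) = Z (\<lambda>i q. N q i)"
      using N by (intro Z) (auto simp: dset_def)
    then show "Z (\<lambda>a q. rswap k l r i N q a) = Z (\<lambda>i q. N q i)" by (simp add: cswap_def)
  qed (use kl r p in auto)
  moreover have "r \<in> dset n (prows k \<union> prows l) k l (\<lambda>i q. M q i) \<longleftrightarrow> M r k \<noteq> M r l" for M
    using r by (auto simp: dset_def)
  ultimately show ?thesis unfolding expect_transpose by simp
qed

text \<open>The coefficient of the product of row and column deviation in the entry probability. It
  arises as twice \<open>(1 / h)\<^sup>2\<close> times the block correlation of
  \<open>expect_block_row\<close>.\<close>

definition kap :: real where "kap = (1 - 2 * lam) / (lam * (1 - lam) * real n ^ 2)"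

lemma inv_card_le1: "1 / real (card A) \<le> 1"
  by (cases "card A = 0") (auto simp: divide_le_eq_1)

lemma x_n_le: "x / n \<le> 1"
  using x_pow_y[of 1] y_le_n n_pos by (simp add: divide_le_eq_1)

lemma inv_h_le1: "1 / h \<le> 1" using inv_h_le x_n_le by simp

text \<open>The factor \<open>1 - M r k - M r l\<close> is what makes the column exchange in row
  \<open>r'\<close> applicable. It vanishes if row \<open>r\<close> differs in the two columns; if
  row \<open>r\<close> agrees there, \<open>card_dset_cswap\<close> keeps the row count in the
  denominator. So everything in front of \<open>M r' k - M r' l\<close> is an admissible test
  function, and the exchange yields about \<open>t k - t l\<close> times a mean of two reciprocal
  counts, one of rows and one of columns.\<close>

lemma half_difference:
  assumes rr: "r < n" "r' < n" "r \<noteq> r'" and kl: "k < n" "l < n" "k \<noteq> l"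
    and B: "k \<notin> B" "l \<notin> B" "finite B" "card B \<le> 4"
    and F: "(r, k) \<notin> F" "(r', k) \<notin> F" "(r, l) \<notin> F" "(r', l) \<notin> F"
  shows "\<bar>expect (\<lambda>M. (1 - real (M r k) - real (M r l)) / card (dset n B r r' M) * (real (M r' k) - real (M r' l)))
     - kap / 2 * (real (t k) - real (t l))\<bar> \<le> 57 * x ^ 7 / real n ^ 2"
proof -
  interpret T: dense_ensemble n t s lam x y "F\<inverse>" by (rule transposed)
  have p: "T.pcols q = prows q" for q by (simp add: T.pcols_def prows_def)
  let ?B = "prows k \<union> prows l"
  have fB: "finite ?B" using T.pcols_finite p by (metis finite_UnI)
  have sB: "?B \<subseteq> {..<n}" using T.pcols_sub p by (metis Un_least)
  have cB: "card ?B \<le> 2" using card_Un_le[of "prows k" "prows l"] T.pcols_card[of k] T.pcols_card[of l] unfolding p by linarith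
  define c where "c M = real (card (dset n B r r' M))" for M
  define v where "v M = real (card (dset n ?B k l (\<lambda>i q. M q i)))" for M
  define es where "es M = esum n ?B k l (\<lambda>i q. M q i)" for M
  define \<psi> where "\<psi> M = (1 - real (M r k) - real (M r l)) * (if M r' k \<noteq> M r' l then 1 else 0)" for M
  define Y where "Y M = \<psi> M * (1 / c M) * (1 / v M)" for M
  have psi1: "\<bar>\<psi> M\<bar> \<le> 1" if "M \<in> \<Omega>" for M
    unfolding \<psi>_def using planted_cases[OF that, of r k] planted_cases[OF that, of r l] by auto
  have c1: "0 \<le> 1 / c M" "1 / c M \<le> 1" "0 \<le> 1 / v M" "1 / v M \<le> 1" for M
    using inv_card_le1 by (auto simp: c_def v_def)
  have cg: "1 / c M \<le> x / n" "\<bar>1 / c M - 1 / h\<bar> \<le> 9 * x ^ 4 / (n * y)" if "good M" for M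
    using rgood_card(4,5)[of M r r' B] that rr B unfolding good_def c_def by auto
  have vg: "1 / v M \<le> x / n" "\<bar>1 / v M - 1 / h\<bar> \<le> 9 * x ^ 4 / (n * y)" if "good M" for M
    using rgood_card(4,5)[of "\<lambda>i q. M q i" k l ?B] that kl fB cB unfolding good_def v_def by auto
  have "expect (\<lambda>M. (1 - real (M r k) - real (M r l)) / c M * (real (M r' k) - real (M r' l)))
    = expect (\<lambda>M. (1 - real (M r k) - real (M r l)) / c M * (if M r' k \<noteq> M r' l then es M / v M else 0))"
    unfolding es_def v_def
  proof (rule col_exchange_expect)
    show "r' \<notin> prows k \<union> prows l" using F by (auto simp: prows_def)
    fix M i assume M: "M \<in> \<Omega>" and d: "M r' k \<noteq> M r' l" "M i k \<noteq> M i l"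
    let ?M = "cswap k l r' i M"
    \<comment> \<open>The exchanged row \<open>i\<close> may be \<open>r\<close> itself; then its
      two entries are 0 and 1 before and after, so their sum does not change.\<close>
    have "?M r k + ?M r l = M r k + M r l"
    proof (cases "r = i")
      case True
      then show ?thesis using rr d planted_cases[OF M, of i k] planted_cases[OF M, of i l] planted_cases[OF M, of r' k] planted_cases[OF M, of r' l]
        by (auto simp: cswap_apply)
    next
      case False
      then show ?thesis using rr by (simp add: cswap_apply)
    qed
    then have s: "real (?M r k) + real (?M r l) = real (M r k) + real (M r l)" by (metis of_nat_add)
    show "(1 - real (?M r k) - real (?M r l)) / c ?M = (1 - real (M r k) - real (M r l)) / c M"
    proof (cases "M r k = M r l")
      case True
      have "c ?M = c M" unfolding c_def
        using card_dset_cswap[OF M kl B(1,2) rr(3) d True] by simp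
      then show ?thesis using s by (simp add: algebra_simps)
    next
      case False
      then have "real (M r k) + real (M r l) = 1"
        using planted_cases[OF M, of r k] planted_cases[OF M, of r l] by auto
      then have "1 - real (M r k) - real (M r l) = 0" "1 - real (?M r k) - real (?M r l) = 0" using s by auto
      then show ?thesis by simp
    qed
  qed (use kl rr in auto)
  also have "\<dots> = expect (\<lambda>M. Y M * es M)"
    by (rule expect_cong) (simp add: Y_def \<psi>_def)
  finally have eq: "expect (\<lambda>M. (1 - real (M r k) - real (M r l)) / c M * (real (M r' k) - real (M r' l))) = expect (\<lambda>M. Y M * es M)" .
  have es: "\<bar>es M - (real (t k) - real (t l))\<bar> \<le> 2" if M: "M \<in> \<Omega>" for M
  proof -
    have M': "(\<lambda>i q. M q i) \<in> planted n t s (F\<inverse>)" using M planted_transpose by simp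
    have "\<bar>\<Sum>q\<in>?B. real (M q k) - real (M q l)\<bar> \<le> (\<Sum>q\<in>?B. 1)"
    proof (rule order_trans[OF sum_abs], rule sum_mono)
      fix q show "\<bar>real (M q k) - real (M q l)\<bar> \<le> 1" using planted_cases[OF M, of q k] planted_cases[OF M, of q l] by auto
    qed
    then show ?thesis using esum_eq[OF M' kl(1,2) fB sB] cB unfolding es_def by simp
  qed
  have Y1: "\<bar>Y M\<bar> \<le> 1" if "M \<in> \<Omega>" for M
    unfolding Y_def abs_mult using psi1[OF that] c1[of M] by (intro mult_le_one) auto
  have Yg: "\<bar>Y M\<bar> \<le> x\<^sup>2 / real n ^ 2" if "M \<in> \<Omega>" "good M" for M
  proof -
    have "\<bar>Y M\<bar> \<le> 1 * (x / n) * (x / n)"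
      unfolding Y_def abs_mult using psi1[OF that(1)] c1[of M] cg(1)[OF that(2)] vg(1)[OF that(2)] x_pos by (intro mult_mono) auto
    then show ?thesis by (simp add: power2_eq_square)
  qed
  have "\<bar>expect (\<lambda>M. Y M * (es M - (real (t k) - real (t l))))\<bar> \<le> 2 * x\<^sup>2 / real n ^ 2 + 2 / real n ^ 5"
  proof (rule expect_good_bound)
    fix M assume M: "M \<in> \<Omega>"
    have "\<bar>Y M * (es M - (real (t k) - real (t l)))\<bar> \<le> 1 * 2"
      unfolding abs_mult using Y1[OF M] es[OF M] by (intro mult_mono) auto
    then show "\<bar>Y M * (es M - (real (t k) - real (t l)))\<bar> \<le> 2" by simp
    assume g: "good M"
    have "\<bar>Y M * (es M - (real (t k) - real (t l)))\<bar> \<le> x\<^sup>2 / real n ^ 2 * 2"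
      unfolding abs_mult using Yg[OF M g] es[OF M] by (intro mult_mono) auto
    then show "\<bar>Y M * (es M - (real (t k) - real (t l)))\<bar> \<le> 2 * x\<^sup>2 / real n ^ 2" by (simp add: mult.commute)
  qed simp
  moreover have "expect (\<lambda>M. Y M * (es M - (real (t k) - real (t l)))) = expect (\<lambda>M. Y M * es M) - (real (t k) - real (t l)) * expect Y"
    unfolding expect_cmult[symmetric] expect_diff[symmetric] by (rule expect_cong) (simp add: algebra_simps)
  ultimately have A: "\<bar>expect (\<lambda>M. Y M * es M) - (real (t k) - real (t l)) * expect Y\<bar> \<le> 2 * x\<^sup>2 / real n ^ 2 + 2 / real n ^ 5" by simp
  \<comment> \<open>Both reciprocal counts are replaced by \<open>1 / h\<close>, one after the
    other.\<close>
  have "\<bar>expect (\<lambda>M. Y M - (1 / h)\<^sup>2 * \<psi> M)\<bar> \<le> 14 * x ^ 5 / (real n ^ 2 * y) + 2 / real n ^ 5"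
  proof (rule expect_good_bound)
    fix M assume M: "M \<in> \<Omega>"
    have "\<bar>(1 / h)\<^sup>2 * \<psi> M\<bar> \<le> 1"
      unfolding abs_mult using inv_h_le1 h_pos psi1[OF M] by (intro mult_le_one) (auto intro: power_le_one)
    then show "\<bar>Y M - (1 / h)\<^sup>2 * \<psi> M\<bar> \<le> 2" using Y1[OF M] by linarith
    assume g: "good M"
    have "Y M - (1 / h)\<^sup>2 * \<psi> M = \<psi> M * ((1 / c M - 1 / h) * (1 / v M) + (1 / h) * (1 / v M - 1 / h))"
      by (simp add: Y_def algebra_simps power2_eq_square)
    also have "\<bar>\<dots>\<bar> \<le> 1 * (9 * x ^ 4 / (n * y) * (x / n) + x / (2 * n) * (9 * x ^ 4 / (n * y)))"
      unfolding abs_mult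
    proof (intro mult_mono psi1[OF M] order_trans[OF abs_triangle_ineq] add_mono)
      show "\<bar>(1 / c M - 1 / h) * (1 / v M)\<bar> \<le> 9 * x ^ 4 / (n * y) * (x / n)"
        unfolding abs_mult using c1[of M] cg(2)[OF g] vg(1)[OF g] y_pos x_pos by (intro mult_mono) auto
      show "\<bar>1 / h * (1 / v M - 1 / h)\<bar> \<le> x / (2 * n) * (9 * x ^ 4 / (n * y))"
        unfolding abs_mult using inv_h_le h_pos vg(2)[OF g] x_pos by (intro mult_mono) auto
    qed auto
    also have "\<dots> = 27 / 2 * x ^ 5 / (real n ^ 2 * y)"
      using n_pos y_pos by (simp add: field_simps power2_eq_square power_eq_if)
    also have "\<dots> \<le> 14 * x ^ 5 / (real n ^ 2 * y)"
      using x_pos y_pos by (intro divide_right_mono mult_right_mono) auto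
    finally show "\<bar>Y M - (1 / h)\<^sup>2 * \<psi> M\<bar> \<le> 14 * x ^ 5 / (real n ^ 2 * y)" .
  qed (use x_pos y_pos in simp)
  then have 1: "\<bar>expect Y - (1 / h)\<^sup>2 * expect \<psi>\<bar> \<le> 14 * x ^ 5 / (real n ^ 2 * y) + 2 / real n ^ 5"
    by (simp add: expect_diff expect_cmult)
  have "\<bar>(1 / h)\<^sup>2 * (expect \<psi> - (1 - 2 * lam) * (2 * lam * (1 - lam)))\<bar> \<le> (x / (2 * n))\<^sup>2 * (8 * e1)"
    unfolding abs_mult
  proof (rule mult_mono)
    show "\<bar>(1 / h)\<^sup>2\<bar> \<le> (x / (2 * n))\<^sup>2" using power_mono[OF inv_h_le, of 2] h_pos by simp
    show "\<bar>expect \<psi> - (1 - 2 * lam) * (2 * lam * (1 - lam))\<bar> \<le> 8 * e1"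
      unfolding \<psi>_def using expect_block_row[of r r' k l] rr kl F by auto
  qed auto
  also have "(x / (2 * n))\<^sup>2 * (8 * e1) = 12 * x ^ 5 / (real n ^ 2 * y)"
    using n_pos y_pos by (simp add: e1_def field_simps power2_eq_square power_eq_if)
  finally have 2: "\<bar>(1 / h)\<^sup>2 * expect \<psi> - (1 / h)\<^sup>2 * ((1 - 2 * lam) * (2 * lam * (1 - lam)))\<bar> \<le> 12 * x ^ 5 / (real n ^ 2 * y)"
    by (simp add: right_diff_distrib)
  have 3: "(1 / h)\<^sup>2 * ((1 - 2 * lam) * (2 * lam * (1 - lam))) = kap / 2"
  proof -
    have "(1 / (2 * l * u * N))\<^sup>2 * (q * (2 * l * u)) = q / (l * u * N\<^sup>2) / 2" if "0 < l" "0 < u" "0 < N" for l u N q :: real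
      using that by (simp add: field_simps power2_eq_square)
    from this[of lam "1 - lam" "real n"] show ?thesis using n_pos lam by (simp add: h_def kap_def)
  qed
  have n5: "2 / real n ^ 5 \<le> 2 * x ^ 5 / (real n ^ 2 * y)"
  proof -
    have "2 * (1 / real n ^ 5) \<le> 2 * (1 / (real n ^ 2 * y))" using inv_n5 by linarith
    also have "\<dots> \<le> 2 * (x ^ 5 / (real n ^ 2 * y))"
      using x_pow_ge1[of 5] y_pos by (intro mult_left_mono divide_right_mono) auto
    finally show ?thesis by simp
  qed
  have Bd: "\<bar>expect Y - kap / 2\<bar> \<le> 28 * x ^ 5 / (real n ^ 2 * y)"
  proof -
    have e: "28 * x ^ 5 / (real n ^ 2 * y) = 14 * x ^ 5 / (real n ^ 2 * y) + 12 * x ^ 5 / (real n ^ 2 * y) + 2 * x ^ 5 / (real n ^ 2 * y)"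
      by (simp add: field_simps)
    show ?thesis unfolding e using 1 2 n5 unfolding 3 by linarith
  qed
  \<comment> \<open>Up to powers of \<open>x\<close>, the error \<open>n powr (-5/2)\<close> of
    \<open>expect Y\<close> meets a column difference of order \<open>sqrt n\<close> and becomes
    \<open>n powr (-2)\<close>: the accuracy that concentration could not give directly.\<close>
  have "\<bar>(real (t k) - real (t l)) * (expect Y - kap / 2)\<bar> \<le> (2 * (x\<^sup>2 * y)) * (28 * x ^ 5 / (real n ^ 2 * y))"
    unfolding abs_mult using Bd t_dev[OF kl(1)] t_dev[OF kl(2)] x_pos y_pos by (intro mult_mono) auto
  also have "\<dots> = 56 * x ^ 7 / real n ^ 2"
    using y_pos by (simp add: field_simps power2_eq_square power_eq_if)
  finally have C: "\<bar>(real (t k) - real (t l)) * expect Y - kap / 2 * (real (t k) - real (t l))\<bar> \<le> 56 * x ^ 7 / real n ^ 2"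
    by (simp add: algebra_simps)
  have D: "2 * x\<^sup>2 / real n ^ 2 + 2 / real n ^ 5 \<le> x ^ 7 / real n ^ 2"
  proof -
    have "2 / real n ^ 5 \<le> 2 / real n ^ 2" using n_pos by (intro divide_left_mono power_increasing) auto
    also have "\<dots> \<le> 2 * x\<^sup>2 / real n ^ 2" using x_pow_ge1[of 2] by (intro divide_right_mono) auto
    finally have "2 * x\<^sup>2 / real n ^ 2 + 2 / real n ^ 5 \<le> 4 * x\<^sup>2 / real n ^ 2" by simp
    also have "\<dots> \<le> x ^ 7 / real n ^ 2"
    proof (rule divide_right_mono)
      have "4 * x\<^sup>2 \<le> x * x\<^sup>2" using x_ge by (intro mult_right_mono) auto
      also have "\<dots> = x ^ 3" by (simp add: power_eq_if)
      also have "\<dots> \<le> x ^ 7" by (rule x_pow_mono) simp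
      finally show "4 * x\<^sup>2 \<le> x ^ 7" .
    qed simp
    finally show ?thesis .
  qed
  have "57 * x ^ 7 / real n ^ 2 = 56 * x ^ 7 / real n ^ 2 + x ^ 7 / real n ^ 2" by (simp add: field_simps)
  then show ?thesis using A C D eq unfolding c_def by linarith
qed

end

section \<open>From column differences to the entry probability\<close>

context dense_ensemble
begin

lemma kap_abs_le: "\<bar>kap\<bar> \<le> x / real n ^ 2"
proof -
  have l: "0 < lam * (1 - lam)" using lam by simp
  have "1 / (lam * (1 - lam)) \<le> 1 / (1 / x)" using lam_ge x_pos l by (intro divide_left_mono) auto
  then have i: "1 / (lam * (1 - lam)) \<le> x" by simp
  have "\<bar>kap\<bar> = \<bar>1 - 2 * lam\<bar> * (1 / (lam * (1 - lam))) * (1 / real n ^ 2)"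
    by (simp add: kap_def abs_mult abs_of_pos lam)
  also have "\<dots> \<le> 1 * x * (1 / real n ^ 2)" using lam i l x_pos by (intro mult_mono) (auto simp: abs_le_iff)
  finally show ?thesis by simp
qed

text \<open>The values \<open>G q\<close> over the unfrozen columns add up to the probability that
  the two rows differ in one of them, and \<open>G k - G l\<close> is a sum of two half differences.
  Averaging these differences over \<open>l\<close> recovers \<open>G k\<close> from the mean
  \<open>1 / n\<close>, with no loss of accuracy.\<close>

lemma expect_inv_differ:
  assumes jm: "j < n" "m < n" "j \<noteq> m" and k: "k < n"
    and jF: "\<And>q. (j, q) \<notin> F" and kF: "\<And>i. (i, k) \<notin> F"
  defines "G \<equiv> \<lambda>q. expect (\<lambda>M. if q \<in> dset n (pcols m) j m M then 1 / card (dset n (pcols m) j m M) else 0)"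
  shows "\<bar>G k - (1 / n + kap * (real (t k) - lam * n))\<bar> \<le> 2 * x ^ 8 / real n ^ 2"
proof -
  let ?B = "pcols m" and ?U = "dset n (pcols m) j m"
  have kB: "k \<notin> ?B" using kF by (auto simp: pcols_def)
  let ?A = "{..<n} - ?B"
  have cB: "card ?B \<le> 1" by (rule pcols_card)
  have cA: "card ?A = n - card ?B" using pcols_sub by (simp add: card_Diff_subset)
  have Bn: "card ?B \<le> n" using cB n_pos by linarith
  have tot: "\<bar>(\<Sum>q\<in>?A. G q) - 1\<bar> \<le> 0 + 1 / real n ^ 5"
  proof -
    have "(\<Sum>q\<in>?A. G q) = expect (\<lambda>M. \<Sum>q\<in>?A. if q \<in> ?U M then 1 / card (?U M) else 0)"
      unfolding G_def by (simp add: expect_sum)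
    also have "\<dots> = expect (\<lambda>M. if ?U M = {} then 0 else 1)"
    proof (rule expect_cong)
      fix M
      have "(\<Sum>q\<in>?A. if q \<in> ?U M then 1 / real (card (?U M)) else 0) = (\<Sum>q\<in>?U M. 1 / real (card (?U M)))"
        by (rule sum.mono_neutral_cong_right) (auto simp: dset_def)
      also have "\<dots> = (if ?U M = {} then 0 else 1)" by simp
      finally show "(\<Sum>q\<in>?A. if q \<in> ?U M then 1 / real (card (?U M)) else 0) = (if ?U M = {} then 0 else 1)" .
    qed
    finally have "(\<Sum>q\<in>?A. G q) - 1 = expect (\<lambda>M. (if ?U M = {} then 0 else 1) - 1)"
      by (simp add: expect_diff expect_const)
    also have "\<bar>\<dots>\<bar> \<le> 0 + 1 / real n ^ 5"
    proof (rule expect_good_bound)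
      fix M assume "good M"
      then have "real n / x \<le> card (?U M)" using jm cB by (intro rgood_card(3)) (auto simp: good_def)
      moreover have "0 < real n / x" using n_pos x_pos by simp
      ultimately have "?U M \<noteq> {}" by auto
      then show "\<bar>(if ?U M = {} then 0 else 1) - 1\<bar> \<le> (0::real)" by simp
    qed auto
    finally show ?thesis .
  qed
  have diff: "\<bar>G k - G l - kap * (real (t k) - real (t l))\<bar> \<le> 114 * x ^ 7 / real n ^ 2" if l: "l \<in> ?A" for l
  proof (cases "l = k")
    case False
    have lB: "l < n" "l \<notin> ?B" using l by auto
    have F: "(j, k) \<notin> F" "(m, k) \<notin> F" "(j, l) \<notin> F" "(m, l) \<notin> F" using jF kF lB by (auto simp: pcols_def)
    let ?H1 = "\<lambda>M. (1 - real (M j k) - real (M j l)) / card (?U M) * (real (M m k) - real (M m l))"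
    let ?H2 = "\<lambda>M. (1 - real (M m k) - real (M m l)) / card (?U M) * (real (M j k) - real (M j l))"
    have "G k - G l = expect (\<lambda>M. ?H1 M + ?H2 M)"
      unfolding G_def expect_diff[symmetric]
    proof (rule expect_cong)
      fix M assume M: "M \<in> \<Omega>"
      \<comment> \<open>For zero-one entries this is a polynomial identity. Each summand is
        antisymmetric in the two columns for one row and symmetric for the other, which is the shape
        required by \<open>half_difference\<close>; the second summand has the roles of
        \<open>j\<close> and \<open>m\<close> interchanged.\<close>
      have "(if k \<in> ?U M then 1 else 0) - (if l \<in> ?U M then 1 else 0 :: real)
        = (1 - real (M j k) - real (M j l)) * (real (M m k) - real (M m l)) + (1 - real (M m k) - real (M m l)) * (real (M j k) - real (M j l))"
        using planted_cases[OF M, of j k] planted_cases[OF M, of m k] planted_cases[OF M, of j l] planted_cases[OF M, of m l] k kB lB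
        by (auto simp: dset_def)
      note eq = this
      have "(if k \<in> ?U M then 1 / card (?U M) else 0) - (if l \<in> ?U M then 1 / card (?U M) else 0)
        = ((if k \<in> ?U M then 1 else 0) - (if l \<in> ?U M then 1 else 0 :: real)) / card (?U M)" by auto
      also have "\<dots> = ?H1 M + ?H2 M" unfolding eq by (simp only: add_divide_distrib times_divide_eq_left)
      finally show "(if k \<in> ?U M then 1 / card (?U M) else 0) - (if l \<in> ?U M then 1 / card (?U M) else 0) = ?H1 M + ?H2 M" .
    qed
    then have e: "G k - G l = expect ?H1 + expect ?H2" by (simp add: expect_add)
    have 1: "\<bar>expect ?H1 - kap / 2 * (real (t k) - real (t l))\<bar> \<le> 57 * x ^ 7 / real n ^ 2"
      by (rule half_difference) (use jm k lB kB F False cB in auto)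
    have 2: "\<bar>expect ?H2 - kap / 2 * (real (t k) - real (t l))\<bar> \<le> 57 * x ^ 7 / real n ^ 2"
      unfolding dset_commute[of n ?B j m]
      by (rule half_difference) (use jm k lB kB F False cB in auto)
    have "114 * x ^ 7 / real n ^ 2 = 57 * x ^ 7 / real n ^ 2 + 57 * x ^ 7 / real n ^ 2" by simp
    moreover have "kap * (real (t k) - real (t l)) = kap / 2 * (real (t k) - real (t l)) + kap / 2 * (real (t k) - real (t l))" by simp
    ultimately show ?thesis using 1 2 unfolding e by linarith
  qed (use x_pos in simp)
  have Gk: "\<bar>G k\<bar> \<le> x / n + 1 / real n ^ 5"
    unfolding G_def
  proof (rule expect_good_bound)
    fix M assume M: "M \<in> \<Omega>"
    show "\<bar>if k \<in> ?U M then 1 / real (card (?U M)) else 0\<bar> \<le> 1" using inv_card_le1[of "?U M"] by simp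
    assume "good M"
    then have "1 / real (card (?U M)) \<le> x / n" using jm cB by (intro rgood_card(4)) (auto simp: good_def)
    then show "\<bar>if k \<in> ?U M then 1 / real (card (?U M)) else 0\<bar> \<le> x / n" using x_pos by simp
  qed (use x_pos in simp)
  have tB: "\<bar>\<Sum>q\<in>?B. real (t k) - real (t q)\<bar> \<le> 2 * (x\<^sup>2 * y)"
  proof -
    have "\<bar>\<Sum>q\<in>?B. real (t k) - real (t q)\<bar> \<le> (\<Sum>q\<in>?B. 2 * (x\<^sup>2 * y))"
    proof (rule order_trans[OF sum_abs], rule sum_mono)
      fix q assume "q \<in> ?B"
      then have "q < n" using pcols_sub by auto
      then show "\<bar>real (t k) - real (t q)\<bar> \<le> 2 * (x\<^sup>2 * y)" using t_dev[OF k] t_dev[of q] by linarith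
    qed
    also have "\<dots> = card ?B * (2 * (x\<^sup>2 * y))" by simp
    also have "\<dots> \<le> 1 * (2 * (x\<^sup>2 * y))" using cB y_pos by (intro mult_right_mono) auto
    finally show ?thesis by simp
  qed
  have tA: "(\<Sum>q\<in>?A. real (t k) - real (t q)) = n * (real (t k) - lam * n) - (\<Sum>q\<in>?B. real (t k) - real (t q))"
  proof -
    have "(\<Sum>q<n. real (t k) - real (t q)) = n * (real (t k) - lam * n)"
      using sum_t by (simp add: sum_subtractf algebra_simps power2_eq_square)
    moreover have "(\<Sum>q<n. real (t k) - real (t q)) = (\<Sum>q\<in>?A. real (t k) - real (t q)) + (\<Sum>q\<in>?B. real (t k) - real (t q))"
      using pcols_sub by (intro sum.subset_diff) auto
    ultimately show ?thesis by simp
  qed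
  have S1: "\<bar>(\<Sum>q\<in>?A. G k - G q) - kap * (\<Sum>q\<in>?A. real (t k) - real (t q))\<bar> \<le> n * (114 * x ^ 7 / real n ^ 2)"
  proof -
    have "(\<Sum>q\<in>?A. G k - G q) - kap * (\<Sum>q\<in>?A. real (t k) - real (t q)) = (\<Sum>q\<in>?A. G k - G q - kap * (real (t k) - real (t q)))"
      by (simp add: sum_subtractf[symmetric] sum_distrib_left)
    also have "\<bar>\<dots>\<bar> \<le> (\<Sum>q\<in>?A. 114 * x ^ 7 / real n ^ 2)"
      by (rule order_trans[OF sum_abs], rule sum_mono) (rule diff)
    also have "\<dots> = card ?A * (114 * x ^ 7 / real n ^ 2)" by simp
    also have "\<dots> \<le> n * (114 * x ^ 7 / real n ^ 2)"
      using cA x_pos by (intro mult_right_mono) auto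
    finally show ?thesis .
  qed
  have S2: "(\<Sum>q\<in>?A. G k - G q) = n * G k - card ?B * G k - (\<Sum>q\<in>?A. G q)"
    using cA Bn by (simp add: sum_subtractf of_nat_diff left_diff_distrib)
  have S3: "\<bar>card ?B * G k\<bar> \<le> x / n + 1 / real n ^ 5"
  proof -
    have "\<bar>card ?B * G k\<bar> \<le> 1 * (x / n + 1 / real n ^ 5)" unfolding abs_mult using cB Gk by (intro mult_mono) auto
    then show ?thesis by simp
  qed
  have S4: "\<bar>kap * (\<Sum>q\<in>?B. real (t k) - real (t q))\<bar> \<le> x / real n ^ 2 * (2 * (x\<^sup>2 * y))"
    unfolding abs_mult using kap_abs_le tB by (intro mult_mono) auto
  have S5: "kap * (\<Sum>q\<in>?A. real (t k) - real (t q)) = n * (kap * (real (t k) - lam * n)) - kap * (\<Sum>q\<in>?B. real (t k) - real (t q))"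
    unfolding tA by (simp add: algebra_simps)
  have gen: "\<bar>N - 1 - K\<bar> \<le> a + b + c + d"
    if "\<bar>S - T\<bar> \<le> a" "S = N - P - Q" "\<bar>Q - 1\<bar> \<le> b" "\<bar>P\<bar> \<le> c" "T = K - R" "\<bar>R\<bar> \<le> d" for N K S T P Q R a b c d :: real
    using that by linarith
  have main: "\<bar>n * G k - 1 - n * (kap * (real (t k) - lam * n))\<bar>
     \<le> n * (114 * x ^ 7 / real n ^ 2) + (0 + 1 / real n ^ 5) + (x / n + 1 / real n ^ 5) + x / real n ^ 2 * (2 * (x\<^sup>2 * y))"
    by (rule gen[OF S1 S2 tot S3 S5 S4])
  also have "\<dots> \<le> n * (2 * x ^ 8 / real n ^ 2)"
  proof -
    have a: "1 / real n ^ 5 \<le> x ^ 7 / n"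
    proof -
      have "1 / real n ^ 5 \<le> 1 / n" using n_pos by (intro divide_left_mono self_le_power) auto
      also have "\<dots> \<le> x ^ 7 / n" using x_pow_ge1[of 7] by (intro divide_right_mono) auto
      finally show ?thesis .
    qed
    have b: "x / n \<le> x ^ 7 / n" using x_pow_mono[of 1 7] by (intro divide_right_mono) auto
    have c: "x / real n ^ 2 * (2 * (x\<^sup>2 * y)) \<le> 2 * x ^ 7 / n"
    proof -
      have "x / real n ^ 2 * (2 * (x\<^sup>2 * y)) = 2 * x ^ 3 / n * (y / n)" using n_pos by (simp add: power2_eq_square power_eq_if)
      also have "\<dots> \<le> 2 * x ^ 3 / n * 1" using y_le_n n_pos x_pos by (intro mult_left_mono) (auto simp: divide_le_eq_1)
      also have "\<dots> \<le> 2 * x ^ 7 / n" using x_pow_mono[of 3 7] by (simp add: divide_right_mono)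
      finally show ?thesis .
    qed
    have d: "n * (114 * x ^ 7 / real n ^ 2) = 114 * (x ^ 7 / n)" using n_pos by (simp add: power2_eq_square)
    have "119 * x ^ 7 \<le> x * x ^ 7" using x_ge by (intro mult_right_mono) auto
    then have "119 * (x ^ 7 / n) \<le> x ^ 8 / n" by (simp add: divide_right_mono power_eq_if)
    moreover have "n * (2 * x ^ 8 / real n ^ 2) = 2 * (x ^ 8 / n)" using n_pos by (simp add: power2_eq_square)
    moreover have "0 \<le> x ^ 7 / n" "2 * x ^ 7 / n = 2 * (x ^ 7 / n)" "0 \<le> x ^ 8 / n" using x_pos by auto
    moreover have "A + (0 + B) + (C + B) + D \<le> E"
      if "119 * p \<le> q" "E = 2 * q" "0 \<le> p" "P = 2 * p" "0 \<le> q" "B \<le> p" "C \<le> p" "D \<le> P" "A = 114 * p"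
      for A B C D E P p q :: real using that by linarith
    ultimately show ?thesis using a b c d by blast
  qed
  finally have "\<bar>n * (G k - (1 / n + kap * (real (t k) - lam * n)))\<bar> \<le> n * (2 * x ^ 8 / real n ^ 2)"
    using n_pos by (simp add: algebra_simps)
  then show ?thesis using n_pos
    by (simp only: abs_mult abs_of_nat mult_le_cancel_left_pos of_nat_0_less_iff)
qed

text \<open>If row \<open>m\<close> has a planted one in column \<open>f\<close>, this frozen column
  adds \<open>1 - M j f\<close> to \<open>esum\<close>. The correction carries no factor of order
  \<open>sqrt n\<close>, so replacing the count by \<open>h\<close> is accurate enough:
  \<open>(1 / h) * 2 * lam * (1 - lam)\<^sup>2\<close> is \<open>(1 - lam) / n\<close>.\<close>

lemma expect_planted_correction:
  assumes jm: "j < n" "m < n" "j \<noteq> m" and k: "k < n"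
    and jF: "\<And>q. (j, q) \<notin> F" and kF: "\<And>i. (i, k) \<notin> F" and f: "(m, f) \<in> F"
  shows "\<bar>expect (\<lambda>M. (if k \<in> dset n (pcols m) j m M then 1 / card (dset n (pcols m) j m M) else 0) * (1 - real (M j f))) - (1 - lam) / n\<bar>
     \<le> 32 * x ^ 4 / (n * y)"
proof -
  let ?U = "dset n (pcols m) j m"
  have fk: "f < n" "k \<noteq> f" using f F_sub kF by auto
  have kB: "k \<notin> pcols m" using kF by (auto simp: pcols_def)
  define \<psi> where "\<psi> M = (if M j k \<noteq> M m k then 1 else 0) * (1 - real (M j f))" for M
  have psi1: "\<bar>\<psi> M\<bar> \<le> 1" if "M \<in> \<Omega>" for M
    unfolding \<psi>_def using planted_cases[OF that, of j f] by auto
  have e: "(if k \<in> ?U M then 1 / card (?U M) else 0) * (1 - real (M j f)) = \<psi> M * (1 / card (?U M))" for M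
    using k kB by (auto simp: \<psi>_def dset_def)
  have "\<bar>expect (\<lambda>M. \<psi> M * (1 / card (?U M)) - (1 / h) * \<psi> M)\<bar> \<le> 9 * x ^ 4 / (n * y) + 2 / real n ^ 5"
  proof (rule expect_good_bound)
    fix M assume M: "M \<in> \<Omega>"
    have q: "\<psi> M * (1 / card (?U M)) - (1 / h) * \<psi> M = \<psi> M * (1 / card (?U M) - 1 / h)" by (simp add: algebra_simps)
    have "0 \<le> 1 / real (card (?U M))" "0 \<le> 1 / h" using h_pos by auto
    then have "\<bar>1 / card (?U M) - 1 / h\<bar> \<le> 2" using inv_card_le1[of "?U M"] inv_h_le1 by linarith
    then have "\<bar>\<psi> M * (1 / card (?U M) - 1 / h)\<bar> \<le> 1 * 2"
      unfolding abs_mult using psi1[OF M] by (intro mult_mono) auto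
    then show "\<bar>\<psi> M * (1 / card (?U M)) - (1 / h) * \<psi> M\<bar> \<le> 2" unfolding q by simp
    assume g: "good M"
    have "\<bar>1 / card (?U M) - 1 / h\<bar> \<le> 9 * x ^ 4 / (n * y)"
      using g jm pcols_card[of m] by (intro rgood_card(5)) (auto simp: good_def)
    then have "\<bar>\<psi> M * (1 / card (?U M) - 1 / h)\<bar> \<le> 1 * (9 * x ^ 4 / (n * y))"
      unfolding abs_mult using psi1[OF M] by (intro mult_mono) auto
    then show "\<bar>\<psi> M * (1 / card (?U M)) - (1 / h) * \<psi> M\<bar> \<le> 9 * x ^ 4 / (n * y)" unfolding q by simp
  qed (use x_pos y_pos in simp)
  then have 1: "\<bar>expect (\<lambda>M. \<psi> M * (1 / card (?U M))) - (1 / h) * expect \<psi>\<bar> \<le> 9 * x ^ 4 / (n * y) + 2 / real n ^ 5"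
    unfolding expect_diff expect_cmult .
  have "\<bar>expect \<psi> - 2 * lam * (1 - lam)\<^sup>2\<bar> \<le> 7 * e1"
    unfolding \<psi>_def using expect_block_col[of j m k f] jm k fk jF kF by auto
  then have "\<bar>(1 / h) * (expect \<psi> - 2 * lam * (1 - lam)\<^sup>2)\<bar> \<le> (x / (2 * n)) * (7 * e1)"
    unfolding abs_mult using inv_h_le h_pos x_pos by (intro mult_mono) auto
  also have "\<dots> = 21 * x ^ 4 / (n * y)" using n_pos y_pos by (simp add: e1_def field_simps power_eq_if)
  finally have 2: "\<bar>(1 / h) * expect \<psi> - (1 / h) * (2 * lam * (1 - lam)\<^sup>2)\<bar> \<le> 21 * x ^ 4 / (n * y)"
    by (simp add: right_diff_distrib)
  have 3: "(1 / h) * (2 * lam * (1 - lam)\<^sup>2) = (1 - lam) / n"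
  proof -
    have "1 / (2 * l * u * N) * (2 * l * u\<^sup>2) = u / N" if "0 < l" "0 < u" "0 < N" for l u N :: real
      using that by (simp add: field_simps power2_eq_square)
    from this[of lam "1 - lam" "real n"] show ?thesis using n_pos lam by (simp add: h_def)
  qed
  have 4: "2 / real n ^ 5 \<le> 2 * x ^ 4 / (n * y)"
  proof -
    have "2 * (1 / real n ^ 5) \<le> 2 * (1 / (real n ^ 2 * y))" using inv_n5 by linarith
    also have "\<dots> \<le> 2 * (x ^ 4 / (n * y))"
      using x_pow_ge1[of 4] y_pos n_pos
      by (intro mult_left_mono frac_le mult_right_mono self_le_power) auto
    finally show ?thesis by simp
  qed
  have "32 * x ^ 4 / (n * y) = 9 * x ^ 4 / (n * y) + 21 * x ^ 4 / (n * y) + 2 * x ^ 4 / (n * y)"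
    by (simp add: field_simps)
  moreover have "\<bar>a - c\<bar> \<le> w" if "w = u + v + z" "\<bar>a - b\<bar> \<le> u + z'" "\<bar>b - c\<bar> \<le> v" "z' \<le> z" for a b c u v w z z' :: real
    using that by linarith
  ultimately show ?thesis using 1 2 4 unfolding e 3 by blast
qed

text \<open>Since column \<open>k\<close> has a fixed sum, adding the means of
  \<open>M j k - M m k\<close> over \<open>m\<close> gives \<open>n\<close> times the wanted mean
  minus \<open>t k\<close>. In each summand \<open>s j - s m\<close>, of order
  \<open>sqrt n\<close>, multiplies an error of order \<open>n powr (-2)\<close>. The planted rows
  contribute \<open>(1 - lam) / n\<close> each, whence the term with \<open>card F\<close>.\<close>

lemma entry_probability:
  assumes j: "j < n" and k: "k < n" and jF: "\<And>q. (j, q) \<notin> F" and kF: "\<And>i. (i, k) \<notin> F"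
  shows "\<bar>expect (\<lambda>M. real (M j k)) - (real (t k) / n + (real (s j) - lam * n) / n
      + kap * (real (s j) - lam * n) * (real (t k) - lam * n) + card F * (1 - lam) / real n ^ 2)\<bar> \<le> 5 * x ^ 10 / (n * y)"
proof -
  let ?d = "\<lambda>m. expect (\<lambda>M. real (M j k) - real (M m k))"
  let ?g = "1 / n + kap * (real (t k) - lam * n)"
  let ?e = "5 * x ^ 10 / (n * y)"
  have one: "\<bar>?d m - ((real (s j) - real (s m)) * ?g + (if m \<in> fst ` F then (1 - lam) / n else 0))\<bar> \<le> ?e" if m: "m < n" for m
  proof (cases "m = j")
    case True
    then have "m \<notin> fst ` F" using jF by force
    then show ?thesis using True x_pos y_pos by (simp add: expect_const)
  next
    case False
    let ?U = "dset n (pcols m) j m"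
    let ?G = "expect (\<lambda>M. if k \<in> ?U M then 1 / card (?U M) else 0)"
    have kB: "k \<notin> pcols m" using kF by (auto simp: pcols_def)
    have pj: "pcols j = {}" using jF by (auto simp: pcols_def)
    have ex: "?d m = expect (\<lambda>M. if k \<in> ?U M then esum n (pcols m) j m M / card (?U M) else 0)"
      using row_exchange_expect[of j m "pcols m" k "\<lambda>_. 1"] j m False k kB pj by simp
    have "\<bar>?G - ?g\<bar> \<le> 2 * x ^ 8 / real n ^ 2"
      by (rule expect_inv_differ) (use j m False k jF kF in auto)
    then have "\<bar>(real (s j) - real (s m)) * (?G - ?g)\<bar> \<le> (2 * (x\<^sup>2 * y)) * (2 * x ^ 8 / real n ^ 2)"
      unfolding abs_mult using s_dev[OF j] s_dev[OF m] x_pos y_pos by (intro mult_mono) auto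
    also have "\<dots> = 4 * x ^ 10 / (n * y)"
      using y_pos by (simp add: n_y field_simps power2_eq_square power_eq_if)
    finally have G: "\<bar>(real (s j) - real (s m)) * ?G - (real (s j) - real (s m)) * ?g\<bar> \<le> 4 * x ^ 10 / (n * y)"
      by (simp only: right_diff_distrib)
    have e0: "4 * x ^ 10 / (n * y) + 32 * x ^ 4 / (n * y) \<le> ?e"
    proof -
      have "32 * x ^ 4 \<le> x * x ^ 4" using x_ge by (intro mult_right_mono) auto
      also have "\<dots> = x ^ 5" by (simp add: power_eq_if)
      also have "\<dots> \<le> x ^ 10" by (rule x_pow_mono) simp
      finally have "4 * x ^ 10 + 32 * x ^ 4 \<le> 5 * x ^ 10" by simp
      then have "(4 * x ^ 10 + 32 * x ^ 4) / (n * y) \<le> 5 * x ^ 10 / (n * y)" using y_pos by (intro divide_right_mono) auto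
      then show ?thesis by (simp add: add_divide_distrib)
    qed
    have pos: "0 \<le> 32 * x ^ 4 / (n * y)" using x_pos y_pos by simp
    show ?thesis
    proof (cases "m \<in> fst ` F")
      case False
      then have B: "pcols m = {}" by (force simp: pcols_def)
      have "?d m = expect (\<lambda>M. (real (s j) - real (s m)) * (if k \<in> ?U M then 1 / card (?U M) else 0))"
        unfolding ex by (rule expect_cong) (use esum_eq[of _ n s t F j m "{}"] j m in \<open>simp add: B\<close>)
      then have "?d m = (real (s j) - real (s m)) * ?G" by (simp add: expect_cmult)
      then show ?thesis using G e0 pos False by simp
    next
      case True
      then obtain f where f: "(m, f) \<in> F" by auto
      have B: "pcols m = {f}" using f F_row by (auto simp: pcols_def)
      have fn: "f < n" using f F_sub by auto
      have "?d m = expect (\<lambda>M. (real (s j) - real (s m)) * (if k \<in> ?U M then 1 / card (?U M) else 0)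
          + (if k \<in> ?U M then 1 / card (?U M) else 0) * (1 - real (M j f)))"
        unfolding ex
      proof (rule expect_cong)
        fix M assume M: "M \<in> \<Omega>"
        have "esum n (pcols m) j m M = (real (s j) - real (s m)) + (1 - real (M j f))"
          using esum_eq[OF M j m, of "{f}"] fn planted_one[OF M f] by (simp add: B)
        then show "(if k \<in> ?U M then esum n (pcols m) j m M / card (?U M) else 0)
          = (real (s j) - real (s m)) * (if k \<in> ?U M then 1 / card (?U M) else 0) + (if k \<in> ?U M then 1 / card (?U M) else 0) * (1 - real (M j f))"
          by (simp add: add_divide_distrib)
      qed
      then have d: "?d m = (real (s j) - real (s m)) * ?G + expect (\<lambda>M. (if k \<in> ?U M then 1 / card (?U M) else 0) * (1 - real (M j f)))"
        unfolding expect_add expect_cmult .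
      have "\<bar>expect (\<lambda>M. (if k \<in> ?U M then 1 / card (?U M) else 0) * (1 - real (M j f))) - (1 - lam) / n\<bar> \<le> 32 * x ^ 4 / (n * y)"
        by (rule expect_planted_correction) (use j m \<open>m \<noteq> j\<close> k jF kF f in auto)
      moreover have "\<bar>a + b - (c + d)\<bar> \<le> w" if "\<bar>a - c\<bar> \<le> u" "\<bar>b - d\<bar> \<le> v" "u + v \<le> w" for a b c d u v w :: real
        using that by linarith
      ultimately show ?thesis unfolding d using G e0 True by simp
    qed
  qed
  have cF: "card (fst ` F) = card F"
    by (rule card_image) (use F_row in \<open>auto simp: inj_on_def\<close>)
  have Fn: "fst ` F \<subseteq> {..<n}" using F_sub by auto
  have "(\<Sum>m<n. ?d m) = n * expect (\<lambda>M. real (M j k)) - t k"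
  proof -
    have "(\<Sum>m<n. ?d m) = expect (\<lambda>M. \<Sum>m<n. real (M j k) - real (M m k))" by (simp add: expect_sum)
    also have "\<dots> = expect (\<lambda>M. n * real (M j k) - t k)"
      by (rule expect_cong) (use k in \<open>simp add: sum_subtractf planted_col_real\<close>)
    finally show ?thesis by (simp add: expect_diff expect_cmult expect_const)
  qed
  moreover have "(\<Sum>m<n. (real (s j) - real (s m)) * ?g + (if m \<in> fst ` F then (1 - lam) / n else 0))
      = n * (real (s j) - lam * n) * ?g + card F * ((1 - lam) / n)"
  proof -
    have "(\<Sum>m<n. real (s j) - real (s m)) = n * (real (s j) - lam * n)"
      using sum_s by (simp add: sum_subtractf algebra_simps power2_eq_square)
    moreover have "(\<Sum>m<n. if m \<in> fst ` F then (1 - lam) / n else 0) = card F * ((1 - lam) / n)"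
      using Fn by (simp add: sum.If_cases Int_absorb1 cF)
    ultimately show ?thesis by (simp only: sum.distrib sum_distrib_right[symmetric])
  qed
  moreover have "\<bar>(\<Sum>m<n. ?d m) - (\<Sum>m<n. (real (s j) - real (s m)) * ?g + (if m \<in> fst ` F then (1 - lam) / n else 0))\<bar> \<le> (\<Sum>m<n. ?e)"
    unfolding sum_subtractf[symmetric]
    by (rule order_trans[OF sum_abs], rule sum_mono) (use one in auto)
  ultimately have "\<bar>(n * expect (\<lambda>M. real (M j k)) - t k) - (n * (real (s j) - lam * n) * ?g + card F * ((1 - lam) / n))\<bar> \<le> n * ?e"
    by simp
  also have "(n * expect (\<lambda>M. real (M j k)) - t k) - (n * (real (s j) - lam * n) * ?g + card F * ((1 - lam) / n))
     = n * (expect (\<lambda>M. real (M j k)) - (real (t k) / n + (real (s j) - lam * n) / n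
      + kap * (real (s j) - lam * n) * (real (t k) - lam * n) + card F * (1 - lam) / real n ^ 2))"
    using n_pos by (simp add: field_simps power2_eq_square)
  finally show ?thesis using n_pos
    by (simp only: abs_mult abs_of_nat mult_le_cancel_left_pos of_nat_0_less_iff)
qed

end

section \<open>Permutations\<close>

text \<open>The remainder has derivative \<open>v\<^sup>2 / (1 + v)\<close>, at most
  \<open>2 * u\<^sup>2\<close> between 0 and \<open>u\<close>, so one application of the mean value
  theorem suffices.\<close>

lemma ln_quadratic_bound:
  fixes u :: real
  assumes "\<bar>u\<bar> \<le> 1 / 2"
  shows "\<bar>ln (1 + u) - (u - u\<^sup>2 / 2)\<bar> \<le> 2 * \<bar>u\<bar> ^ 3"
proof -
  define f where "f v = ln (1 + v) - (v - v\<^sup>2 / 2)" for v :: real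
  have D: "(f has_field_derivative v\<^sup>2 / (1 + v)) (at v within S)" if "\<bar>v\<bar> \<le> 1 / 2" for v :: real and S
    unfolding f_def
    by (rule derivative_eq_intros refl | use that in \<open>simp add: field_simps power2_eq_square\<close>)+
  have b: "\<bar>v\<^sup>2 / (1 + v)\<bar> \<le> 2 * u\<^sup>2" if v: "\<bar>v\<bar> \<le> \<bar>u\<bar>" for v
  proof -
    have h: "1 / 2 \<le> 1 + v" using v assms by linarith
    have "v\<^sup>2 \<le> u\<^sup>2" using v by (simp add: abs_le_square_iff)
    then have "v\<^sup>2 / (1 + v) \<le> u\<^sup>2 / (1 / 2)" using h by (intro frac_le) auto
    then show ?thesis using h by simp
  qed
  have "\<exists>v. \<bar>v\<bar> \<le> \<bar>u\<bar> \<and> f u - f 0 = u * (v\<^sup>2 / (1 + v))"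
  proof (cases u "0 :: real" rule: linorder_cases)
    case less
    have "\<exists>z>u. z < 0 \<and> f 0 - f u = (0 - u) * (z\<^sup>2 / (1 + z))"
      by (rule MVT2[OF less]) (use assms in \<open>auto intro!: D\<close>)
    then obtain z where "u < z" "z < 0" "f 0 - f u = (0 - u) * (z\<^sup>2 / (1 + z))" by blast
    then show ?thesis by (intro exI[of _ z]) (auto simp: algebra_simps)
  next
    case greater
    have "\<exists>z>0. z < u \<and> f u - f 0 = (u - 0) * (z\<^sup>2 / (1 + z))"
      by (rule MVT2[OF greater]) (use assms in \<open>auto intro!: D\<close>)
    then obtain z where "0 < z" "z < u" "f u - f 0 = (u - 0) * (z\<^sup>2 / (1 + z))" by blast
    then show ?thesis by (intro exI[of _ z]) auto
  qed auto
  then obtain v where v: "\<bar>v\<bar> \<le> \<bar>u\<bar>" "f u - f 0 = u * (v\<^sup>2 / (1 + v))" by blast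
  have "\<bar>f u - f 0\<bar> \<le> \<bar>u\<bar> * (2 * u\<^sup>2)"
    unfolding v(2) abs_mult[of u] using b[OF v(1)] by (intro mult_left_mono) auto
  also have "\<dots> = 2 * \<bar>u\<bar> ^ 3" by (simp add: power3_eq_cube power2_eq_square)
  finally show ?thesis by (simp add: f_def)
qed

section \<open>Planting a permutation row by row, and averaging over permutations\<close>

definition diag_set :: "(nat \<Rightarrow> nat) \<Rightarrow> nat \<Rightarrow> (nat \<times> nat) set" where
  "diag_set \<sigma> i = (\<lambda>r. (r, \<sigma> r)) ` {..<i}"

lemma planted_diag_Suc:
  "planted n s t (diag_set \<sigma> (Suc i)) = {M \<in> planted n s t (diag_set \<sigma> i). M i (\<sigma> i) = 1}"
  by (auto simp: planted_def diag_set_def lessThan_Suc)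

lemma card_diag_set: "card (diag_set \<sigma> i) = i"
  unfolding diag_set_def by (subst card_image) (auto simp: inj_on_def)

text \<open>A product of zero-one entries along \<open>\<sigma>\<close> is the indicator that
  \<open>M\<close> contains the whole diagonal of \<open>\<sigma>\<close>.\<close>

lemma sum_perm_mat_eq:
  "(\<Sum>M\<in>zo_matrices n s t. real (perm_mat n M)) = (\<Sum>\<sigma> | \<sigma> permutes {..<n}. real (card (planted n s t (diag_set \<sigma> n))))"
proof -
  have "(\<Sum>M\<in>zo_matrices n s t. real (perm_mat n M)) = (\<Sum>\<sigma> | \<sigma> permutes {..<n}. \<Sum>M\<in>zo_matrices n s t. real (\<Prod>i<n. M i (\<sigma> i)))"
    unfolding perm_mat_def of_nat_sum by (rule sum.swap)
  also have "\<dots> = (\<Sum>\<sigma> | \<sigma> permutes {..<n}. real (card (planted n s t (diag_set \<sigma> n))))"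
  proof (rule sum.cong[OF refl])
    fix \<sigma>
    have "(\<Sum>M\<in>zo_matrices n s t. real (\<Prod>i<n. M i (\<sigma> i))) = (\<Sum>M\<in>zo_matrices n s t. if M \<in> planted n s t (diag_set \<sigma> n) then 1 else 0)"
    proof (rule sum.cong[OF refl])
      fix M assume M: "M \<in> zo_matrices n s t"
      have c: "M i (\<sigma> i) = 0 \<or> M i (\<sigma> i) = 1" for i
        using M unfolding zo_matrices_def by (metis (mono_tags, lifting) le_Suc_eq le_zero_eq mem_Collect_eq One_nat_def)
      show "real (\<Prod>i<n. M i (\<sigma> i)) = (if M \<in> planted n s t (diag_set \<sigma> n) then 1 else 0)"
      proof (cases "\<forall>i<n. M i (\<sigma> i) = 1")
        case True
        then have "M \<in> planted n s t (diag_set \<sigma> n)" using M by (auto simp: planted_def diag_set_def)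
        then show ?thesis using True by simp
      next
        case False
        then obtain i where i: "i < n" "M i (\<sigma> i) \<noteq> 1" by auto
        then have "M \<notin> planted n s t (diag_set \<sigma> n)" by (auto simp: planted_def diag_set_def)
        moreover have "(\<Prod>i<n. M i (\<sigma> i)) = 0" using i c[of i] by (intro prod_zero) auto
        ultimately show ?thesis by simp
      qed
    qed
    also have "\<dots> = card (planted n s t (diag_set \<sigma> n))"
    proof -
      have "planted n s t (diag_set \<sigma> n) \<subseteq> zo_matrices n s t" by (auto simp: planted_def)
      then show ?thesis using finite_zo_matrices by (simp add: sum.If_cases Int_absorb1)
    qed
    finally show "(\<Sum>M\<in>zo_matrices n s t. real (\<Prod>i<n. M i (\<sigma> i))) = card (planted n s t (diag_set \<sigma> n))" .
  qed
  finally show ?thesis .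
qed

text \<open>A combinatorial sum of Hoeffding's type, handled by composing \<open>\<sigma>\<close>
  with transpositions of weight \<open>1 / (2 * n)\<close>. One transposition changes the sum by at
  most \<open>4 * A\<^sup>2\<close>, so the variance proxy is
  \<open>n\<^sup>2 * 16 * A ^ 4 / (2 * n)\<close>. The assumption \<open>a0\<close> removes the
  mean, which gives both \<open>lin\<close> and, by \<open>1 + u \<le> exp u\<close>, the lower
  bound. With \<open>A\<close> of order \<open>1 / sqrt n\<close> the exponent is of order
  \<open>1 / n\<close>.\<close>

lemma exp_sum_permutations:
  fixes a b :: "nat \<Rightarrow> real" and n :: nat
  assumes n: "0 < n" and a0: "(\<Sum>i<n. a i) = 0" and aA: "\<And>i. i < n \<Longrightarrow> \<bar>a i\<bar> \<le> A" and bA: "\<And>i. i < n \<Longrightarrow> \<bar>b i\<bar> \<le> A"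
    and th: "0 \<le> \<theta>"
  shows "(\<Sum>\<sigma> | \<sigma> permutes {..<n}. exp (\<theta> * (\<Sum>i<n. a i * b (\<sigma> i)))) \<le> fact n * exp (4 * real n * A ^ 4 * \<theta>\<^sup>2)"
    and "fact n \<le> (\<Sum>\<sigma> | \<sigma> permutes {..<n}. exp (\<theta> * (\<Sum>i<n. a i * b (\<sigma> i))))"
proof -
  let ?S = "{\<sigma>. \<sigma> permutes {..<n}}" and ?Q = "{..<n} \<times> {..<n}"
  define f where "f \<sigma> = (\<Sum>i<n. a i * b (\<sigma> i))" for \<sigma> :: "nat \<Rightarrow> nat"
  define \<tau> where "\<tau> = (\<lambda>(i, j) \<sigma>. \<sigma> \<circ> Transposition.transpose i j :: nat \<Rightarrow> nat)"
  have fin: "finite ?S" by (rule finite_permutations) auto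
  have cS: "real (card ?S) = fact n" using card_permutations[of "{..<n}" n] by simp
  have \<tau>S: "\<tau> q \<sigma> \<in> ?S" if "q \<in> ?Q" "\<sigma> \<in> ?S" for q \<sigma>
    using that by (auto simp: \<tau>_def intro!: permutes_compose permutes_swap_id)
  have \<tau>\<tau>: "\<tau> q (\<tau> q \<sigma>) = \<sigma>" for q \<sigma> by (cases q) (auto simp: \<tau>_def fun_eq_iff)
  have df: "f \<sigma> - f (\<tau> (i, j) \<sigma>) = (a i - a j) * (b (\<sigma> i) - b (\<sigma> j))" if "i < n" "j < n" for i j \<sigma>
    using sum_transpose_diff[of "{..<n}" i j a "\<lambda>q. b (\<sigma> q)"] that by (simp add: f_def \<tau>_def)
  have lin: "(\<Sum>q\<in>?Q. 1 / (2 * real n) * (f \<sigma> - f (\<tau> q \<sigma>))) = f \<sigma>" for \<sigma>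
  proof -
    have "(\<Sum>q\<in>?Q. f \<sigma> - f (\<tau> q \<sigma>)) = (\<Sum>i<n. \<Sum>j<n. f \<sigma> - f (\<tau> (i, j) \<sigma>))"
      by (simp add: sum.cartesian_product case_prod_unfold)
    also have "\<dots> = (\<Sum>i<n. \<Sum>j<n. (a i - a j) * (b (\<sigma> i) - b (\<sigma> j)))"
      by (intro sum.cong refl) (simp add: df)
    also have "\<dots> = 2 * n * f \<sigma>"
      using sum_pair_product[of "{..<n}" a "\<lambda>q. b (\<sigma> q)"] a0 by (simp add: f_def)
    finally show ?thesis using n by (simp flip: sum_distrib_left sum_divide_distrib)
  qed
  have var: "(\<Sum>q\<in>?Q. 1 / (2 * real n) * (f \<sigma> - f (\<tau> q \<sigma>))\<^sup>2) \<le> 8 * real n * A ^ 4" if \<sigma>: "\<sigma> \<in> ?S" for \<sigma>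
  proof -
    have "(f \<sigma> - f (\<tau> q \<sigma>))\<^sup>2 \<le> 16 * A ^ 4" if q: "q \<in> ?Q" for q
    proof -
      obtain i j where ij: "q = (i, j)" "i < n" "j < n" using q by auto
      have "\<sigma> i < n" "\<sigma> j < n" using \<sigma> ij permutes_in_image[of \<sigma> "{..<n}"] by auto
      then have "\<bar>a i - a j\<bar> \<le> 2 * A" "\<bar>b (\<sigma> i) - b (\<sigma> j)\<bar> \<le> 2 * A"
        using aA[of i] aA[of j] bA[of "\<sigma> i"] bA[of "\<sigma> j"] ij by linarith+
      then have "\<bar>f \<sigma> - f (\<tau> q \<sigma>)\<bar> \<le> (2 * A) * (2 * A)"
        unfolding ij(1) df[OF ij(2,3)] abs_mult by (intro mult_mono) auto
      then have "\<bar>f \<sigma> - f (\<tau> q \<sigma>)\<bar>\<^sup>2 \<le> ((2 * A) * (2 * A))\<^sup>2" by (intro power_mono) auto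
      then show ?thesis by (simp add: power2_eq_square power_eq_if)
    qed
    then have "(\<Sum>q\<in>?Q. 1 / (2 * real n) * (f \<sigma> - f (\<tau> q \<sigma>))\<^sup>2) \<le> (\<Sum>q\<in>?Q. 1 / (2 * real n) * (16 * A ^ 4))"
      by (intro sum_mono mult_left_mono) auto
    also have "\<dots> = 8 * real n * A ^ 4" using n by simp
    finally show ?thesis .
  qed
  have "(\<Sum>\<sigma>\<in>?S. exp (\<theta> * f \<sigma>)) \<le> card ?S * exp (8 * real n * A ^ 4 * \<theta>\<^sup>2 / 2)"
    by (rule exchange_subgaussian[where Q = ?Q and w = "\<lambda>_ _. 1 / (2 * real n)" and \<tau> = \<tau>])
      (use fin \<tau>S \<tau>\<tau> lin var th in auto)
  also have "\<dots> = fact n * exp (4 * real n * A ^ 4 * \<theta>\<^sup>2)" unfolding cS by simp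
  finally show "(\<Sum>\<sigma> | \<sigma> permutes {..<n}. exp (\<theta> * (\<Sum>i<n. a i * b (\<sigma> i)))) \<le> fact n * exp (4 * real n * A ^ 4 * \<theta>\<^sup>2)"
    by (simp add: f_def)
  have z: "(\<Sum>\<sigma>\<in>?S. f \<sigma>) = 0"
  proof -
    have sw: "(\<Sum>\<sigma>\<in>?S. f (\<tau> q \<sigma>)) = (\<Sum>\<sigma>\<in>?S. f \<sigma>)" if "q \<in> ?Q" for q
      by (rule sum.reindex_bij_witness[of _ "\<tau> q" "\<tau> q"]) (use that \<tau>S \<tau>\<tau> in auto)
    have "(\<Sum>\<sigma>\<in>?S. f \<sigma>) = (\<Sum>\<sigma>\<in>?S. \<Sum>q\<in>?Q. 1 / (2 * real n) * (f \<sigma> - f (\<tau> q \<sigma>)))" by (simp only: lin)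
    also have "\<dots> = (\<Sum>q\<in>?Q. 1 / (2 * real n) * ((\<Sum>\<sigma>\<in>?S. f \<sigma>) - (\<Sum>\<sigma>\<in>?S. f (\<tau> q \<sigma>))))"
      by (subst sum.swap) (simp only: sum_distrib_left[symmetric] sum_subtractf)
    also have "\<dots> = 0" by (rule sum.neutral) (use sw in auto)
    finally show ?thesis .
  qed
  have "(\<Sum>\<sigma>\<in>?S. 1 + \<theta> * f \<sigma>) \<le> (\<Sum>\<sigma>\<in>?S. exp (\<theta> * f \<sigma>))"
    by (intro sum_mono exp_ge_add_one_self)
  moreover have "(\<Sum>\<sigma>\<in>?S. 1 + \<theta> * f \<sigma>) = fact n"
    using cS z by (simp add: sum.distrib flip: sum_distrib_left)
  ultimately show "fact n \<le> (\<Sum>\<sigma> | \<sigma> permutes {..<n}. exp (\<theta> * (\<Sum>i<n. a i * b (\<sigma> i))))"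
    by (simp add: f_def)
qed

section \<open>The logarithm of an entry probability\<close>

context dense_degrees
begin

lemma inv_lam_le: "1 / lam \<le> x" and inv_colam_le: "1 / (1 - lam) \<le> x"
proof -
  have "lam * (1 - lam) \<le> lam" "lam * (1 - lam) \<le> 1 - lam" using lam by (auto simp: mult_le_cancel_left1 mult_le_cancel_right1)
  then have "1 / x \<le> lam" "1 / x \<le> 1 - lam" using lam_ge by auto
  then show "1 / lam \<le> x" "1 / (1 - lam) \<le> x" using lam x_pos by (simp_all add: field_simps)
qed

text \<open>Deviations relative to the mean \<open>lam * n\<close>: small enough for the logarithm
  to be expanded, and summing to zero over all rows, as \<open>cdev\<close> does over all
  columns.\<close>

definition rdev :: "nat \<Rightarrow> real" where "rdev i = (real (s i) - lam * n) / (lam * n)"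
definition cdev :: "nat \<Rightarrow> real" where "cdev k = (real (t k) - lam * n) / (lam * n)"

lemma dev_bound:
  assumes "\<bar>z - lam * n\<bar> \<le> x\<^sup>2 * y"
  shows "\<bar>(z - lam * n) / (lam * n)\<bar> \<le> x ^ 3 / y"
proof -
  have "\<bar>(z - lam * n) / (lam * n)\<bar> = \<bar>z - lam * n\<bar> * (1 / lam) * (1 / n)" using lam by (simp add: abs_mult)
  also have "\<dots> \<le> (x\<^sup>2 * y) * x * (1 / n)"
    using assms inv_lam_le lam x_pos y_pos by (intro mult_mono) auto
  also have "\<dots> = x ^ 3 / y" using y_pos by (simp add: n_y power2_eq_square power_eq_if)
  finally show ?thesis .
qed

lemma rdev_bound: "i < n \<Longrightarrow> \<bar>rdev i\<bar> \<le> x ^ 3 / y" and cdev_bound: "i < n \<Longrightarrow> \<bar>cdev i\<bar> \<le> x ^ 3 / y"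
  unfolding rdev_def cdev_def using dev_bound s_dev t_dev by auto

lemma sum_rdev: "(\<Sum>i<n. rdev i) = 0" and sum_cdev: "(\<Sum>i<n. cdev i) = 0"
  unfolding rdev_def cdev_def using sum_s sum_t
  by (simp_all add: sum_subtractf power2_eq_square flip: sum_divide_distrib)

text \<open>Here \<open>p\<close> is the conditional probability delivered by \<open>entry_probability\<close> and \<open>i\<close> the number of entries already planted.\<close>
lemma ln_entry_probability:
  fixes p :: real
  assumes jk: "j < n" "k < n" and i: "i \<le> n"
    and p: "\<bar>p - (real (t k) / n + (real (s j) - lam * n) / n
      + (1 - 2 * lam) / (lam * (1 - lam) * real n ^ 2) * (real (s j) - lam * n) * (real (t k) - lam * n)
      + i * (1 - lam) / real n ^ 2)\<bar> \<le> 5 * x ^ 10 / (n * y)"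
  shows "0 < p" and "\<bar>ln p - (ln lam + rdev j + cdev k - ((rdev j)\<^sup>2 + (cdev k)\<^sup>2) / 2
      - lam / (1 - lam) * (rdev j * cdev k) + i * (1 - lam) / (lam * real n ^ 2))\<bar> \<le> 6 * x ^ 11 / (n * y)"
proof -
  let ?a = "rdev j" and ?b = "cdev k" and ?\<theta> = "lam / (1 - lam)"
  let ?v = "i * (1 - lam) / (lam * real n ^ 2)"
  have sa: "real (s j) - lam * n = lam * n * ?a" and tb: "real (t k) - lam * n = lam * n * ?b"
    using lam n_pos by (simp_all add: rdev_def cdev_def)
  define q where "q = real (t k) / n + (real (s j) - lam * n) / n
      + (1 - 2 * lam) / (lam * (1 - lam) * real n ^ 2) * (real (s j) - lam * n) * (real (t k) - lam * n)
      + i * (1 - lam) / real n ^ 2"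
  \<comment> \<open>With \<open>lam\<close> taken out, the coefficient of the mixed term becomes
    \<open>(1 - 2 * lam) / (1 - lam)\<close>, which is \<open>1 - ?\<theta>\<close>.\<close>
  have q: "q = lam * (1 + ?a + ?b + (1 - ?\<theta>) * (?a * ?b) + ?v)"
  proof -
    have "real (t k) / n = lam * (1 + ?b)" using tb n_pos by (simp add: field_simps)
    moreover have "(real (s j) - lam * n) / n = lam * ?a" using sa n_pos by simp
    moreover have "(1 - 2 * lam) / (lam * (1 - lam) * real n ^ 2) * (real (s j) - lam * n) * (real (t k) - lam * n) = lam * ((1 - ?\<theta>) * (?a * ?b))"
    proof -
      have "(u - l) / (l * u * N\<^sup>2) * (l * N * a) * (l * N * b) = l * ((1 - l / u) * (a * b))"
        if "0 < l" "0 < u" "0 < N" for l u N a b :: real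
        using that by (simp add: field_simps power2_eq_square)
      from this[of lam "1 - lam" "real n"] show ?thesis unfolding sa tb using lam n_pos by simp
    qed
    moreover have "i * (1 - lam) / real n ^ 2 = lam * ?v" using lam by simp
    ultimately show ?thesis unfolding q_def by (simp add: algebra_simps)
  qed
  define er where "er = (p - q) / lam"
  define w where "w = (1 - ?\<theta>) * (?a * ?b) + ?v + er"
  define u where "u = ?a + ?b + w"
  have pu: "p = lam * (1 + u)"
  proof -
    have "lam * (1 + u) = q + lam * er" unfolding u_def w_def q by (simp add: distrib_left)
    then show ?thesis using lam by (simp add: er_def)
  qed
  have er: "\<bar>er\<bar> \<le> 5 * x ^ 11 / (n * y)"
  proof -
    have "\<bar>er\<bar> = \<bar>p - q\<bar> * (1 / lam)" using lam by (simp add: er_def)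
    also have "\<dots> \<le> 5 * x ^ 10 / (n * y) * x"
      using p inv_lam_le lam x_pos y_pos unfolding q_def by (intro mult_mono) auto
    also have "\<dots> = 5 * x ^ 11 / (n * y)" by (simp add: power_eq_if)
    finally show ?thesis .
  qed
  have ab: "\<bar>?a\<bar> \<le> x ^ 3 / y" "\<bar>?b\<bar> \<le> x ^ 3 / y" using rdev_bound cdev_bound jk by auto
  have th: "0 \<le> ?\<theta>" "?\<theta> \<le> x"
  proof -
    have "lam * (1 / (1 - lam)) \<le> 1 * x" using lam inv_colam_le by (intro mult_mono) auto
    then show "?\<theta> \<le> x" by simp
  qed (use lam in auto)
  have wb: "\<bar>w\<bar> \<le> 2 * x ^ 7 / n"
  proof -
    have 1: "\<bar>(1 - ?\<theta>) * (?a * ?b)\<bar> \<le> x ^ 7 / n"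
    proof -
      have "\<bar>(1 - ?\<theta>) * (?a * ?b)\<bar> \<le> x * ((x ^ 3 / y) * (x ^ 3 / y))"
        unfolding abs_mult using ab th x_ge y_pos by (intro mult_mono) auto
      also have "\<dots> = x ^ 7 / n" by (simp add: n_y power2_eq_square power_eq_if)
      finally show ?thesis .
    qed
    have 2: "\<bar>?v\<bar> \<le> x / n"
    proof -
      have "\<bar>?v\<bar> = real i * (1 - lam) * (1 / lam) * (1 / real n ^ 2)" using lam by simp
      also have "\<dots> \<le> real n * 1 * x * (1 / real n ^ 2)"
        using i lam inv_lam_le x_pos by (intro mult_mono) auto
      also have "\<dots> = x / n" using n_pos by (simp add: power2_eq_square)
      finally show ?thesis .
    qed
    have 3: "5 * x ^ 11 / (n * y) \<le> 5 / n"
    proof -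
      have "5 * x ^ 11 / (n * y) \<le> 5 * y / (n * y)" using x_pow_y[of 11] y_pos by (intro divide_right_mono) auto
      then show ?thesis using y_pos by simp
    qed
    have "x + 5 \<le> x ^ 7"
    proof -
      have "x + 5 \<le> x * x" using x_ge mult_right_mono[of 2 x x] by linarith
      also have "\<dots> = x ^ 2" by (simp add: power2_eq_square)
      also have "\<dots> \<le> x ^ 7" by (rule x_pow_mono) simp
      finally show ?thesis .
    qed
    then have 4: "(x + 5) / n \<le> x ^ 7 / n" by (intro divide_right_mono) auto
    have "\<bar>w\<bar> \<le> \<bar>(1 - ?\<theta>) * (?a * ?b)\<bar> + \<bar>?v\<bar> + \<bar>er\<bar>"
      unfolding w_def by (intro order_trans[OF abs_triangle_ineq] add_mono order_refl)
    also have "\<dots> \<le> x ^ 7 / n + x / n + 5 / n" by (intro add_mono 1 2 order_trans[OF er 3])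
    also have "\<dots> \<le> 2 * x ^ 7 / n" using 4 by (simp add: add_divide_distrib)
    finally show ?thesis .
  qed
  have wy: "2 * x ^ 7 / n \<le> x ^ 3 / y"
  proof -
    have "2 * x ^ 4 \<le> x * x ^ 4" using x_ge by (intro mult_right_mono) auto
    also have "\<dots> = x ^ 5" by (simp add: power_eq_if)
    also have "\<dots> \<le> y" by (rule x_pow_y) simp
    finally have "2 * x ^ 4 * x ^ 3 \<le> y * x ^ 3" using x_pos by (intro mult_right_mono) auto
    then have "2 * x ^ 7 \<le> y * x ^ 3" by (simp add: power_eq_if)
    then have "2 * x ^ 7 / n \<le> y * x ^ 3 / n" by (intro divide_right_mono) auto
    also have "\<dots> = x ^ 3 / y" using y_pos by (simp add: n_y power2_eq_square)
    finally show ?thesis .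
  qed
  have ub: "\<bar>u\<bar> \<le> 3 * (x ^ 3 / y)" unfolding u_def using ab wb wy by linarith
  have small: "3 * (x ^ 3 / y) \<le> 1 / 2"
  proof -
    have "6 * x ^ 3 \<le> x * x ^ 3" using x_ge by (intro mult_right_mono) auto
    also have "\<dots> = x ^ 4" by (simp add: power_eq_if)
    also have "\<dots> \<le> y" by (rule x_pow_y) simp
    finally show ?thesis using y_pos by (simp add: field_simps)
  qed
  have u2: "\<bar>u\<bar> \<le> 1 / 2" using ub small by linarith
  then have u1: "0 < 1 + u" by linarith
  show "0 < p" using pu lam u1 by simp
  have lp: "ln p = ln lam + ln (1 + u)" using pu lam u1 by (simp add: ln_mult)
  have A: "\<bar>ln (1 + u) - (u - u\<^sup>2 / 2)\<bar> \<le> 54 * x ^ 9 / (n * y)"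
  proof -
    have "\<bar>ln (1 + u) - (u - u\<^sup>2 / 2)\<bar> \<le> 2 * \<bar>u\<bar> ^ 3" by (rule ln_quadratic_bound[OF u2])
    also have "\<dots> \<le> 2 * (3 * (x ^ 3 / y)) ^ 3" using ub by (intro mult_left_mono power_mono) auto
    also have "\<dots> = 54 * x ^ 9 / (n * y)" by (simp add: n_y power2_eq_square power_eq_if)
    finally show ?thesis .
  qed
  have B: "\<bar>(?a + ?b) * w\<bar> \<le> 4 * x ^ 10 / (n * y)"
  proof -
    have "\<bar>?a + ?b\<bar> \<le> 2 * (x ^ 3 / y)" using ab by linarith
    then have "\<bar>(?a + ?b) * w\<bar> \<le> (2 * (x ^ 3 / y)) * (2 * x ^ 7 / n)"
      unfolding abs_mult using wb x_pos y_pos by (intro mult_mono) auto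
    also have "\<dots> = 4 * x ^ 10 / (n * y)" by (simp add: power_eq_if)
    finally show ?thesis .
  qed
  have C: "\<bar>w\<^sup>2 / 2\<bar> \<le> x ^ 10 / (n * y)"
  proof -
    have "w\<^sup>2 = \<bar>w\<bar> * \<bar>w\<bar>" by (simp add: power2_eq_square)
    also have "\<dots> \<le> (x ^ 3 / y) * (2 * x ^ 7 / n)"
      using wb wy x_pos y_pos by (intro mult_mono) auto
    also have "\<dots> = 2 * (x ^ 10 / (n * y))" by (simp add: power_eq_if mult_ac)
    finally show ?thesis by (simp add: mult.commute)
  qed
  \<comment> \<open>The square of \<open>?a + ?b\<close> contributes minus the product
    \<open>?a * ?b\<close>, which cancels the 1 in the coefficient \<open>1 - ?\<theta>\<close>. The
    mixed term left over has coefficient \<open>- ?\<theta>\<close>.\<close>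
  have eq: "(u - u\<^sup>2 / 2) - (?a + ?b - (?a\<^sup>2 + ?b\<^sup>2) / 2 - ?\<theta> * (?a * ?b) + ?v) = er - (?a + ?b) * w - w\<^sup>2 / 2"
  proof -
    have "(\<alpha> + \<beta> + ((1 - \<tau>) * (\<alpha> * \<beta>) + \<nu> + \<eta>) - (\<alpha> + \<beta> + ((1 - \<tau>) * (\<alpha> * \<beta>) + \<nu> + \<eta>))\<^sup>2 / 2)
      - (\<alpha> + \<beta> - (\<alpha>\<^sup>2 + \<beta>\<^sup>2) / 2 - \<tau> * (\<alpha> * \<beta>) + \<nu>) = \<eta> - (\<alpha> + \<beta>) * ((1 - \<tau>) * (\<alpha> * \<beta>) + \<nu> + \<eta>) - ((1 - \<tau>) * (\<alpha> * \<beta>) + \<nu> + \<eta>)\<^sup>2 / 2"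
      for \<alpha> \<beta> \<tau> \<nu> \<eta> :: real by (simp add: power2_eq_square field_simps)
    then show ?thesis unfolding u_def w_def by blast
  qed
  have D: "5 * x ^ 11 / (n * y) + 54 * x ^ 9 / (n * y) + 4 * x ^ 10 / (n * y) + x ^ 10 / (n * y) \<le> 6 * x ^ 11 / (n * y)"
  proof -
    have "59 * x ^ 10 \<le> x * x ^ 10" using x_ge by (intro mult_right_mono) auto
    also have "\<dots> = x ^ 11" by (simp add: power_eq_if)
    finally have "5 * x ^ 11 + 54 * x ^ 9 + 4 * x ^ 10 + x ^ 10 \<le> 6 * x ^ 11" using x_pow_mono[of 9 10] by simp
    then have "(5 * x ^ 11 + 54 * x ^ 9 + 4 * x ^ 10 + x ^ 10) / (n * y) \<le> 6 * x ^ 11 / (n * y)"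
      using y_pos by (intro divide_right_mono) auto
    then show ?thesis by (simp only: add_divide_distrib)
  qed
  have gen: "\<bar>L - (l0 + (\<alpha> + \<beta> - \<gamma> - \<delta> + \<nu>))\<bar> \<le> K"
    if "L = l0 + L1" "\<bar>L1 - U\<bar> \<le> k1" "U - (\<alpha> + \<beta> - \<gamma> - \<delta> + \<nu>) = \<eta> - P - W" "\<bar>\<eta>\<bar> \<le> k2" "\<bar>P\<bar> \<le> k3" "\<bar>W\<bar> \<le> k4" "k2 + k1 + k3 + k4 \<le> K"
    for L l0 L1 U \<alpha> \<beta> \<gamma> \<delta> \<nu> \<eta> P W k1 k2 k3 k4 K :: real
    using that by linarith
  have "\<bar>ln p - (ln lam + (?a + ?b - (?a\<^sup>2 + ?b\<^sup>2) / 2 - ?\<theta> * (?a * ?b) + ?v))\<bar> \<le> 6 * x ^ 11 / (n * y)"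
    by (rule gen[OF lp A eq er B C D])
  then show "\<bar>ln p - (ln lam + ?a + ?b - (?a\<^sup>2 + ?b\<^sup>2) / 2 - ?\<theta> * (?a * ?b) + ?v)\<bar> \<le> 6 * x ^ 11 / (n * y)"
    by (simp add: algebra_simps)
qed

end

section \<open>Existence of a matrix\<close>

definition mv :: "nat \<Rightarrow> nat \<Rightarrow> nat \<Rightarrow> (nat \<Rightarrow> nat \<Rightarrow> nat) \<Rightarrow> nat \<Rightarrow> nat \<Rightarrow> nat" where
  "mv j m k M = (\<lambda>i q. if q = k then (if i = j then 0 else if i = m then 1 else M i q) else M i q)"

text \<open>Row sums are left free: \<open>mv\<close> preserves the column sums, and the row sums
  are to be repaired by moves.\<close>

definition col_matrices :: "nat \<Rightarrow> (nat \<Rightarrow> nat) \<Rightarrow> (nat \<Rightarrow> nat \<Rightarrow> nat) set" where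
  "col_matrices n t = {M. (\<forall>i k. M i k \<le> 1) \<and> (\<forall>i k. (n \<le> i \<or> n \<le> k) \<longrightarrow> M i k = 0) \<and> (\<forall>k<n. (\<Sum>i<n. M i k) = t k)}"

definition row_total :: "nat \<Rightarrow> (nat \<Rightarrow> nat \<Rightarrow> nat) \<Rightarrow> nat \<Rightarrow> int" where
  "row_total n M i = (\<Sum>k<n. int (M i k))"

lemma mv_col_matrices:
  assumes M: "M \<in> col_matrices n t" and jm: "j < n" "m < n" "k < n" and jk: "M j k = 1" and mk: "M m k = 0"
  shows "mv j m k M \<in> col_matrices n t"
proof -
  have ne: "j \<noteq> m" using jk mk by auto
  have "(\<Sum>i<n. mv j m k M i q) = t q" if "q < n" for q
  proof (cases "q = k")
    case True
    have *: "(\<Sum>i<n. N i) = N j + N m + (\<Sum>i\<in>{..<n} - {j, m}. N i)" for N :: "nat \<Rightarrow> nat"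
      using jm ne sum.subset_diff[of "{j, m}" "{..<n}" N] by simp
    have "(\<Sum>i\<in>{..<n} - {j, m}. mv j m k M i q) = (\<Sum>i\<in>{..<n} - {j, m}. M i q)"
      by (rule sum.cong) (auto simp: mv_def)
    then have "(\<Sum>i<n. mv j m k M i q) = (\<Sum>i<n. M i q)"
      using *[of "\<lambda>i. mv j m k M i q"] *[of "\<lambda>i. M i q"] jk mk ne True by (simp add: mv_def)
    then show ?thesis using M that by (simp add: col_matrices_def)
  next
    case False
    then show ?thesis using M that by (simp add: mv_def col_matrices_def)
  qed
  moreover have "mv j m k M i q \<le> 1" for i q using M by (auto simp: mv_def col_matrices_def)
  moreover have "mv j m k M i q = 0" if "n \<le> i \<or> n \<le> q" for i q
    using M that jm unfolding mv_def col_matrices_def by auto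
  ultimately show ?thesis unfolding col_matrices_def by blast
qed

lemma row_total_mv:
  assumes "k < n" "M j k = 1" "M m k = 0"
  shows "row_total n (mv j m k M) i = row_total n M i - (if i = j then 1 else 0) + (if i = m then 1 else 0)"
proof -
  have ne: "j \<noteq> m" using assms by auto
  have *: "(\<Sum>q<n. N q) = N k + (\<Sum>q\<in>{..<n} - {k}. N q)" for N :: "nat \<Rightarrow> int"
    using assms by (simp add: sum.remove)
  have "(\<Sum>q\<in>{..<n} - {k}. int (mv j m k M i q)) = (\<Sum>q\<in>{..<n} - {k}. int (M i q))"
    by (rule sum.cong) (auto simp: mv_def)
  then show ?thesis unfolding row_total_def
    using *[of "\<lambda>q. int (mv j m k M i q)"] *[of "\<lambda>q. int (M i q)"] assms ne by (simp add: mv_def)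
qed

definition imbalance :: "nat \<Rightarrow> (nat \<Rightarrow> nat) \<Rightarrow> (nat \<Rightarrow> nat \<Rightarrow> nat) \<Rightarrow> nat" where
  "imbalance n s M = nat (\<Sum>i<n. (row_total n M i - int (s i))\<^sup>2)"

text \<open>Moving one unit from an excess \<open>a\<close> to an excess \<open>b\<close> with
  \<open>b + 2 \<le> a\<close> lowers the sum of squares. Only the row totals of \<open>N\<close>
  enter, so the lemma covers a single move as well as two moves through an intermediate row.\<close>

lemma imbalance_decreases:
  assumes jm: "j < n" "m < n" "j \<noteq> m"
    and N: "\<And>i. i < n \<Longrightarrow> row_total n N i = row_total n M i - (if i = j then 1 else 0) + (if i = m then 1 else 0)"
    and gap: "row_total n M m - int (s m) + 2 \<le> row_total n M j - int (s j)"
  shows "imbalance n s N < imbalance n s M"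
proof -
  let ?e = "\<lambda>M i. (row_total n M i - int (s i))\<^sup>2"
  have *: "(\<Sum>i<n. g i) = g j + g m + (\<Sum>i\<in>{..<n} - {j, m}. g i)" for g :: "nat \<Rightarrow> int"
    using jm sum.subset_diff[of "{j, m}" "{..<n}" g] by simp
  have r: "(\<Sum>i\<in>{..<n} - {j, m}. ?e N i) = (\<Sum>i\<in>{..<n} - {j, m}. ?e M i)"
    by (rule sum.cong) (auto simp: N)
  have "?e N j + ?e N m < ?e M j + ?e M m"
  proof -
    have "(a - 1)\<^sup>2 + (b + 1)\<^sup>2 < a\<^sup>2 + b\<^sup>2" if "b + 2 \<le> a" for a b :: int
      using that by (simp add: power2_eq_square algebra_simps)
    note * = this[OF gap]
    have "row_total n N j - int (s j) = row_total n M j - int (s j) - 1"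
      "row_total n N m - int (s m) = row_total n M m - int (s m) + 1"
      using N[OF jm(1)] N[OF jm(2)] jm(3) by auto
    then show ?thesis using * by (simp only:)
  qed
  then have "(\<Sum>i<n. ?e N i) < (\<Sum>i<n. ?e M i)" using *[of "?e N"] *[of "?e M"] r by linarith
  moreover have "0 \<le> (\<Sum>i<n. ?e N i)" by (intro sum_nonneg) auto
  ultimately show ?thesis unfolding imbalance_def by (simp add: nat_less_eq_zless)
qed

text \<open>A matrix with the right column sums and least imbalance has the right row sums: otherwise a one
  could be moved from an overfull row to an underfull one, directly or through a third row.\<close>
lemma (in dense_degrees) zo_matrices_nonempty: "zo_matrices n s t \<noteq> {}"
proof -
  let ?d = "x\<^sup>2 * y"
  have d5: "5 * ?d < n / x"
  proof -
    have "5 * x ^ 3 < x * x ^ 3" using x_ge by (intro mult_strict_right_mono) auto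
    also have "\<dots> = x ^ 4" by (simp add: power_eq_if)
    also have "\<dots> \<le> y" by (rule x_pow_y) simp
    finally have "5 * x ^ 3 * y < y * y" using y_pos by (intro mult_strict_right_mono) auto
    moreover have "5 * x ^ 3 * y = 5 * ?d * x" by (simp add: power_eq_if)
    ultimately show ?thesis using x_pos by (simp add: n_y power2_eq_square less_divide_eq)
  qed
  have d0: "0 \<le> ?d" using y_pos by simp
  have tn: "t k \<le> n" if "k < n" for k
  proof -
    have "lam * (1 - lam) \<le> 1 - lam" using lam by (simp add: mult_le_cancel_right1)
    then have "1 / x * n \<le> (1 - lam) * n" using lam_ge by (intro mult_right_mono) auto
    then have "n / x \<le> n - lam * n" by (simp add: algebra_simps)
    then have "real (t k) \<le> n" using t_dev[OF that] d5 d0 by linarith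
    then show ?thesis by simp
  qed
  \<comment> \<open>A starting point for the minimisation: every column is filled from the top,
    which \<open>tn\<close> permits.\<close>
  have "(\<lambda>i k. if i < t k \<and> k < n then 1 else 0) \<in> col_matrices n t"
  proof -
    have "(\<Sum>i<n. if i < t k \<and> k < n then 1 else 0) = t k" if "k < n" for k
    proof -
      have "{..<n} \<inter> {i. i < t k} = {..<t k}" using tn[OF that] by auto
      then show ?thesis using that by (simp add: sum.If_cases)
    qed
    moreover have "\<not> (i < t k \<and> k < n)" if "n \<le> i \<or> n \<le> k" for i k using that tn[of k] by auto
    ultimately show ?thesis unfolding col_matrices_def by auto
  qed
  then obtain M where M: "M \<in> col_matrices n t"
    and min: "\<And>N. N \<in> col_matrices n t \<Longrightarrow> imbalance n s M \<le> imbalance n s N"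
    using ex_has_least_nat[of "\<lambda>M. M \<in> col_matrices n t" _ "imbalance n s"] by blast
  have M1: "M i k = 0 \<or> M i k = 1" for i k
    using M unfolding col_matrices_def by (metis (mono_tags, lifting) le_Suc_eq le_zero_eq mem_Collect_eq One_nat_def)
  define r where "r = row_total n M"
  define e where "e i = r i - int (s i)" for i
  have sub: "M m k = 1" if g: "j < n" "m < n" "e m + 2 \<le> e j" "k < n" "M j k = 1" for j m k
  proof (rule ccontr)
    assume "M m k \<noteq> 1"
    then have mk: "M m k = 0" using M1[of m k] by simp
    have "imbalance n s (mv j m k M) < imbalance n s M"
      by (rule imbalance_decreases[of j n m]) (use g mk row_total_mv[of k n M j m, OF g(4,5) mk] in \<open>auto simp: e_def r_def\<close>)
    then show False using min[OF mv_col_matrices[of M n t j m k, OF M g(1,2,4,5) mk]] by simp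
  qed
  \<comment> \<open>Two moves: a one goes from \<open>j\<close> to \<open>i\<close> in column
    \<open>k\<close>, then from \<open>i\<close> to \<open>m\<close> in column \<open>l\<close>. Row
    \<open>i\<close> keeps its total, and by minimality the second move must be blocked.\<close>
  have sub2: "M m l = 1" if g: "j < n" "m < n" "e m + 2 \<le> e j" "i < n" "k < n" "l < n" "M j k = 1" "M i k = 0" "M i l = 1" for i j m k l
  proof (rule ccontr)
    assume "M m l \<noteq> 1"
    then have ml: "M m l = 0" using M1[of m l] by simp
    let ?M = "mv j i k M" and ?N = "mv i m l (mv j i k M)"
    have kl: "k \<noteq> l" using g by auto
    have a: "?M i l = 1" "?M m l = 0" using kl g ml by (auto simp: mv_def)
    have M': "?M \<in> col_matrices n t" by (rule mv_col_matrices[OF M]) (use g in auto)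
    have N: "?N \<in> col_matrices n t" by (rule mv_col_matrices[OF M']) (use g a in auto)
    have "imbalance n s ?N < imbalance n s M"
    proof (rule imbalance_decreases[of j n m])
      show "row_total n ?N q = row_total n M q - (if q = j then 1 else 0) + (if q = m then 1 else 0)" for q
        using row_total_mv[of l n ?M i m q, OF g(6) a] row_total_mv[of k n M j i q, OF g(5,7,8)] by simp
    qed (use g in \<open>auto simp: e_def r_def\<close>)
    then show False using min[OF N] by simp
  qed
  have rr: "real_of_int (r i) = (\<Sum>k<n. real (M i k))" for i unfolding r_def row_total_def by simp
  have colr: "(\<Sum>i<n. real (M i k)) = real (t k)" if "k < n" for k
    using M that unfolding col_matrices_def by (simp flip: of_nat_sum)
  have sume: "(\<Sum>i<n. e i) = 0"
  proof -
    have "(\<Sum>i<n. real_of_int (r i)) = (\<Sum>k<n. real (t k))"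
      unfolding rr by (subst sum.swap) (simp add: colr)
    then have "real_of_int (\<Sum>i<n. e i) = 0" using sum_s sum_t by (simp add: e_def sum_subtractf)
    then show ?thesis by linarith
  qed
  have "e i = 0" if "i < n" for i
  proof (rule ccontr)
    assume ne: "e i \<noteq> 0"
    have fin: "finite (e ` {..<n})" "e ` {..<n} \<noteq> {}" using n_pos by auto
    obtain j where j: "j < n" "e j = Max (e ` {..<n})" using Max_in[OF fin] by auto
    obtain m where m: "m < n" "e m = Min (e ` {..<n})" using Min_in[OF fin] by auto
    have jmax: "e q \<le> e j" and mmin: "e m \<le> e q" if "q < n" for q using that fin j m by auto
    have "1 \<le> e j"
    proof (rule ccontr)
      assume "\<not> 1 \<le> e j"
      then have "e q \<le> 0" if "q < n" for q using jmax[OF that] by linarith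
      then have "(\<Sum>q<n. - e q) = 0 \<longleftrightarrow> (\<forall>q\<in>{..<n}. - e q = 0)" by (intro sum_nonneg_eq_0_iff) auto
      then show False using sume ne \<open>i < n\<close> by (auto simp: sum_negf)
    qed
    have "e m \<le> - 1"
    proof (rule ccontr)
      assume "\<not> e m \<le> - 1"
      then have "0 \<le> e q" if "q < n" for q using mmin[OF that] by linarith
      then have "(\<Sum>q<n. e q) = 0 \<longleftrightarrow> (\<forall>q\<in>{..<n}. e q = 0)" by (intro sum_nonneg_eq_0_iff) auto
      then show False using sume ne \<open>i < n\<close> by auto
    qed
    have gap: "e m + 2 \<le> e j" using \<open>1 \<le> e j\<close> \<open>e m \<le> - 1\<close> by simp
    have jm: "M j k \<le> M m k" if "k < n" for k
      using sub[OF j(1) m(1) gap that] M1[of j k] by auto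
    \<comment> \<open>Row \<open>j\<close> has the largest excess, yet its ones are contained in
      those of row \<open>m\<close>. As the prescribed sums differ by at most \<open>2 * ?d\<close>,
      the largest excess is at most \<open>2 * ?d\<close>.\<close>
    have rjm: "r j \<le> r m" unfolding r_def row_total_def by (intro sum_mono) (use jm in auto)
    have er: "real_of_int (e q) = real_of_int (r q) - real (s q)" for q by (simp add: e_def)
    have "real_of_int (e j) \<le> 2 * ?d"
    proof -
      have "real_of_int (r j) \<le> r m" "real_of_int (e m) \<le> - 1" using rjm \<open>e m \<le> - 1\<close> by linarith+
      then show ?thesis using er[of j] er[of m] s_dev[OF j(1)] s_dev[OF m(1)] by linarith
    qed
    then have rq: "real_of_int (r q) \<le> lam * n + 3 * ?d" if "q < n" for q
      using jmax[OF that] er[of q] s_dev[OF that] by linarith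
    have rj: "lam * n - ?d \<le> real_of_int (r j)" using er[of j] s_dev[OF j(1)] \<open>1 \<le> e j\<close> by linarith
    have rm: "real_of_int (r m) \<le> lam * n + ?d" using er[of m] s_dev[OF m(1)] \<open>e m \<le> - 1\<close> by linarith
    let ?O = "{l \<in> {..<n}. M m l = 0}"
    \<comment> \<open>Every row has few ones in the columns where row \<open>m\<close> is zero. If
      row \<open>q\<close> can take a one from row \<open>j\<close>, then \<open>sub2\<close>
      forbids any one there. Otherwise row \<open>q\<close> contains all ones of row
      \<open>j\<close>, which lie outside \<open>?O\<close>, and exceeds row \<open>j\<close> by at
      most \<open>4 * ?d\<close>. Yet \<open>?O\<close> has about \<open>(1 - lam) * n\<close>
      columns, each with sum about \<open>lam * n\<close>: too many ones, by
      \<open>d5\<close>.\<close>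
    have row: "(\<Sum>l\<in>?O. real (M q l)) \<le> 4 * ?d" if q: "q < n" for q
    proof (cases "\<exists>k<n. M j k = 1 \<and> M q k = 0")
      case True
      then obtain k where k: "k < n" "M j k = 1" "M q k = 0" by auto
      have "M q l = 0" if "l \<in> ?O" for l
        using sub2[OF j(1) m(1) gap q k(1) _ k(2,3), of l] M1[of q l] that by auto
      then have "(\<Sum>l\<in>?O. real (M q l)) = 0" by (intro sum.neutral) auto
      then show ?thesis using d0 by simp
    next
      case False
      have "(\<Sum>l\<in>{..<n} - ?O. real (M j l)) \<le> (\<Sum>l\<in>{..<n} - ?O. real (M q l))"
      proof (rule sum_mono)
        fix l assume "l \<in> {..<n} - ?O"
        then show "real (M j l) \<le> real (M q l)" using False M1[of j l] M1[of q l] by auto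
      qed
      moreover have "(\<Sum>l\<in>{..<n} - ?O. real (M j l)) = (\<Sum>l<n. real (M j l))"
      proof (rule sum.mono_neutral_left)
        show "\<forall>l\<in>{..<n} - ({..<n} - ?O). real (M j l) = 0" using jm by force
      qed auto
      moreover have "(\<Sum>l<n. real (M q l)) = (\<Sum>l\<in>{..<n} - ?O. real (M q l)) + (\<Sum>l\<in>?O. real (M q l))"
        by (rule sum.subset_diff) auto
      ultimately show ?thesis using rq[OF q] rj unfolding rr by linarith
    qed
    have "(\<Sum>l\<in>?O. real (t l)) = (\<Sum>q<n. \<Sum>l\<in>?O. real (M q l))"
      by (subst sum.swap) (simp add: colr)
    also have "\<dots> \<le> (\<Sum>q<n. 4 * ?d)" by (intro sum_mono row) auto
    finally have up: "(\<Sum>l\<in>?O. real (t l)) \<le> n * (4 * ?d)" by simp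
    have cO: "real (card ?O) = n - real_of_int (r m)"
    proof -
      have "real_of_int (r m) = (\<Sum>l<n. 1 - (if M m l = 0 then 1 else 0))"
        unfolding rr
      proof (rule sum.cong[OF refl])
        fix l show "real (M m l) = 1 - (if M m l = 0 then 1 else 0)" using M1[of m l] by auto
      qed
      also have "\<dots> = n - real (card ({..<n} \<inter> {l. M m l = 0}))" by (simp add: sum_subtractf sum.If_cases)
      also have "{..<n} \<inter> {l. M m l = 0} = ?O" by auto
      finally show ?thesis by simp
    qed
    have "(\<Sum>l\<in>?O. lam * n - ?d) \<le> (\<Sum>l\<in>?O. real (t l))"
    proof (rule sum_mono)
      fix l assume "l \<in> ?O"
      then show "lam * n - ?d \<le> real (t l)" using t_dev[of l] by auto
    qed
    then have lo: "card ?O * (lam * n - ?d) \<le> n * (4 * ?d)" using up by simp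
    have ln0: "0 \<le> lam * n - ?d"
    proof -
      have "lam * (1 - lam) \<le> lam" using lam by (simp add: mult_le_cancel_left1)
      then have "1 / x * n \<le> lam * n" using lam_ge by (intro mult_right_mono) auto
      then show ?thesis using d5 d0 by simp
    qed
    have "(n - (lam * n + ?d)) * (lam * n - ?d) \<le> card ?O * (lam * n - ?d)"
      using cO rm ln0 by (intro mult_right_mono) auto
    then have "(n - (lam * n + ?d)) * (lam * n - ?d) \<le> n * (4 * ?d)" using lo by linarith
    moreover have "(n - (lam * n + ?d)) * (lam * n - ?d) = n * (lam * (1 - lam) * n - ?d) + ?d * ?d" by (simp add: algebra_simps)
    moreover have "0 \<le> ?d * ?d" by simp
    ultimately have "n * (lam * (1 - lam) * n - ?d) \<le> n * (4 * ?d)" by linarith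
    then have "lam * (1 - lam) * n - ?d \<le> 4 * ?d" using n_pos by (simp only: mult_le_cancel_left_pos of_nat_0_less_iff)
    moreover have "1 / x * n \<le> lam * (1 - lam) * n" using lam_ge by (intro mult_right_mono) auto
    moreover have "1 / x * n = n / x" by simp
    ultimately show False using d5 by linarith
  qed
  then have "(\<Sum>k<n. M i k) = s i" if "i < n" for i
    using that unfolding e_def r_def row_total_def by (simp flip: of_nat_sum)
  then have "M \<in> zo_matrices n s t" using M unfolding zo_matrices_def col_matrices_def by blast
  then show ?thesis by auto
qed

section \<open>The expected permanent\<close>

context dense_degrees
begin

definition log_term :: "(nat \<Rightarrow> nat) \<Rightarrow> nat \<Rightarrow> real" where
  "log_term \<sigma> i = ln lam + rdev i + cdev (\<sigma> i) - ((rdev i)\<^sup>2 + (cdev (\<sigma> i))\<^sup>2) / 2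
      - lam / (1 - lam) * (rdev i * cdev (\<sigma> i)) + i * (1 - lam) / (lam * real n ^ 2)"

text \<open>The cardinality ratios telescope into conditional entry probabilities. Nonemptiness
  belongs to the induction: it is what allows \<open>dense_ensemble\<close> to be interpreted at
  step \<open>i\<close>, and positivity of the probability found there passes it on to the next
  step.\<close>

lemma ln_card_planted_diag:
  assumes \<sigma>: "\<sigma> permutes {..<n}" and i: "i \<le> n"
  shows "planted n s t (diag_set \<sigma> i) \<noteq> {} \<and>
    \<bar>ln (card (planted n s t (diag_set \<sigma> i)) / card (zo_matrices n s t)) - (\<Sum>r<i. log_term \<sigma> r)\<bar> \<le> i * (6 * x ^ 11 / (n * y))"
  using i
proof (induction i)
  case 0
  have "planted n s t (diag_set \<sigma> 0) = zo_matrices n s t" by (auto simp: planted_def diag_set_def)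
  moreover have "0 < card (zo_matrices n s t)" using zo_matrices_nonempty finite_zo_matrices by (simp add: card_gt_0_iff)
  ultimately show ?case using zo_matrices_nonempty by simp
next
  case (Suc i)
  let ?F = "diag_set \<sigma> i" and ?e = "6 * x ^ 11 / (n * y)"
  have IH: "planted n s t ?F \<noteq> {}"
    "\<bar>ln (card (planted n s t ?F) / card (zo_matrices n s t)) - (\<Sum>r<i. log_term \<sigma> r)\<bar> \<le> i * ?e"
    using Suc by auto
  have \<sigma>n: "\<sigma> r < n \<longleftrightarrow> r < n" for r using permutes_in_image[OF \<sigma>] by auto
  have inj: "\<sigma> r = \<sigma> r' \<longleftrightarrow> r = r'" for r r' using permutes_inj[OF \<sigma>] by (auto dest: injD)
  have F1: "?F \<subseteq> {..<n} \<times> {..<n}"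
  proof
    fix q assume "q \<in> ?F"
    then obtain r where r: "q = (r, \<sigma> r)" "r < i" unfolding diag_set_def by blast
    then have "r < n" using Suc.prems by linarith
    then show "q \<in> {..<n} \<times> {..<n}" using r \<sigma>n[of r] by simp
  qed
  have F2: "k = k'" if "(r, k) \<in> ?F" "(r, k') \<in> ?F" for r k k'
    using that unfolding diag_set_def by blast
  have F3: "r = r'" if "(r, k) \<in> ?F" "(r', k) \<in> ?F" for r r' k
  proof -
    have "k = \<sigma> r" "k = \<sigma> r'" using that unfolding diag_set_def by blast+
    then show ?thesis using inj[of r r'] by simp
  qed
  interpret D: dense_ensemble n s t lam x y ?F
    by unfold_locales (rule F1, rule F2, assumption+, rule F3, assumption+, rule IH(1))
  define p where "p = D.expect (\<lambda>M. real (M i (\<sigma> i)))"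
  have i: "i < n" "\<sigma> i < n" using Suc.prems \<sigma>n by auto
  have "\<bar>p - (real (t (\<sigma> i)) / n + (real (s i) - lam * n) / n
      + D.kap * (real (s i) - lam * n) * (real (t (\<sigma> i)) - lam * n) + card ?F * (1 - lam) / real n ^ 2)\<bar> \<le> 5 * x ^ 10 / (n * y)"
    unfolding p_def 
  proof (rule D.entry_probability[OF i])
    show "(i, q) \<notin> ?F" for q unfolding diag_set_def by blast
    show "(r, \<sigma> i) \<notin> ?F" for r
    proof
      assume "(r, \<sigma> i) \<in> ?F"
      then have "r < i" "\<sigma> i = \<sigma> r" unfolding diag_set_def by blast+
      then show False using inj[of i r] by simp
    qed
  qed
  then have "\<bar>p - (real (t (\<sigma> i)) / n + (real (s i) - lam * n) / n
      + (1 - 2 * lam) / (lam * (1 - lam) * real n ^ 2) * (real (s i) - lam * n) * (real (t (\<sigma> i)) - lam * n) + i * (1 - lam) / real n ^ 2)\<bar> \<le> 5 * x ^ 10 / (n * y)"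
    unfolding D.kap_def card_diag_set .
  from ln_entry_probability[OF i less_imp_le[OF i(1)] this]
  have p0: "0 < p" and lp: "\<bar>ln p - log_term \<sigma> i\<bar> \<le> ?e" unfolding log_term_def by auto
  let ?c = "real (card (planted n s t ?F))" and ?c' = "real (card (planted n s t (diag_set \<sigma> (Suc i))))" and ?z = "real (card (zo_matrices n s t))"
  have pc: "p = ?c' / ?c"
  proof -
    have "(\<Sum>M\<in>planted n s t ?F. real (M i (\<sigma> i))) = (\<Sum>M\<in>planted n s t ?F. if M i (\<sigma> i) = 1 then 1 else 0)"
    proof (rule sum.cong[OF refl])
      fix M assume "M \<in> planted n s t ?F"
      then show "real (M i (\<sigma> i)) = (if M i (\<sigma> i) = 1 then 1 else 0)" using planted_cases[of M n s t ?F i "\<sigma> i"] by auto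
    qed
    also have "\<dots> = ?c'"
      unfolding planted_diag_Suc using finite_planted by (simp add: sum.If_cases Int_def)
    finally show ?thesis unfolding p_def D.expect_def by simp
  qed
  have c0: "0 < ?c" using D.card_\<Omega>_pos by simp
  have c'0: "0 < ?c'" using p0 c0 unfolding pc by (simp add: zero_less_divide_iff)
  have z0: "0 < ?z" using zo_matrices_nonempty finite_zo_matrices by (simp add: card_gt_0_iff)
  have "ln (?c' / ?z) = ln (?c / ?z) + ln p"
  proof -
    have "?c' / ?z = (?c / ?z) * p" unfolding pc using c0 by simp
    moreover have "0 < ?c / ?z" using c0 z0 by simp
    ultimately show ?thesis using p0 by (simp only: ln_mult_pos)
  qed
  moreover have "(\<Sum>r<Suc i. log_term \<sigma> r) = (\<Sum>r<i. log_term \<sigma> r) + log_term \<sigma> i" by simp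
  moreover have "real (Suc i) * ?e = ?e + i * ?e" by (simp only: of_nat_Suc distrib_right mult_1_left)
  ultimately have "\<bar>ln (?c' / ?z) - (\<Sum>r<Suc i. log_term \<sigma> r)\<bar> \<le> real (Suc i) * ?e"
    using IH(2) lp by linarith
  moreover have "planted n s t (diag_set \<sigma> (Suc i)) \<noteq> {}" using c'0 by auto
  ultimately show ?case by blast
qed

text \<open>The linear deviations cancel and the squares do not depend on the order of the columns,
  so only the mixed term retains \<open>\<sigma>\<close>. The planted counts \<open>i\<close> run
  from 0 to \<open>n - 1\<close>; their sum \<open>n * (n - 1) / 2\<close> leaves the correction of
  order \<open>1 / n\<close>, later absorbed into the error.\<close>

lemma sum_log_term:
  assumes \<sigma>: "\<sigma> permutes {..<n}"
  shows "(\<Sum>i<n. log_term \<sigma> i) = n * ln lam + (1 - lam) / (2 * lam) - (1 - lam) / (2 * lam * n)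
     - ((\<Sum>j<n. (real (s j) - lam * n)\<^sup>2) + (\<Sum>k<n. (real (t k) - lam * n)\<^sup>2)) / (2 * lam\<^sup>2 * real n ^ 2)
     - lam / (1 - lam) * (\<Sum>i<n. rdev i * cdev (\<sigma> i))"
proof -
  have perm: "(\<Sum>i<n. g (\<sigma> i)) = (\<Sum>i<n. g i)" for g :: "nat \<Rightarrow> real"
    using sum.permute[OF \<sigma>, of g] by (simp add: o_def)
  have rd: "(\<Sum>i<n. (rdev i)\<^sup>2) = (\<Sum>j<n. (real (s j) - lam * n)\<^sup>2) / (lam * n)\<^sup>2"
    by (simp add: rdev_def power_divide flip: sum_divide_distrib)
  have cd: "(\<Sum>i<n. (cdev i)\<^sup>2) = (\<Sum>k<n. (real (t k) - lam * n)\<^sup>2) / (lam * n)\<^sup>2"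
    by (simp add: cdev_def power_divide flip: sum_divide_distrib)
  have gauss: "(\<Sum>i<n. real i) = n * (real n - 1) / 2"
    by (induction n) (auto simp: field_simps)
  have lin: "(\<Sum>i<n. i * (1 - lam) / (lam * real n ^ 2)) = (1 - lam) / (2 * lam) - (1 - lam) / (2 * lam * n)"
  proof -
    have "(\<Sum>i<n. i * (1 - lam) / (lam * real n ^ 2)) = (\<Sum>i<n. real i) * (1 - lam) / (lam * real n ^ 2)"
      by (simp flip: sum_divide_distrib sum_distrib_right)
    also have "\<dots> = (1 - lam) / (2 * lam) - (1 - lam) / (2 * lam * n)"
    proof -
      have "N * (N - 1) / 2 * u / (l * N\<^sup>2) = u / (2 * l) - u / (2 * l * N)" if "0 < N" "0 < l" for N u l :: real
        using that by (simp add: field_simps power2_eq_square)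
      then show ?thesis unfolding gauss using lam n_pos by simp
    qed
    finally show ?thesis .
  qed
  have "(\<Sum>i<n. log_term \<sigma> i) = n * ln lam + (\<Sum>i<n. rdev i) + (\<Sum>i<n. cdev (\<sigma> i))
      - ((\<Sum>i<n. (rdev i)\<^sup>2) + (\<Sum>i<n. (cdev (\<sigma> i))\<^sup>2)) / 2
      - lam / (1 - lam) * (\<Sum>i<n. rdev i * cdev (\<sigma> i)) + (\<Sum>i<n. i * (1 - lam) / (lam * real n ^ 2))"
    unfolding log_term_def by (simp add: sum.distrib sum_subtractf sum_distrib_left flip: sum_divide_distrib)
  also have "\<dots> = n * ln lam - ((\<Sum>j<n. (real (s j) - lam * n)\<^sup>2) / (lam * n)\<^sup>2 + (\<Sum>k<n. (real (t k) - lam * n)\<^sup>2) / (lam * n)\<^sup>2) / 2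
      - lam / (1 - lam) * (\<Sum>i<n. rdev i * cdev (\<sigma> i)) + ((1 - lam) / (2 * lam) - (1 - lam) / (2 * lam * n))"
    unfolding perm[of cdev] perm[of "\<lambda>k. (cdev k)\<^sup>2"] sum_rdev sum_cdev rd cd lin by simp
  finally show ?thesis by (simp add: add_divide_distrib power_mult_distrib)
qed

text \<open>Every diagonal has the same probability up to the factor
  \<open>exp (?\<theta> * X \<sigma>)\<close> and a relative error
  \<open>exp (7 * x ^ 11 / y)\<close>. The sum \<open>W\<close> of those factors lies between
  \<open>fact n\<close> and \<open>fact n * exp (x ^ 11 / y)\<close>, so 7 becomes 8, and one more
  factor \<open>x\<close> removes the constant.\<close>

lemma expected_perm_estimate:
  "\<exists>\<delta>. \<bar>\<delta>\<bar> \<le> x ^ 12 / y \<and> expected_perm n s t = fact n * lam ^ n *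
     exp ((1 - lam) / (2 * lam) - ((\<Sum>j<n. (real (s j) - lam * n)\<^sup>2) + (\<Sum>k<n. (real (t k) - lam * n)\<^sup>2)) / (2 * lam\<^sup>2 * real n ^ 2) + \<delta>)"
proof -
  let ?S = "{\<sigma>. \<sigma> permutes {..<n}}"
  let ?m = "(1 - lam) / (2 * lam) - ((\<Sum>j<n. (real (s j) - lam * n)\<^sup>2) + (\<Sum>k<n. (real (t k) - lam * n)\<^sup>2)) / (2 * lam\<^sup>2 * real n ^ 2)"
  let ?\<theta> = "lam / (1 - lam)"
  \<comment> \<open>The minus sign is attached to the row deviations, so that the parameter
    \<open>?\<theta>\<close> of \<open>exp_sum_permutations\<close> is nonnegative.\<close>
  define X where "X \<sigma> = (\<Sum>i<n. - rdev i * cdev (\<sigma> i))" for \<sigma>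
  define p where "p \<sigma> = card (planted n s t (diag_set \<sigma> n)) / card (zo_matrices n s t)" for \<sigma>
  let ?E = "7 * x ^ 11 / y"
  have z0: "0 < card (zo_matrices n s t)" using zo_matrices_nonempty finite_zo_matrices by (simp add: card_gt_0_iff)
  have lp: "0 < p \<sigma>" "\<bar>ln (p \<sigma>) - (n * ln lam + ?m + ?\<theta> * X \<sigma>)\<bar> \<le> ?E" if "\<sigma> \<in> ?S" for \<sigma>
  proof -
    have \<sigma>: "\<sigma> permutes {..<n}" using that by simp
    have ne: "planted n s t (diag_set \<sigma> n) \<noteq> {}" using ln_card_planted_diag[OF \<sigma> order_refl] by blast
    then show "0 < p \<sigma>" using z0 finite_planted by (simp add: p_def card_gt_0_iff)
    have 1: "\<bar>ln (p \<sigma>) - (\<Sum>r<n. log_term \<sigma> r)\<bar> \<le> n * (6 * x ^ 11 / (n * y))"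
      using ln_card_planted_diag[OF \<sigma> order_refl] unfolding p_def by blast
    have 2: "n * (6 * x ^ 11 / (n * y)) = 6 * x ^ 11 / y" using n_pos by simp
    have 3: "\<bar>(1 - lam) / (2 * lam * n)\<bar> \<le> x ^ 11 / y"
    proof -
      have "\<bar>(1 - lam) / (2 * lam * n)\<bar> = (1 - lam) / 2 * (1 / lam) * (1 / n)" using lam by simp
      also have "\<dots> \<le> 1 * x * (1 / y)"
        using lam inv_lam_le y_le_n y_pos n_pos x_pos by (intro mult_mono divide_left_mono) auto
      also have "\<dots> \<le> x ^ 11 / y" using x_pow_mono[of 1 11] y_pos by (simp add: divide_right_mono)
      finally show ?thesis .
    qed
    have 4: "(\<Sum>i<n. rdev i * cdev (\<sigma> i)) = - X \<sigma>" by (simp add: X_def sum_negf)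
    have 5: "?E = 6 * x ^ 11 / y + x ^ 11 / y" by (simp add: field_simps)
    have gen: "\<bar>L - (a + (b - c) + t * X)\<bar> \<le> E" if "\<bar>L - S\<bar> \<le> e1" "e1 = e2" "\<bar>d\<bar> \<le> e3" "E = e2 + e3" "S = a + b - d - c - t * (- X)"
      for L a b c d t X S e1 e2 e3 E :: real
    proof -
      have "L - (a + (b - c) + t * X) = (L - S) - d" using that(5) by simp
      then show ?thesis using that by linarith
    qed
    show "\<bar>ln (p \<sigma>) - (n * ln lam + ?m + ?\<theta> * X \<sigma>)\<bar> \<le> ?E"
      by (rule gen[OF 1 2 3 5 sum_log_term[OF \<sigma>, unfolded 4]])
  qed
  have ep: "expected_perm n s t = (\<Sum>\<sigma>\<in>?S. p \<sigma>)"
    unfolding expected_perm_def sum_perm_mat_eq p_def by (simp add: sum_divide_distrib)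
  define W where "W = (\<Sum>\<sigma>\<in>?S. exp (?\<theta> * X \<sigma>))"
  have th: "0 \<le> ?\<theta>" "?\<theta> \<le> x"
  proof -
    have "lam * (1 / (1 - lam)) \<le> 1 * x" using lam inv_colam_le by (intro mult_mono) auto
    then show "?\<theta> \<le> x" by simp
  qed (use lam in auto)
  have a0: "(\<Sum>i<n. - rdev i) = 0" using sum_rdev by (simp add: sum_negf)
  have rb: "\<bar>- rdev i\<bar> \<le> x ^ 3 / y" if "i < n" for i using rdev_bound[OF that] by simp
  have Wb: "W \<le> fact n * exp (4 * real n * (x ^ 3 / y) ^ 4 * ?\<theta>\<^sup>2)" "fact n \<le> W"
    unfolding W_def X_def
    using exp_sum_permutations[where b = cdev, OF n_pos a0 rb cdev_bound th(1)] by blast+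
  have W0: "0 < W" using Wb(2) by (smt (verit) fact_gt_zero)
  have sm: "4 * real n * (x ^ 3 / y) ^ 4 * ?\<theta>\<^sup>2 \<le> x ^ 11 / y"
  proof -
    have "4 * real n * (x ^ 3 / y) ^ 4 * ?\<theta>\<^sup>2 \<le> 4 * real n * (x ^ 3 / y) ^ 4 * x\<^sup>2"
      using th x_pos y_pos by (intro mult_left_mono power_mono) auto
    also have "\<dots> = x ^ 11 / y * (4 * x ^ 3 / y)"
      using y_pos by (simp add: n_y power_eq_if)
    also have "\<dots> \<le> x ^ 11 / y * 1"
    proof (rule mult_left_mono)
      have "4 * x ^ 3 \<le> x * x ^ 3" using x_ge by (intro mult_right_mono) auto
      also have "\<dots> = x ^ 4" by (simp add: power_eq_if)
      also have "\<dots> \<le> y" by (rule x_pow_y) simp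
      finally show "4 * x ^ 3 / y \<le> 1" using y_pos by simp
    qed (use x_pos y_pos in simp)
    finally show ?thesis by simp
  qed
  define T where "T = lam ^ n * exp ?m"
  have T0: "0 < T" using lam by (simp add: T_def)
  have Te: "exp (n * ln lam + ?m + z) = T * exp z" for z
    using lam by (simp add: T_def exp_add exp_of_nat_mult)
  have up: "p \<sigma> \<le> T * (exp ?E * exp (?\<theta> * X \<sigma>))" if "\<sigma> \<in> ?S" for \<sigma>
  proof -
    have "ln (p \<sigma>) \<le> n * ln lam + ?m + (?E + ?\<theta> * X \<sigma>)" using lp(2)[OF that] by linarith
    then have "exp (ln (p \<sigma>)) \<le> exp (n * ln lam + ?m + (?E + ?\<theta> * X \<sigma>))" by (simp only: exp_le_cancel_iff)
    then show ?thesis using lp(1)[OF that] by (simp only: exp_ln Te) (simp only: exp_add)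
  qed
  have lo: "T * (exp (- ?E) * exp (?\<theta> * X \<sigma>)) \<le> p \<sigma>" if "\<sigma> \<in> ?S" for \<sigma>
  proof -
    have "n * ln lam + ?m + (- ?E + ?\<theta> * X \<sigma>) \<le> ln (p \<sigma>)" using lp(2)[OF that] by linarith
    then have "exp (n * ln lam + ?m + (- ?E + ?\<theta> * X \<sigma>)) \<le> exp (ln (p \<sigma>))" by (simp only: exp_le_cancel_iff)
    then show ?thesis using lp(1)[OF that] by (simp only: exp_ln Te) (simp only: exp_add)
  qed
  have "expected_perm n s t \<le> (\<Sum>\<sigma>\<in>?S. T * (exp ?E * exp (?\<theta> * X \<sigma>)))" unfolding ep by (rule sum_mono) (rule up)
  also have "\<dots> = T * exp ?E * W" by (simp add: W_def sum_distrib_left mult.assoc)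
  also have "\<dots> \<le> T * exp ?E * (fact n * exp (x ^ 11 / y))"
  proof (rule mult_left_mono)
    have "fact n * exp (4 * real n * (x ^ 3 / y) ^ 4 * ?\<theta>\<^sup>2) \<le> fact n * exp (x ^ 11 / y)"
      using sm by (intro mult_left_mono) auto
    then show "W \<le> fact n * exp (x ^ 11 / y)" using Wb(1) by linarith
  qed (use T0 in simp)
  also have "\<dots> = fact n * T * exp (8 * x ^ 11 / y)"
    by (simp add: mult_ac flip: exp_add)
  finally have U: "expected_perm n s t \<le> fact n * T * exp (8 * x ^ 11 / y)" .
  have "fact n * T * exp (- (8 * x ^ 11 / y)) \<le> fact n * T * exp (- ?E)"
    using T0 x_pos y_pos by (intro mult_left_mono) (auto intro: divide_right_mono)
  also have "\<dots> \<le> T * exp (- ?E) * W" using Wb(2) T0 by (simp add: mult_ac)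
  also have "\<dots> = (\<Sum>\<sigma>\<in>?S. T * (exp (- ?E) * exp (?\<theta> * X \<sigma>)))" by (simp add: W_def sum_distrib_left mult.assoc)
  also have "\<dots> \<le> expected_perm n s t" unfolding ep by (rule sum_mono) (rule lo)
  finally have Lw: "fact n * T * exp (- (8 * x ^ 11 / y)) \<le> expected_perm n s t" .
  have fT: "0 < fact n * T" using T0 by simp
  have e0: "0 < expected_perm n s t" using Lw fT by (smt (verit) exp_gt_zero mult_pos_pos)
  define \<delta> where "\<delta> = ln (expected_perm n s t / (fact n * T))"
  have ed: "expected_perm n s t / (fact n * T) = exp \<delta>" using e0 fT by (simp add: \<delta>_def)
  then have "exp \<delta> \<le> exp (8 * x ^ 11 / y)" "exp (- (8 * x ^ 11 / y)) \<le> exp \<delta>"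
    using U Lw fT by (simp_all add: divide_le_eq le_divide_eq mult.commute flip: ed)
  then have "\<bar>\<delta>\<bar> \<le> 8 * x ^ 11 / y" by simp
  also have "\<dots> \<le> x ^ 12 / y"
  proof (rule divide_right_mono)
    have "8 * x ^ 11 \<le> x * x ^ 11" using x_ge by (intro mult_right_mono) auto
    then show "8 * x ^ 11 \<le> x ^ 12" by (simp add: power_eq_if)
  qed (use y_pos in simp)
  finally have "\<bar>\<delta>\<bar> \<le> x ^ 12 / y" .
  moreover have "expected_perm n s t = fact n * lam ^ n * exp (?m + \<delta>)"
  proof -
    have "expected_perm n s t = fact n * T * exp \<delta>" unfolding ed[symmetric] using T0 by simp
    then show ?thesis by (simp add: T_def exp_add mult.assoc)
  qed
  ultimately show ?thesis by blast
qed

end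

section \<open>Choice of the parameters\<close>

theorem theorem2p8:
  fixes a b :: real
  assumes "a > 0" and "b > 0" and "a + b < 1/2"
  shows "\<exists>\<epsilon>0>0. \<forall>\<epsilon>. 0 < \<epsilon> \<and> \<epsilon> < \<epsilon>0 \<longrightarrow>
    (\<forall>K>0. \<exists>Cc N. \<forall>n\<ge>N. \<forall>s t :: nat \<Rightarrow> nat.
      let sbar = (\<Sum>j<n. real (s j)) / real n;
          lam = sbar / real n;
          A = lam * (1 - lam) / 2;
          R = (\<Sum>j<n. (real (s j) - sbar)^2);
          C = (\<Sum>k<n. (real (t k) - sbar)^2)
      in ((\<forall>j<n. s j \<ge> 1) \<and> (\<forall>k<n. t k \<ge> 1)
          \<and> (\<Sum>j<n. s j) = (\<Sum>k<n. t k)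
          \<and> (\<forall>j<n. \<bar>real (s j) - sbar\<bar> \<le> K * real n powr (1/2 + \<epsilon>))
          \<and> (\<forall>k<n. \<bar>real (t k) - sbar\<bar> \<le> K * real n powr (1/2 + \<epsilon>))
          \<and> 0 < lam \<and> lam < 1
          \<and> (1 - 2 * lam)^2 / (3 * A) \<le> a * ln (real n))
        \<longrightarrow> (\<exists>\<delta>. \<bar>\<delta>\<bar> \<le> Cc * real n powr (- b) \<and>
              expected_perm n s t = fact n * lam ^ n *
                exp ((1 - lam) / (2 * lam) - (R + C) / (2 * lam^2 * real n ^ 2) + \<delta>)))"
proof -
  \<comment> \<open>Two demands are met at once: \<open>40 * \<epsilon> \<le> 1 / 2\<close> for
    \<open>x ^ 40 \<le> y\<close>, and \<open>12 * \<epsilon> - 1 / 2 \<le> - b\<close> for the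
    final error \<open>x ^ 12 / y\<close>.\<close>
  define \<epsilon>0 :: real where "\<epsilon>0 = (1 / 2 - b) / 40"
  have b: "0 < b" "b < 1 / 2" using assms by auto
  have "0 < \<epsilon>0" using b by (simp add: \<epsilon>0_def)
  moreover have "\<exists>Cc N. \<forall>n\<ge>N. \<forall>s t :: nat \<Rightarrow> nat.
      let sbar = (\<Sum>j<n. real (s j)) / real n;
          lam = sbar / real n;
          A = lam * (1 - lam) / 2;
          R = (\<Sum>j<n. (real (s j) - sbar)^2);
          C = (\<Sum>k<n. (real (t k) - sbar)^2)
      in ((\<forall>j<n. s j \<ge> 1) \<and> (\<forall>k<n. t k \<ge> 1)
          \<and> (\<Sum>j<n. s j) = (\<Sum>k<n. t k)
          \<and> (\<forall>j<n. \<bar>real (s j) - sbar\<bar> \<le> K * real n powr (1/2 + \<epsilon>))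
          \<and> (\<forall>k<n. \<bar>real (t k) - sbar\<bar> \<le> K * real n powr (1/2 + \<epsilon>))
          \<and> 0 < lam \<and> lam < 1
          \<and> (1 - 2 * lam)^2 / (3 * A) \<le> a * ln (real n))
        \<longrightarrow> (\<exists>\<delta>. \<bar>\<delta>\<bar> \<le> Cc * real n powr (- b) \<and>
              expected_perm n s t = fact n * lam ^ n *
                exp ((1 - lam) / (2 * lam) - (R + C) / (2 * lam^2 * real n ^ 2) + \<delta>))"
    if \<epsilon>: "0 < \<epsilon>" "\<epsilon> < \<epsilon>0" and K: "0 < K" for \<epsilon> K :: real
  proof -
    have "eventually (\<lambda>n::nat. 1000 \<le> real n powr \<epsilon>) at_top" using \<epsilon> by real_asymp
    moreover have "eventually (\<lambda>n::nat. K \<le> real n powr \<epsilon>) at_top" using \<epsilon> by real_asymp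
    moreover have "eventually (\<lambda>n::nat. real n ^ 10 * exp (- (real n powr \<epsilon>)) \<le> 1) at_top" using \<epsilon> by real_asymp
    moreover have "eventually (\<lambda>n::nat. 4 + 3 / 2 * a * ln (real n) \<le> real n powr \<epsilon>) at_top" using \<epsilon> assms(1) by real_asymp
    moreover have "eventually (\<lambda>n::nat. 0 < n) at_top" by (rule eventually_gt_at_top)
    ultimately have "eventually (\<lambda>n::nat. 0 < n \<and> 1000 \<le> real n powr \<epsilon> \<and> K \<le> real n powr \<epsilon>
        \<and> real n ^ 10 * exp (- (real n powr \<epsilon>)) \<le> 1 \<and> 4 + 3 / 2 * a * ln (real n) \<le> real n powr \<epsilon>) at_top"
      by eventually_elim auto
    then obtain N where N: "\<And>n::nat. n \<ge> N \<Longrightarrow> 0 < n \<and> 1000 \<le> real n powr \<epsilon> \<and> K \<le> real n powr \<epsilon>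
        \<and> real n ^ 10 * exp (- (real n powr \<epsilon>)) \<le> 1 \<and> 4 + 3 / 2 * a * ln (real n) \<le> real n powr \<epsilon>"
      unfolding eventually_sequentially by blast
    show ?thesis
      unfolding Let_def
    \<comment> \<open>From \<open>N\<close> on, all constants including \<open>K\<close> are
      absorbed by powers of \<open>x\<close>, so the constant in the error can be 1.\<close>
    proof (rule exI[of _ 1], rule exI[of _ N], intro allI impI)
      fix n :: nat and s t :: "nat \<Rightarrow> nat"
      define sbar where "sbar = (\<Sum>j<n. real (s j)) / real n"
      define lam where "lam = sbar / real n"
      assume n: "N \<le> n" and H0: "(\<forall>j<n. 1 \<le> s j) \<and> (\<forall>k<n. 1 \<le> t k) \<and> (\<Sum>j<n. s j) = (\<Sum>k<n. t k)
        \<and> (\<forall>j<n. \<bar>real (s j) - (\<Sum>j<n. real (s j)) / real n\<bar> \<le> K * real n powr (1/2 + \<epsilon>))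
        \<and> (\<forall>k<n. \<bar>real (t k) - (\<Sum>j<n. real (s j)) / real n\<bar> \<le> K * real n powr (1/2 + \<epsilon>))
        \<and> 0 < (\<Sum>j<n. real (s j)) / real n / real n \<and> (\<Sum>j<n. real (s j)) / real n / real n < 1
        \<and> (1 - 2 * ((\<Sum>j<n. real (s j)) / real n / real n))\<^sup>2
          / (3 * ((\<Sum>j<n. real (s j)) / real n / real n * (1 - (\<Sum>j<n. real (s j)) / real n / real n) / 2)) \<le> a * ln (real n)"
      note H = H0[folded sbar_def, folded lam_def]
      define x where "x = real n powr \<epsilon>"
      define y where "y = sqrt (real n)"
      have n0: "0 < n" and x1: "1000 \<le> x" and xK: "K \<le> x" and nx: "real n ^ 10 * exp (- x) \<le> 1"
        and ax: "4 + 3 / 2 * a * ln (real n) \<le> x"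
        using N[OF n] by (auto simp: x_def)
      have n1: "1 \<le> real n" using n0 by simp
      have sb: "sbar = lam * n" using n0 by (simp add: lam_def)
      have lam: "0 < lam" "lam < 1" using H by auto
      have xp: "x ^ m = real n powr (m * \<epsilon>)" for m
        using n0 by (simp add: x_def powr_power mult.commute)
      have yp: "y = real n powr (1 / 2)" by (simp add: y_def powr_half_sqrt)
      have dev: "K * real n powr (1 / 2 + \<epsilon>) \<le> x\<^sup>2 * y"
      proof -
        have "K * real n powr (1 / 2 + \<epsilon>) = K * (x * y)" by (simp add: powr_add x_def yp mult_ac)
        also have "\<dots> \<le> x * (x * y)" using xK x1 by (intro mult_right_mono) (auto simp: y_def)
        finally show ?thesis by (simp add: power2_eq_square)
      qed
      have sums: "(\<Sum>j<n. real (s j)) = lam * real n ^ 2" using n0 by (simp add: lam_def sbar_def power2_eq_square)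
      have sumt: "(\<Sum>k<n. real (t k)) = lam * real n ^ 2"
        using H sums by (metis of_nat_sum)
      have "dense_degrees n s t lam x y"
      proof
        have "40 * \<epsilon> \<le> 1 / 2" using \<epsilon> b by (simp add: \<epsilon>0_def)
        then show "x ^ 40 \<le> y" unfolding xp yp using n1 by (intro powr_mono) auto
        show "\<bar>real (s j) - lam * n\<bar> \<le> x\<^sup>2 * y" if "j < n" for j
          using H that dev unfolding sb by fastforce
        show "\<bar>real (t j) - lam * n\<bar> \<le> x\<^sup>2 * y" if "j < n" for j
          using H that dev unfolding sb by fastforce
        show "1 / x \<le> lam * (1 - lam)"
        proof -
          let ?p = "lam * (1 - lam)"
          have p: "0 < ?p" using lam by simp
          have "(1 - 2 * lam)\<^sup>2 / (3 * (?p / 2)) \<le> a * ln (real n)" using H by blast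
          then have "(1 - 2 * lam)\<^sup>2 \<le> a * ln (real n) * (3 * (?p / 2))" using p by (simp add: divide_le_eq)
          \<comment> \<open>This turns the density condition into
            \<open>1 \<le> (4 + 3 / 2 * a * ln n) * ?p\<close>. So the entry variance
            \<open>lam * (1 - lam)\<close> can decay at most logarithmically, which \<open>x\<close>
            dominates.\<close>
          moreover have "(1 - 2 * lam)\<^sup>2 = 1 - 4 * ?p" by (simp add: power2_eq_square algebra_simps)
          moreover have "(4 + 3 / 2 * a * ln (real n)) * ?p = 4 * ?p + a * ln (real n) * (3 * (?p / 2))" by (simp add: algebra_simps)
          ultimately have "1 \<le> (4 + 3 / 2 * a * ln (real n)) * ?p" by linarith
          also have "\<dots> \<le> x * ?p" using ax p by (intro mult_right_mono) auto
          finally show ?thesis using x1 by (simp add: divide_le_eq mult.commute)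
        qed
      qed (use n0 x1 nx lam sums sumt y_def in auto)
      then obtain \<delta> where d: "\<bar>\<delta>\<bar> \<le> x ^ 12 / y" and e: "expected_perm n s t = fact n * lam ^ n *
         exp ((1 - lam) / (2 * lam) - ((\<Sum>j<n. (real (s j) - lam * n)\<^sup>2) + (\<Sum>k<n. (real (t k) - lam * n)\<^sup>2)) / (2 * lam\<^sup>2 * real n ^ 2) + \<delta>)"
        using dense_degrees.expected_perm_estimate by blast
      have "x ^ 12 / y = real n powr (12 * \<epsilon> - 1 / 2)" unfolding xp yp by (simp add: powr_diff)
      also have "\<dots> \<le> 1 * real n powr (- b)"
      proof -
        have "12 * \<epsilon> - 1 / 2 \<le> - b" using \<epsilon> b by (simp add: \<epsilon>0_def)
        then show ?thesis using n1 by (simp add: powr_mono)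
      qed
      finally have "\<bar>\<delta>\<bar> \<le> 1 * real n powr (- b)" using d by linarith
      then show "\<exists>\<delta>. \<bar>\<delta>\<bar> \<le> 1 * real n powr (- b) \<and>
              expected_perm n s t = fact n * ((\<Sum>j<n. real (s j)) / real n / real n) ^ n *
                exp ((1 - (\<Sum>j<n. real (s j)) / real n / real n) / (2 * ((\<Sum>j<n. real (s j)) / real n / real n))
                  - ((\<Sum>j<n. (real (s j) - (\<Sum>j<n. real (s j)) / real n)^2) + (\<Sum>k<n. (real (t k) - (\<Sum>j<n. real (s j)) / real n)^2))
                    / (2 * ((\<Sum>j<n. real (s j)) / real n / real n)^2 * real n ^ 2) + \<delta>)"
        using e unfolding sb[symmetric] unfolding lam_def sbar_def by blast
    qed
  qed
  ultimately show ?thesis by blast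
qed

end
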